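(* Let $q\in(0,1)$, $\beta\in\mathbb{R}$, $1\leqslant s\leqslant\infty$, $s'=\frac{s}{s-1}$ (with $s'=\infty$ for $s=1$ and $s'=1$ for $s=\infty$), and let $C^\psi_{\beta,s}$ and $C^\psi_\beta H_\omega$ be the classes generated by the coefficients $\psi(k)=q^k/k$, $k\in\mathbb{N}$, of the Neumann kernel $N_{q,\beta}(t)=\sum_{k=1}^\infty\frac{q^k}{k}\cos\left(kt-\frac{\beta\pi}{2}\right)$. Let $n,p\in\mathbb{N}$, $p\leqslant n$, and let $\omega(t)$ be a convex (upwards) modulus of continuity satisfying $\lim_{t\to0}\frac{\omega(t)}{t}=\infty$. Then the following asymptotic equalities hold as $n-p\to\infty$: $$\mathcal{E}(C^\psi_{\beta,s};V_{n,p})=\frac{q^{n-p+1}}{p(n-p+1)}\Bigg(\frac{\|\cos t\|_{s'}}{\pi^{1+1/s'}}K_{q,p}(s')+\frac{O(1)}{n-p+1}\bigg(\frac{1}{(1-q)^{\sigma(s',p)}}+\frac{q}{(1-q)^2}\min\Big\{p,\frac{1}{1-q}\Big\}\bigg)\Bigg),$$ $$\mathcal{E}(C^\psi_{\beta}H_\omega;V_{n,p})=\frac{q^{n-p+1}}{p(n-p+1)}\Bigg(\frac{4}{\pi^2}\frac{1-q^{2p}}{1-q^2}\mathbf{K}(q^p)\int_0^{\pi/2}\omega\left(\frac{2t}{n-p+1}\right)\sin t\,dt$$ $$+\frac{O(1)}{n-p+1}\bigg(\frac{\omega(\pi)}{(1-q)^{\gamma(p)}}+\frac{q}{(1-q)^2}\min\Big\{p,\frac{1}{1-q}\Big\}\,\omega\Big(\frac{1}{n-p+1}\Big)\bigg)\Bigg),$$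 where $$K_{q,p}(s')=2^{-1/s'}\left\|\frac{\sqrt{1-2q^p\cos pt+q^{2p}}}{1-2q\cos t+q^2}\right\|_{s'},\qquad \sigma(s',p)=\begin{cases}1,& s'=1,\ p=1,\\ 2,& 1<s'\leqslant\infty,\ p=1,\\ 3,& 1\leqslant s'\leqslant\infty,\ p\in\mathbb{N}\setminus\{1\},\end{cases}$$ $\gamma(p)=2$ if $p=1$ and $\gamma(p)=3$ if $p=2,3,\ldots,n$, $\mathbf{K}(\rho)=\int_0^{\pi/2}\frac{dt}{\sqrt{1-\rho^2\sin^2t}}$ is the complete elliptic integral of the first kind, and the quantities $O(1)$ are uniformly bounded in $n$, $p$, $q$, $s$, $\omega$ and $\beta$.
   Context: Spaces. $L_s$ ($1\leqslant s<\infty$) is the space of $2\pi$-periodic functions with $\|f\|_s=\left(\int_0^{2\pi}|f(t)|^s\,dt\right)^{1/s}<\infty$; $L_\infty$ is the space of essentially bounded measurable $2\pi$-periodic functions with $\|f\|_\infty=\operatorname{ess\,sup}_t|f(t)|$; $C$ is the space of continuous $2\pi$-periodic functions with $\|f\|_C=\max_t|f(t)|$. By convention $1/s'=0$ when $s'=\infty$. $(\psi,\beta)$-derivative. Let $f\in L_1$ have Fourier series $\frac{a_0(f)}{2}+\sum_{k=1}^\infty(a_k(f)\cos kx+b_k(f)\sin kx)$, let $\psi(k)$, $k\in\mathbb{N}$, be a sequence of real numbers and $\beta\in\mathbb{R}$. If there is $\varphi\in L_1$ with Fourier series $\sum_{k=1}^\infty\frac{1}{\psi(k)}\left(a_k(f)\cos(kx+\frac{\beta\pi}{2})+b_k(f)\sin(kx+\frac{\beta\pi}{2})\right)$,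 then $\varphi$ is called the $(\psi,\beta)$-derivative of $f$, denoted $f^\psi_\beta$. For $\mathfrak{N}\subset L_1$, $L^\psi_\beta\mathfrak{N}$ is the set of $f\in L_1$ for which $f^\psi_\beta$ exists and belongs to $\mathfrak{N}$, and $C^\psi_\beta\mathfrak{N}=C\cap L^\psi_\beta\mathfrak{N}$. Classes. $U_s^0=\{\varphi\in L_s:\|\varphi\|_s\leqslant1,\ \int_0^{2\pi}\varphi(t)\,dt=0\}$ and $C^\psi_{\beta,s}=C^\psi_\beta U_s^0$. For a modulus of continuity $\omega$ (a continuous, nondecreasing, subadditive function on $[0,\infty)$ with $\omega(0)=0$), $H_\omega=\{\varphi\in C:\omega(\varphi;t)\leqslant\omega(t),\ t\geqslant0\}$, where $\omega(\varphi;t)=\sup_{|h|\leqslant t}\|\varphi(\cdot+h)-\varphi(\cdot)\|_C$. "Convex (upwards)" means concave in the usual modern terminology. De la Vallée Poussin sums. $V_{n,p}(f;x)=\frac1p\sum_{k=n-p}^{n-1}S_k(f;x)$, where $S_k(f;x)$ is the $k$th partial sum (harmonics of order at most $k$) of the Fourier series of $f$. For a class $\mathfrak{M}\subset C$, $\mathcal{E}(\mathfrak{M};V_{n,p})=\sup_{f\in\mathfrak{M}}\|f(\cdot)-V_{n,p}(f;\cdot)\|_C$. Meaning of the asymptotic notation. The parameter $p=p(n)$ may vary with $n$. "As $n-p\to\infty$, with $O(1)$ uniformly bounded in the listed parameters" means: there is an absolute constant $K$ such that for each $q\in(0,1)$ there is $N=N(q)$ such that, for all $n,p$ with $p\leqslant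 n$ and $n-p\geqslant N$ and all values of the other parameters, the formulas hold with quantities $O(1)$ of absolute value at most $K$. *)

theory Defs
  imports "HOL-Analysis.Analysis" "HOL-Probability.Essential_Supremum"
begin

text \<open>
  Elements of the Lebesgue spaces are represented by functions rather than by classes modulo
  equality almost everywhere.
\<close>

definition periodic2pi :: "(real \<Rightarrow> real) \<Rightarrow> bool" where
  "periodic2pi f \<longleftrightarrow> (\<forall>t. f (t + 2 * pi) = f t)"

definition Ls :: "ennreal \<Rightarrow> (real \<Rightarrow> real) set" where
  "Ls s = {f. periodic2pi f \<and> f \<in> borel_measurable lebesgue \<and>
     (if s = \<infinity> then esssup (lebesgue_on {0..2 * pi}) (\<lambda>t. ennreal \<bar>f t\<bar>) < \<infinity>
      else integrable (lebesgue_on {0..2 * pi}) (\<lambda>t. \<bar>f t\<bar> powr enn2real s))}"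

definition Ls_norm :: "ennreal \<Rightarrow> (real \<Rightarrow> real) \<Rightarrow> real" where
  "Ls_norm s f =
     (if s = \<infinity> then enn2real (esssup (lebesgue_on {0..2 * pi}) (\<lambda>t. ennreal \<bar>f t\<bar>))
      else (LINT t|lebesgue_on {0..2 * pi}. \<bar>f t\<bar> powr enn2real s) powr (1 / enn2real s))"

definition C_per :: "(real \<Rightarrow> real) set" where
  "C_per = {f. periodic2pi f \<and> continuous_on UNIV f}"

definition C_norm :: "(real \<Rightarrow> real) \<Rightarrow> real" where
  "C_norm f = (SUP t. \<bar>f t\<bar>)"

text \<open>In \<^typ>\<open>ennreal\<close>, \<open>s / (s - 1)\<close> is \<open>\<infinity>\<close> for \<open>s = 1\<close>, but would be \<open>0\<close> for \<open>s = \<infinity>\<close>.\<close>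

definition conj_exponent :: "ennreal \<Rightarrow> ennreal" where
  "conj_exponent s = (if s = 1 then \<infinity> else if s = \<infinity> then 1 else s / (s - 1))"

definition fourier_a :: "(real \<Rightarrow> real) \<Rightarrow> nat \<Rightarrow> real" where
  "fourier_a f k = 1 / pi * (LINT t|lebesgue_on {0..2 * pi}. f t * cos (real k * t))"

definition fourier_b :: "(real \<Rightarrow> real) \<Rightarrow> nat \<Rightarrow> real" where
  "fourier_b f k = 1 / pi * (LINT t|lebesgue_on {0..2 * pi}. f t * sin (real k * t))"

definition fourier_sum :: "nat \<Rightarrow> (real \<Rightarrow> real) \<Rightarrow> real \<Rightarrow> real" where
  "fourier_sum m f x = fourier_a f 0 / 2 +
     (\<Sum>k=1..m. fourier_a f k * cos (real k * x) + fourier_b f k * sin (real k * x))"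

definition vallee_poussin :: "nat \<Rightarrow> nat \<Rightarrow> (real \<Rightarrow> real) \<Rightarrow> real \<Rightarrow> real" where
  "vallee_poussin n p f x = 1 / real p * (\<Sum>k\<in>{n - p..<n}. fourier_sum k f x)"

text \<open>
  The Fourier series of \<open>\<phi>\<close> is prescribed harmonic by harmonic, and its constant term is zero.
\<close>

definition is_psi_beta_derivative ::
  "(nat \<Rightarrow> real) \<Rightarrow> real \<Rightarrow> (real \<Rightarrow> real) \<Rightarrow> (real \<Rightarrow> real) \<Rightarrow> bool" where
  "is_psi_beta_derivative \<psi> \<beta> f \<phi> \<longleftrightarrow> \<phi> \<in> Ls 1 \<and> fourier_a \<phi> 0 = 0 \<and>
     (\<forall>k\<ge>1. \<forall>x.
        fourier_a \<phi> k * cos (real k * x) + fourier_b \<phi> k * sin (real k * x) =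
        1 / \<psi> k * (fourier_a f k * cos (real k * x + \<beta> * pi / 2) +
                   fourier_b f k * sin (real k * x + \<beta> * pi / 2)))"

text \<open>
  The derivative is determined only up to equality almost everywhere, so it belongs to \<open>N\<close>
  if one of its representatives does.
\<close>

definition L_class ::
  "(nat \<Rightarrow> real) \<Rightarrow> real \<Rightarrow> (real \<Rightarrow> real) set \<Rightarrow> (real \<Rightarrow> real) set" where
  "L_class \<psi> \<beta> N = {f \<in> Ls 1. \<exists>\<phi>\<in>N. is_psi_beta_derivative \<psi> \<beta> f \<phi>}"

definition C_class ::
  "(nat \<Rightarrow> real) \<Rightarrow> real \<Rightarrow> (real \<Rightarrow> real) set \<Rightarrow> (real \<Rightarrow> real) set" where
  "C_class \<psi> \<beta> N = C_per \<inter> L_class \<psi> \<beta> N"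

definition U0 :: "ennreal \<Rightarrow> (real \<Rightarrow> real) set" where
  "U0 s = {\<phi> \<in> Ls s. Ls_norm s \<phi> \<le> 1 \<and> (LINT t|lebesgue_on {0..2 * pi}. \<phi> t) = 0}"

definition modulus_of_continuity :: "(real \<Rightarrow> real) \<Rightarrow> bool" where
  "modulus_of_continuity \<omega> \<longleftrightarrow>
     continuous_on {0..} \<omega> \<and> mono_on {0..} \<omega> \<and> \<omega> 0 = 0 \<and>
     (\<forall>a\<ge>0. \<forall>b\<ge>0. \<omega> (a + b) \<le> \<omega> a + \<omega> b)"

definition modulus :: "(real \<Rightarrow> real) \<Rightarrow> real \<Rightarrow> real" where
  "modulus \<phi> t = (SUP h\<in>{h. \<bar>h\<bar> \<le> t}. C_norm (\<lambda>x. \<phi> (x + h) - \<phi> x))"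

definition H_class :: "(real \<Rightarrow> real) \<Rightarrow> (real \<Rightarrow> real) set" where
  "H_class \<omega> = {\<phi> \<in> C_per. \<forall>t\<ge>0. modulus \<phi> t \<le> \<omega> t}"

text \<open>
  The supremum is taken in the extended reals, so that an equation with a real number includes
  the finiteness of the supremum.
\<close>

definition VP_error :: "(real \<Rightarrow> real) set \<Rightarrow> nat \<Rightarrow> nat \<Rightarrow> ereal" where
  "VP_error M n p = (SUP f\<in>M. ereal (C_norm (\<lambda>x. f x - vallee_poussin n p f x)))"

definition neumann_psi :: "real \<Rightarrow> nat \<Rightarrow> real" where
  "neumann_psi q k = q ^ k / real k"

definition K_qp :: "real \<Rightarrow> nat \<Rightarrow> ennreal \<Rightarrow> real" where
  "K_qp q p s' = 2 powr (- enn2real (1 / s')) *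
     Ls_norm s' (\<lambda>t. sqrt (1 - 2 * q ^ p * cos (real p * t) + q ^ (2 * p)) /
                      (1 - 2 * q * cos t + q\<^sup>2))"

definition elliptic_K :: "real \<Rightarrow> real" where
  "elliptic_K \<rho> = (LINT t|lebesgue_on {0..pi / 2}. 1 / sqrt (1 - \<rho>\<^sup>2 * (sin t)\<^sup>2))"

definition sigma_exp :: "ennreal \<Rightarrow> nat \<Rightarrow> nat" where
  "sigma_exp s' p = (if p = 1 then (if s' = 1 then 1 else 2) else 3)"

definition gamma_exp :: "nat \<Rightarrow> nat" where
  "gamma_exp p = (if p = 1 then 2 else 3)"

end

theory Submission
  imports Defs
begin

text \<open>
  With \<open>m = n - p + 1\<close>, the deviation \<open>f - V f\<close> is the convolution of the derivative of \<open>f\<close> with a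
  kernel which, up to a factor \<open>q ^ m / (p m)\<close> and an error \<open>O(1 / m)\<close>, is
  \<open>Re (exp (\<i> (m t - \<beta> \<pi> / 2)) Z t)\<close> with the slowly varying amplitude
  \<open>Z t = (1 - z ^ p) / (1 - z)\<^sup>2\<close>, \<open>z = q exp (\<i> t)\<close>.

  For the classes \<open>U0 s\<close>, freeze \<open>Z\<close> on the \<open>m\<close> cells of length \<open>2 \<pi> / m\<close>. The \<open>L\<close>-norm of the frozen
  wave is exactly \<open>(2 \<pi>) powr (- 1 / s')\<close> times the norm of \<open>cos\<close> times the norm of the frozen
  amplitude, and the Hoelder-extremal function is an odd function of the frozen wave, so that it
  has mean zero and belongs to the class.

  For \<open>H_class \<omega>\<close>, write the wave as \<open>\<bar>Z t\<bar> cos (m \<tau> t)\<close>, substitute \<open>u = \<tau> t\<close>, freeze \<open>\<bar>Z\<bar>\<close> on half-periods of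
  \<open>cos (m u)\<close> and pair the points symmetric about each zero of the cosine; concavity of \<open>\<omega>\<close> makes the
  odd function \<open>sgn x * \<omega> (2 \<bar>x\<bar>) / 2\<close>, folded periodically, extremal. The elliptic integral is the mean
  of \<open>\<bar>Z\<bar>\<close>.
\<close>

section \<open>Integration over a period\<close>

text \<open>The two kinds of classes call for two ways of freezing. For \<open>U0 s\<close> the
  extremal function may jump, so the complex amplitude is frozen together with its phase: the
  integral of a power of a pure cosine over a full period is independent of the phase, and only
  \<open>cmod\<close> survives. A function built from frozen phases jumps from cell to cell and
  cannot serve for \<open>H_class \<omega>\<close>. There the substitution straightens the phase and
  only the modulus is frozen; distances are distorted by a factor
  \<open>1 + O(1 / (m (1 - q)))\<close>, which costs a relative error because
  \<open>\<omega> (c x) \<le> c \<omega> x\<close> for \<open>c \<ge> 1\<close>.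

  Uniformity in \<open>p\<close> rests on one estimate: the logarithmic derivative of
  \<open>Z\<close> is at most \<open>3 / (1 - q)\<close> for every \<open>p\<close>. A freezing
  error is this rate times the maximum of the amplitude, which is at most \<open>1 / (1 - q)\<close>
  for \<open>p = 1\<close> and \<open>2 / (1 - q) ^ 2\<close> otherwise; hence the exponents 2 and
  3. For \<open>s = 1\<close> the dual norm is a maximum, and narrow bumps stand in for point
  masses.\<close>

abbreviation circ :: "real measure" where "circ \<equiv> lebesgue_on {0..2 * pi}"

lemma finite_measure_circ: "finite_measure circ"
  by (rule finite_measure_lebesgue_on) auto

lemma measure_circ [simp]: "measure circ {0..2 * pi} = 2 * pi"
  by (simp add: measure_restrict_space)

lemma borel_measurable_circ:
  "f \<in> borel_measurable lebesgue \<Longrightarrow> f \<in> borel_measurable circ"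
  by (rule measurable_restrict_space1)

lemma borel_measurable_circ_borel:
  "f \<in> borel_measurable borel \<Longrightarrow> f \<in> borel_measurable circ"
  by (rule borel_measurable_circ) (simp add: measurable_completion)

lemma integrable_lebesgue_on_bounded:
  fixes f :: "real \<Rightarrow> 'a::euclidean_space"
  assumes "f \<in> borel_measurable borel" "\<And>x. norm (f x) \<le> C"
  shows "integrable (lebesgue_on {a..b}) f"
proof -
  interpret finite_measure "lebesgue_on {a..b}" by (rule finite_measure_lebesgue_on) auto
  have "f \<in> borel_measurable (lebesgue_on {a..b})"
    using assms(1) by (intro measurable_restrict_space1) (simp add: measurable_completion)
  then show ?thesis
    using assms(2) by (intro integrable_const_bound[of _ C]) auto
qed

lemma integrable_on_bounded_borel:
  fixes f :: "real \<Rightarrow> 'a::euclidean_space"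
  assumes "f \<in> borel_measurable borel" "\<And>x. norm (f x) \<le> C"
  shows "f integrable_on {a..b}"
  by (rule integrable_on_lebesgue_on[OF integrable_lebesgue_on_bounded[OF assms]]) auto

lemma LINT_circ_eq_integral:
  fixes f :: "real \<Rightarrow> 'a::euclidean_space"
  assumes "integrable circ f"
  shows "integral\<^sup>L circ f = integral {0..2 * pi} f"
  by (rule lebesgue_integral_eq_integral) (use assms in auto)

lemma integrable_circ_continuous:
  fixes f :: "real \<Rightarrow> 'a::euclidean_space"
  assumes "continuous_on UNIV f"
  shows "integrable circ f"
  by (rule continuous_imp_integrable_real) (use assms continuous_on_subset in blast)

lemma LINT_circ_continuous:
  fixes f :: "real \<Rightarrow> 'a::euclidean_space"
  assumes "continuous_on UNIV f"
  shows "integral\<^sup>L circ f = integral {0..2 * pi} f"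
  by (rule LINT_circ_eq_integral) (rule integrable_circ_continuous[OF assms])

lemma periodic_int_multiple:
  fixes G :: "real \<Rightarrow> 'a" and k :: int
  assumes per: "\<And>t. G (t + T) = G t"
  shows "G (t + of_int k * T) = G t"
proof -
  have nat: "G (t + of_nat n * T) = G t" for n t
  proof (induction n)
    case (Suc n)
    have "G (t + of_nat (Suc n) * T) = G ((t + of_nat n * T) + T)" by (simp add: algebra_simps)
    then show ?case using per Suc by simp
  qed simp
  show ?thesis
  proof (cases "k \<ge> 0")
    case True
    then show ?thesis using nat[of t "nat k"] by simp
  next
    case False
    then show ?thesis using nat[of "t + of_int k * T" "nat (-k)"] by (simp add: algebra_simps)
  qed
qed

text \<open>For \<open>x \<ge> 0\<close> the interval \<open>{0..x + T}\<close> is cut once at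
  \<open>x\<close> and once at \<open>T\<close>; the pieces \<open>{0..x}\<close> and
  \<open>{T..x + T}\<close> agree by periodicity and cancel. A general start is first moved to the
  right by a multiple of \<open>T\<close>.\<close>

lemma integral_periodic:
  fixes G :: "real \<Rightarrow> 'a::euclidean_space"
  assumes per: "\<And>t. G (t + T) = G t" and T: "T > 0"
    and int: "\<And>a b. G integrable_on {a..b}"
  shows "integral {a..a + T} G = integral {0..T} G"
proof -
  have shift: "integral {u..v} G = integral {u + of_int k * T..v + of_int k * T} G" for u v k
    using integral_shift_real_ivl[of "u + of_int k * T" "of_int k * T" "v + of_int k * T" G]
    by (simp add: periodic_int_multiple[of G, OF per])
  have pos: "integral {x..x + T} G = integral {0..T} G" if "x \<ge> 0" for x
  proof -
    have "integral {0..x} G + integral {x..x + T} G = integral {0..x + T} G"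
      using that T int by (intro Henstock_Kurzweil_Integration.integral_combine) auto
    moreover have "integral {0..T} G + integral {T..x + T} G = integral {0..x + T} G"
      using that T int by (intro Henstock_Kurzweil_Integration.integral_combine) auto
    moreover have "integral {0..x} G = integral {T..x + T} G"
      using shift[of 0 x 1] by simp
    ultimately show ?thesis by (metis add.commute add_left_cancel)
  qed
  define k where "k = \<lceil>- a / T\<rceil>"
  have "a + of_int k * T \<ge> 0"
  proof -
    have "- a / T \<le> of_int k" unfolding k_def by simp
    then show ?thesis using T by (simp add: field_simps)
  qed
  from pos[OF this] show ?thesis
    using shift[of a "a + T" k] by (simp add: algebra_simps)
qed

lemma LINT_circ_reflect:
  fixes G :: "real \<Rightarrow> 'a::euclidean_space"
  assumes per: "\<And>t. G (t + 2 * pi) = G t" and cont: "continuous_on UNIV G"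
  shows "(LINT t|circ. G (x - t)) = integral\<^sup>L circ G"
proof -
  have int: "G integrable_on {a..b}" for a b
    by (rule integrable_continuous_interval) (use cont continuous_on_subset in blast)
  have c: "continuous_on UNIV (\<lambda>t. G (x - t))"
    by (rule continuous_on_compose2[OF cont]) (auto intro!: continuous_intros)
  have "(LINT t|circ. G (x - t)) = integral {0..2*pi} (\<lambda>t. G (x - t))"
    by (rule LINT_circ_continuous[OF c])
  also have "\<dots> = integral {-2*pi..0} (\<lambda>t. G (x + t))"
    using Henstock_Kurzweil_Integration.integral_reflect_real[of "2*pi" 0 "\<lambda>t. G (x - t)"] by simp
  also have "\<dots> = integral {-2*pi+x..0+x} G"
    using integral_shift_real_ivl[of "-2*pi+x" x "0+x" G] by (simp add: add.commute)
  also have "\<dots> = integral {0..2*pi} G"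
    using integral_periodic[OF per _ int, of "-2*pi+x"] by simp
  finally show ?thesis using LINT_circ_continuous[OF cont] by simp
qed

lemma LINT_circ_shift:
  fixes G :: "real \<Rightarrow> 'a::euclidean_space"
  assumes per: "\<And>t. G (t + 2 * pi) = G t" and cont: "continuous_on UNIV G"
  shows "(LINT t|circ. G (t + c)) = integral\<^sup>L circ G"
proof -
  have int: "G integrable_on {a..b}" for a b
    by (rule integrable_continuous_interval) (use cont continuous_on_subset in blast)
  have ct: "continuous_on UNIV (\<lambda>t. G (t + c))"
    by (rule continuous_on_compose2[OF cont]) (auto intro!: continuous_intros)
  have "(LINT t|circ. G (t + c)) = integral {0..2*pi} (\<lambda>t. G (t + c))"
    by (rule LINT_circ_continuous[OF ct])
  also have "\<dots> = integral {c..c+2*pi} G"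
    using integral_shift_real_ivl[of c c "c+2*pi" G] by simp
  also have "\<dots> = integral {0..2*pi} G"
    using integral_periodic[OF per _ int, of c] by simp
  finally show ?thesis using LINT_circ_continuous[OF cont] by simp
qed

section \<open>Orthogonality of harmonics and termwise integration of series\<close>

lemma periodic_cos_nat: "cos (real k * (t + 2 * pi) + a) = cos (real k * t + a)"
proof -
  have "cos (real k * t + a + 2 * pi * real_of_int (int k)) = cos (real k * t + a)"
    by (simp add: cos_add cos_int_2pin sin_int_2pin del: of_int_of_nat_eq)
  then show ?thesis by (simp add: algebra_simps)
qed

lemma periodic_sin_nat: "sin (real k * (t + 2 * pi) + a) = sin (real k * t + a)"
proof -
  have "sin (real k * t + a + 2 * pi * real_of_int (int k)) = sin (real k * t + a)"
    by (simp add: sin_add cos_int_2pin sin_int_2pin del: of_int_of_nat_eq)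
  then show ?thesis by (simp add: algebra_simps)
qed

lemma LINT_circ_cos:
  assumes "k > 0"
  shows "(LINT t|circ. cos (real k * t + a)) = 0"
proof -
  have "((\<lambda>t. cos (real k * t + a)) has_integral
      (sin (real k * (2*pi) + a) / k - sin (real k * 0 + a) / k)) {0..2*pi}"
    by (rule fundamental_theorem_of_calculus)
      (auto intro!: derivative_eq_intros simp: has_real_derivative_iff_has_vector_derivative[symmetric] assms[THEN less_imp_neq, symmetric])
  moreover have "sin (real k * (2*pi) + a) = sin a"
    using periodic_sin_nat[of k 0 a] by simp
  ultimately show ?thesis
    by (subst LINT_circ_continuous) (auto intro!: continuous_intros simp: integral_unique)
qed

text \<open>The phases are left free because a sine is a cosine shifted by \<open>pi / 2\<close>:
  one relation covers both kinds of Fourier coefficients. With \<open>k > 0\<close> the frequency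
  \<open>k + l\<close> is positive, so that only the difference term can survive.\<close>

lemma LINT_circ_cos_cos:
  assumes "k > 0"
  shows "(LINT t|circ. cos (real k * t + a) * cos (real l * t + b)) = (if k = l then pi * cos (a - b) else 0)"
proof -
  have ic: "integrable circ (\<lambda>t. cos (x * t + y))" for x y
    by (rule integrable_circ_continuous) (auto intro!: continuous_intros)
  have "(LINT t|circ. cos (real k * t + a) * cos (real l * t + b)) =
      (LINT t|circ. cos (real (k + l) * t + (a + b)) / 2 + cos ((real k - real l) * t + (a - b)) / 2)"
    by (rule arg_cong[where f = "integral\<^sup>L _"], rule ext)
      (simp add: cos_times_cos algebra_simps add_divide_distrib)
  also have "\<dots> = (LINT t|circ. cos ((real k - real l) * t + (a - b))) / 2"
    using LINT_circ_cos[of "k + l" "a + b"] assms ic[of "real k + real l" "a+b"] by (subst Bochner_Integration.integral_add) (auto intro!: integrable_divide ic)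
  also have "(LINT t|circ. cos ((real k - real l) * t + (a - b))) = (if k = l then 2 * pi * cos (a - b) else 0)"
  proof (cases k l rule: linorder_cases)
    case equal
    then show ?thesis by simp
  next
    case greater
    have "(LINT t|circ. cos ((real k - real l) * t + (a - b))) = (LINT t|circ. cos (real (k - l) * t + (a - b)))"
      using greater by (simp add: of_nat_diff)
    then show ?thesis using greater LINT_circ_cos[of "k - l" "a - b"] by simp
  next
    case less
    have "(LINT t|circ. cos ((real k - real l) * t + (a - b))) = (LINT t|circ. cos (real (l - k) * t + (b - a)))"
      using less by (subst cos_minus[symmetric]) (simp add: of_nat_diff algebra_simps)
    then show ?thesis using less LINT_circ_cos[of "l - k" "b - a"] by simp
  qed
  finally show ?thesis by (cases "k = l") auto
qed

text \<open>The terms have L1 norms at most \<open>\<bar>c k\<bar>\<close> times that of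
  \<open>\<phi>\<close>, so the series may be integrated termwise. The functions \<open>e k\<close>
  stay abstract because they will be shifted cosines in some places and rescaled harmonics of a
  given function in another.\<close>

lemma cos_series_sums_LINT:
  fixes \<phi> :: "real \<Rightarrow> real"
  assumes \<phi>: "integrable circ \<phi>" and c: "summable (\<lambda>k. \<bar>c k\<bar>)"
    and e: "\<And>k. continuous_on UNIV (e k)" "\<And>k t. \<bar>e k t\<bar> \<le> (1::real)"
  shows "integrable circ (\<lambda>t. \<phi> t * (\<Sum>k. c k * e k t))"
    and "(\<lambda>k. c k * (LINT t|circ. \<phi> t * e k t)) sums (LINT t|circ. \<phi> t * (\<Sum>k. c k * e k t))"
proof -
  have me: "e k \<in> borel_measurable circ" for k
    using integrable_circ_continuous[OF e(1)[of k]] by auto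
  have i: "integrable circ (\<lambda>t. \<phi> t * e k t)" for k
    by (rule Bochner_Integration.integrable_bound[OF \<phi>])
      (use \<phi> me e(2) in \<open>auto simp: abs_mult intro!: mult_left_le borel_measurable_times\<close>)
  have s: "summable (\<lambda>k. \<bar>\<phi> t * (c k * e k t)\<bar>)" for t
    by (rule summable_comparison_test[OF _ summable_mult[OF c, of "\<bar>\<phi> t\<bar>"]])
      (use e(2) in \<open>auto simp: abs_mult intro!: mult_left_mono mult_left_le\<close>)
  have s': "summable (\<lambda>k. c k * e k t)" for t
    by (rule summable_comparison_test[OF _ c])
      (use e(2) in \<open>auto simp: abs_mult intro!: mult_left_mono mult_left_le\<close>)
  have i2: "integrable circ (\<lambda>t. \<phi> t * (c k * e k t))" for k
    using integrable_mult_right[OF i[of k], of "c k"] by (simp add: algebra_simps)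
  have s2: "summable (\<lambda>k. LINT t|circ. norm (\<phi> t * (c k * e k t)))"
  proof (rule summable_comparison_test[OF _ summable_mult2[OF c, of "LINT t|circ. \<bar>\<phi> t\<bar>"]], intro exI allI impI)
    fix k :: nat
    have "(LINT t|circ. norm (\<phi> t * (c k * e k t))) \<le> (LINT t|circ. \<bar>c k\<bar> * \<bar>\<phi> t\<bar>)"
    proof (rule integral_mono)
      fix t
      have "\<bar>\<phi> t * c k\<bar> * \<bar>e k t\<bar> \<le> \<bar>\<phi> t * c k\<bar> * 1" by (rule mult_left_mono) (use e(2) in auto)
      then show "norm (\<phi> t * (c k * e k t)) \<le> \<bar>c k\<bar> * \<bar>\<phi> t\<bar>" by (simp add: abs_mult mult_ac)
    qed (use integrable_norm[OF i2[of k]] \<phi> in auto)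
    then show "norm (LINT t|circ. norm (\<phi> t * (c k * e k t))) \<le> \<bar>c k\<bar> * (LINT t|circ. \<bar>\<phi> t\<bar>)"
      by (simp add: integral_nonneg_AE)
  qed
  have eq: "(\<Sum>k. \<phi> t * (c k * e k t)) = \<phi> t * (\<Sum>k. c k * e k t)" for t
    by (rule suminf_mult[OF s'])
  have ae: "AE t in circ. summable (\<lambda>k. norm (\<phi> t * (c k * e k t)))" using s by simp
  have eq2: "(LINT t|circ. \<phi> t * (c k * e k t)) = c k * (LINT t|circ. \<phi> t * e k t)" for k
    by (simp add: mult.left_commute[of "\<phi> _"])
  show "integrable circ (\<lambda>t. \<phi> t * (\<Sum>k. c k * e k t))"
    "(\<lambda>k. c k * (LINT t|circ. \<phi> t * e k t)) sums (LINT t|circ. \<phi> t * (\<Sum>k. c k * e k t))"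
    using integrable_suminf[OF i2 ae s2] sums_integral[OF i2 ae s2] by (simp_all only: eq eq2)
qed

lemma cos_series_continuous:
  fixes c :: "nat \<Rightarrow> real"
  assumes c: "summable (\<lambda>k. \<bar>c k\<bar>)"
    and e: "\<And>k. continuous_on UNIV (e k)" "\<And>k t. \<bar>e k t\<bar> \<le> (1::real)"
  shows "continuous_on UNIV (\<lambda>t::real. \<Sum>k. c k * e k t)"
proof -
  have "uniform_limit UNIV (\<lambda>n t. \<Sum>k<n. c k * e k t) (\<lambda>t. \<Sum>k. c k * e k t) sequentially"
    by (rule Weierstrass_m_test[OF _ c])
      (use e(2) in \<open>auto simp: abs_mult intro!: mult_left_le\<close>)
  then show ?thesis
    by (rule uniform_limit_theorem[rotated]) (auto intro!: continuous_intros always_eventually e(1))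
qed

section \<open>Poisson means and Fourier inversion\<close>

definition poisson :: "real \<Rightarrow> real \<Rightarrow> real" where
  "poisson r u = (1 - r\<^sup>2) / (1 - 2 * r * cos u + r\<^sup>2)"

text \<open>The denominator is the squared distance from 1 to the point \<open>r * cis u\<close>.
  Besides positivity, this identity later gives the quotient inside \<open>K_qp\<close> as the
  modulus of \<open>vp_mult\<close>.\<close>

lemma poisson_denom: "1 - 2 * r * cos u + r\<^sup>2 = (cmod (1 - of_real r * cis u))\<^sup>2"
proof -
  have "(cmod (1 - of_real r * cis u))\<^sup>2 = (1 - r * cos u)\<^sup>2 + (r * sin u)\<^sup>2"
    by (simp only: cmod_power2) simp
  also have "\<dots> = 1 - 2 * r * cos u + r\<^sup>2 * ((sin u)\<^sup>2 + (cos u)\<^sup>2)"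
    by (simp add: power2_diff power_mult_distrib distrib_left del: sin_cos_squared_add sin_cos_squared_add2)
  finally show ?thesis unfolding sin_cos_squared_add by simp
qed

lemma poisson_denom_pos:
  fixes r u :: real
  assumes "\<bar>r\<bar> < 1"
  shows "1 - 2 * r * cos u + r\<^sup>2 > 0"
proof -
  have "cmod (of_real r * cis u) < 1" using assms by (simp add: norm_mult)
  then have "1 - of_real r * cis u \<noteq> 0" by force
  then show ?thesis unfolding poisson_denom by simp
qed

lemma poisson_pos: "\<bar>r\<bar> < 1 \<Longrightarrow> poisson r u > 0"
  unfolding poisson_def using poisson_denom_pos[of r u] by (simp add: abs_square_less_1)

definition poisson_coeff :: "real \<Rightarrow> nat \<Rightarrow> real" where
  "poisson_coeff r k = (if k = 0 then 1 else 2 * r ^ k)"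

lemma summable_poisson_coeff: "\<bar>r\<bar> < 1 \<Longrightarrow> summable (\<lambda>k. \<bar>poisson_coeff r k\<bar>)"
  by (rule summable_comparison_test[OF _ summable_mult[of "\<lambda>k. \<bar>r\<bar> ^ k" 2]])
    (auto simp: poisson_coeff_def abs_mult power_abs summable_geometric)

lemma poisson_sums:
  assumes r: "\<bar>r\<bar> < 1"
  shows "(\<lambda>k. poisson_coeff r k * cos (real k * u)) sums poisson r u"
proof -
  define z where "z = of_real r * cis u"
  have nz: "cmod z < 1" using r by (simp add: z_def norm_mult)
  then have nz1: "1 - z \<noteq> 0" by force
  have "(\<lambda>k. z ^ k) sums (1 / (1 - z))" using nz by (rule geometric_sums)
  then have "(\<lambda>k. Re (z ^ k)) sums Re (1 / (1 - z))" by (rule sums_Re)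
  moreover have "Re (z ^ k) = r ^ k * cos (real k * u)" for k
    by (simp add: z_def power_mult_distrib Complex.DeMoivre flip: of_real_power)
  ultimately have "(\<lambda>k. 2 * (r ^ k * cos (real k * u)) - (if k = 0 then 1 else 0)) sums (2 * Re (1 / (1 - z)) - 1)"
    using sums_single[of 0 "\<lambda>_. 1::real"] by (intro sums_diff sums_mult) auto
  moreover have "2 * (r ^ k * cos (real k * u)) - (if k = 0 then 1 else 0) = poisson_coeff r k * cos (real k * u)" for k
    by (simp add: poisson_coeff_def)
  moreover have "2 * Re (1 / (1 - z)) - 1 = poisson r u"
  proof -
    have c: "(cmod (1 - z))\<^sup>2 = 1 - 2 * r * cos u + r\<^sup>2" unfolding z_def poisson_denom ..
    have "Re (1 / (1 - z)) = Re (1 - z) / (cmod (1 - z))\<^sup>2"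
      by (simp add: Re_divide cmod_power2)
    also have "\<dots> = (1 - r * cos u) / (1 - 2 * r * cos u + r\<^sup>2)"
      unfolding c by (simp add: z_def)
    finally show ?thesis
      using poisson_denom_pos[OF r, of u] unfolding poisson_def by (simp add: field_simps)
  qed
  ultimately show ?thesis by simp
qed

lemma LINT_poisson_sums:
  assumes \<phi>: "integrable circ \<phi>" and r: "\<bar>r\<bar> < 1"
  shows "integrable circ (\<lambda>t. \<phi> t * poisson r (x - t))"
    and "(\<lambda>k. poisson_coeff r k * (LINT t|circ. \<phi> t * cos (real k * (x - t)))) sums
      (LINT t|circ. \<phi> t * poisson r (x - t))"
proof -
  have eq: "(\<Sum>k. poisson_coeff r k * cos (real k * (x - t))) = poisson r (x - t)" for t
    using poisson_sums[OF r] by (rule sums_unique[symmetric])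
  have e: "continuous_on UNIV (\<lambda>t. cos (real k * (x - t)))" for k
    by (intro continuous_intros)
  show "integrable circ (\<lambda>t. \<phi> t * poisson r (x - t))"
    "(\<lambda>k. poisson_coeff r k * (LINT t|circ. \<phi> t * cos (real k * (x - t)))) sums
      (LINT t|circ. \<phi> t * poisson r (x - t))"
    using cos_series_sums_LINT[OF \<phi> summable_poisson_coeff[OF r], of "\<lambda>k t. cos (real k * (x - t))"] e
    by (simp_all add: eq)
qed

lemma LINT_poisson:
  assumes r: "\<bar>r\<bar> < 1"
  shows "(LINT t|circ. poisson r (x - t)) = 2 * pi"
proof -
  have "(\<lambda>k. poisson_coeff r k * (LINT t|circ. 1 * cos (real k * (x - t)))) sums
      (LINT t|circ. 1 * poisson r (x - t))"
    by (rule LINT_poisson_sums[OF _ r]) (rule integrable_circ_continuous, simp)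
  moreover have "poisson_coeff r k * (LINT t|circ. 1 * cos (real k * (x - t))) = (if k = 0 then 2 * pi else 0)" for k
  proof (cases "k = 0")
    case False
    have "(LINT t|circ. 1 * cos (real k * (x - t))) = (LINT t|circ. cos (real k * t + (- real k * x)))"
      by (subst cos_minus[symmetric]) (simp add: algebra_simps)
    then show ?thesis using False LINT_circ_cos[of k "- real k * x"] by simp
  qed (simp add: poisson_coeff_def)
  ultimately have "(\<lambda>k. if k = 0 then 2 * pi else 0) sums (LINT t|circ. poisson r (x - t))"
    by simp
  then show ?thesis using sums_single[of 0 "\<lambda>_. 2 * pi"] sums_unique2 by blast
qed

text \<open>Besides the constant term only the first harmonic of the kernel contributes, and it
  carries the factor \<open>r\<close>. The result vanishes as \<open>r\<close> tends to 1, which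
  expresses the concentration of the kernel at 0.\<close>

lemma LINT_one_minus_cos_poisson:
  assumes r: "\<bar>r\<bar> < 1"
  shows "(LINT t|circ. (1 - cos (x - t)) * poisson r (x - t)) = 2 * pi * (1 - r)"
proof -
  have i: "integrable circ (\<lambda>t. cos (x - t))"
    by (rule integrable_circ_continuous) (intro continuous_intros)
  have "(\<lambda>k. poisson_coeff r k * (LINT t|circ. cos (x - t) * cos (real k * (x - t)))) sums
      (LINT t|circ. cos (x - t) * poisson r (x - t))"
    by (rule LINT_poisson_sums[OF i r])
  moreover have "poisson_coeff r k * (LINT t|circ. cos (x - t) * cos (real k * (x - t)))
      = (if k = 1 then 2 * pi * r else 0)" for k
  proof -
    have "(LINT t|circ. cos (x - t) * cos (real k * (x - t))) = (LINT t|circ. cos (real 1 * t + - x) * cos (real k * t + - real k * x))"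
      by (subst (1 2) cos_minus[symmetric]) (simp add: algebra_simps)
    also have "\<dots> = (if k = 1 then pi else 0)"
      using LINT_circ_cos_cos[of 1 "- x" k "- real k * x"] by auto
    finally show ?thesis by (simp add: poisson_coeff_def)
  qed
  ultimately have "(\<lambda>k. if k = 1 then 2 * pi * r else 0) sums (LINT t|circ. cos (x - t) * poisson r (x - t))"
    by simp
  then have *: "(LINT t|circ. cos (x - t) * poisson r (x - t)) = 2 * pi * r"
    using sums_single[of 1 "\<lambda>_. 2 * pi * r"] sums_unique2 by blast
  have "(LINT t|circ. (1 - cos (x - t)) * poisson r (x - t)) =
      (LINT t|circ. 1 * poisson r (x - t) - cos (x - t) * poisson r (x - t))"
    by (simp add: algebra_simps)
  also have "\<dots> = 2 * pi - 2 * pi * r"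
    using LINT_poisson_sums(1)[OF _ r, of "\<lambda>_. 1" x] LINT_poisson_sums(1)[OF i r, of x] LINT_poisson[OF r, of x] *
    by (subst Bochner_Integration.integral_diff) (auto intro: integrable_circ_continuous)
  finally show ?thesis by (simp add: algebra_simps)
qed

lemma real_mod_2pi:
  obtains k :: int where "\<bar>t + of_int k * (2 * pi)\<bar> \<le> pi"
proof
  have "real_of_int \<lfloor>(t + pi) / (2 * pi)\<rfloor> * (2 * pi) \<le> t + pi"
    using of_int_floor_le[of "(t + pi) / (2 * pi)"] by (subst (asm) pos_le_divide_eq) simp_all
  moreover have "t + pi < (real_of_int \<lfloor>(t + pi) / (2 * pi)\<rfloor> + 1) * (2 * pi)"
    using floor_correct[of "(t + pi) / (2 * pi)", THEN conjunct2] by (subst (asm) pos_divide_less_eq) simp_all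
  ultimately show "\<bar>t + of_int (- \<lfloor>(t + pi) / (2 * pi)\<rfloor>) * (2 * pi)\<bar> \<le> pi"
    by (simp add: field_simps abs_le_iff)
qed

lemma C_per_bounded:
  assumes "f \<in> C_per"
  obtains M where "\<And>t. \<bar>f t\<bar> \<le> M" "M \<ge> 0"
proof -
  have "compact (f ` {-pi..pi})"
    using assms by (intro compact_continuous_image) (auto simp: C_per_def intro: continuous_on_subset)
  then have "bounded (f ` {-pi..pi})" by (rule compact_imp_bounded)
  then obtain M where M: "\<And>t. t \<in> {-pi..pi} \<Longrightarrow> \<bar>f t\<bar> \<le> M"
    unfolding bounded_iff by (metis imageI real_norm_def)
  have "\<bar>f t\<bar> \<le> M" for t
  proof -
    obtain k :: int where k: "\<bar>t + of_int k * (2 * pi)\<bar> \<le> pi" by (rule real_mod_2pi)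
    have "f t = f (t + of_int k * (2 * pi))"
      using assms by (intro periodic_int_multiple[symmetric]) (simp add: C_per_def periodic2pi_def)
    then show ?thesis using M[of "t + of_int k * (2 * pi)"] k by (simp add: abs_le_iff)
  qed
  then show ?thesis using that[of M] abs_ge_zero order_trans by blast
qed

lemma cos_periodic_int: "cos (t + of_int k * (2 * pi)) = cos t"
  using cos_int_2pin[of k] sin_int_2pin[of k] by (simp add: cos_add mult.commute)

text \<open>Testing the Poisson means on \<open>1\<close> and \<open>cos\<close> suffices for their convergence, as in Korovkin's theorem.\<close>

lemma C_per_korovkin:
  assumes f: "f \<in> C_per" and e: "e > 0"
  obtains D where "D \<ge> 0" "\<And>t. \<bar>f x - f t\<bar> \<le> e + D * (1 - cos (x - t))"
proof -
  obtain M where M: "\<And>t. \<bar>f t\<bar> \<le> M" "M \<ge> 0" using C_per_bounded[OF f] by blast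
  have "isCont f x" using f by (auto simp: C_per_def continuous_on_eq_continuous_at)
  then obtain d0 where d0: "d0 > 0" "\<And>t. \<bar>t - x\<bar> < d0 \<Longrightarrow> \<bar>f t - f x\<bar> < e"
    using e unfolding continuous_at_eps_delta dist_real_def by blast
  define d where "d = min (d0 / 2) pi"
  have d: "0 < d" "d \<le> pi" "d < d0" using d0(1) by (auto simp: d_def min_def)
  have cd: "cos d < 1" using cos_monotone_0_pi[of 0 d] d by simp
  \<comment> \<open>Farther than \<open>d\<close> from \<open>x\<close> modulo the period,
    \<open>1 - cos (x - t)\<close> is at least \<open>1 - cos d\<close>, so this multiple of it
    dominates the trivial bound \<open>2 * M\<close>.\<close>
  define D where "D = 2 * M / (1 - cos d)"
  have D: "D \<ge> 0" using cd M by (simp add: D_def)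
  have "\<bar>f x - f t\<bar> \<le> e + D * (1 - cos (x - t))" for t
  proof -
    obtain k :: int where k: "\<bar>(t - x) + of_int k * (2 * pi)\<bar> \<le> pi" by (rule real_mod_2pi)
    define t' where "t' = t + of_int k * (2 * pi)"
    have ft: "f t' = f t" unfolding t'_def
      using f by (intro periodic_int_multiple) (simp add: C_per_def periodic2pi_def)
    have ct: "cos (x - t') = cos (x - t)"
      using cos_periodic_int[of "x - t" "-k"] by (simp add: t'_def algebra_simps)
    have tp: "\<bar>t' - x\<bar> \<le> pi" using k by (simp add: t'_def algebra_simps)
    show ?thesis
    proof (cases "\<bar>t' - x\<bar> \<le> d")
      case True
      then have "\<bar>f t' - f x\<bar> < e" using d0(2) d(3) by force
      moreover have "D * (1 - cos (x - t)) \<ge> 0" using D by simp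
      ultimately show ?thesis using ft by linarith
    next
      case False
      then have "cos \<bar>t' - x\<bar> \<le> cos d" using d tp by (intro cos_monotone_0_pi_le) auto
      then have "cos (x - t) \<le> cos d" using ct by (simp add: abs_minus_commute flip: cos_abs_real[of "x - t'"])
      then have "D * (1 - cos (x - t)) \<ge> D * (1 - cos d)" using D by (intro mult_left_mono) auto
      also have "D * (1 - cos d) = 2 * M" using cd by (simp add: D_def)
      finally show ?thesis using M(1)[of x] M(1)[of t] e by linarith
    qed
  qed
  then show ?thesis using D that by blast
qed

definition harmonic :: "(real \<Rightarrow> real) \<Rightarrow> nat \<Rightarrow> real \<Rightarrow> real" where
  "harmonic f k x = fourier_a f k * cos (real k * x) + fourier_b f k * sin (real k * x)"

lemma integrable_mult_bounded_continuous:
  fixes f :: "real \<Rightarrow> real"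
  assumes f: "integrable circ f" and e: "continuous_on UNIV e" "\<And>t. \<bar>e t\<bar> \<le> C"
  shows "integrable circ (\<lambda>t. f t * e t)"
proof (rule Bochner_Integration.integrable_bound[of _ "\<lambda>t. C * f t"])
  show "integrable circ (\<lambda>t. C * f t)" using f by simp
  show "(\<lambda>t. f t * e t) \<in> borel_measurable circ"
    using f integrable_circ_continuous[OF e(1)] by (intro borel_measurable_times) auto
  have "\<bar>f t * e t\<bar> \<le> \<bar>C * f t\<bar>" for t
    using mult_left_mono[OF e(2)[of t], of "\<bar>f t\<bar>"] e(2)[of t] by (auto simp: abs_mult mult.commute)
  then show "AE t in circ. norm (f t * e t) \<le> norm (C * f t)" by simp
qed

lemma harmonic_eq_LINT:
  assumes f: "integrable circ f"
  shows "harmonic f k x = (LINT t|circ. f t * cos (real k * (x - t))) / pi"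
proof -
  have i: "integrable circ (\<lambda>t. f t * cos (real k * t))" "integrable circ (\<lambda>t. f t * sin (real k * t))"
    by (rule integrable_mult_bounded_continuous[OF f, of _ 1]; auto intro!: continuous_intros)+
  have "(LINT t|circ. f t * cos (real k * (x - t))) =
      (LINT t|circ. (f t * cos (real k * t)) * cos (real k * x) + (f t * sin (real k * t)) * sin (real k * x))"
    by (rule Bochner_Integration.integral_cong) (simp_all add: cos_diff algebra_simps)
  also have "\<dots> = (LINT t|circ. f t * cos (real k * t)) * cos (real k * x) + (LINT t|circ. f t * sin (real k * t)) * sin (real k * x)"
    using i by simp
  finally show ?thesis
    by (simp add: harmonic_def fourier_a_def fourier_b_def add_divide_distrib)
qed

text \<open>The Abel means of the Fourier series are the Poisson means of \<open>f\<close>. As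
  \<open>r\<close> tends to 1 they approach \<open>f x\<close> by the Korovkin estimate, and they
  approach the sum of the series because, under the geometric bound, damping changes it by at most a
  multiple of \<open>1 - r\<close>. Comparing the two limits identifies the sum.\<close>

lemma Fourier_inversion:
  assumes f: "f \<in> C_per" and q: "0 < q" "q < 1"
    and bd: "\<And>k. \<bar>harmonic f (Suc k) x\<bar> \<le> C * q ^ k"
  shows "(\<lambda>k. harmonic f (Suc k) x) sums (f x - fourier_a f 0 / 2)"
proof -
  have fi: "integrable circ f" using f by (intro integrable_circ_continuous) (simp add: C_per_def)
  have sg: "summable (\<lambda>k. C * q ^ k)" using q by (intro summable_mult summable_geometric) simp
  have sh: "summable (\<lambda>k. harmonic f (Suc k) x)"
    by (rule summable_comparison_test[OF _ sg]) (use bd in auto)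
  define S where "S = (\<Sum>k. harmonic f (Suc k) x)"
  have C: "C \<ge> 0" using bd[of 0] by simp
  have sg2: "(\<lambda>k. real (Suc k) * q ^ k) sums (1 / (1 - q)\<^sup>2)"
    using geometric_deriv_sums[of q] q by simp
  have main: "\<bar>f x - (fourier_a f 0 / 2 + S)\<bar> \<le> e + (D + C / (1 - q)\<^sup>2) * (1 - r)"
    if D: "D \<ge> 0" "\<And>t. \<bar>f x - f t\<bar> \<le> e + D * (1 - cos (x - t))" and r: "0 < r" "r < 1" for e D r
  proof -
    have r': "\<bar>r\<bar> < 1" using r by simp
    have "(\<lambda>k. poisson_coeff r k * (pi * harmonic f k x)) sums (LINT t|circ. f t * poisson r (x - t))"
      using LINT_poisson_sums(2)[OF fi r', of x] by (simp add: harmonic_eq_LINT[OF fi])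
    then have "(\<lambda>k. poisson_coeff r (Suc k) * (pi * harmonic f (Suc k) x)) sums
        ((LINT t|circ. f t * poisson r (x - t)) - pi * fourier_a f 0)"
      by (subst sums_Suc_iff) (simp add: poisson_coeff_def harmonic_def)
    then have P0: "(\<lambda>k. poisson_coeff r (Suc k) * (pi * harmonic f (Suc k) x) / (2 * pi)) sums
        (((LINT t|circ. f t * poisson r (x - t)) - pi * fourier_a f 0) / (2 * pi))"
      by (rule sums_divide)
    have Pc: "(\<lambda>k. poisson_coeff r (Suc k) * (pi * harmonic f (Suc k) x) / (2 * pi)) = (\<lambda>k. r ^ Suc k * harmonic f (Suc k) x)"
      unfolding poisson_coeff_def by (rule ext) simp
    have Pe: "((LINT t|circ. f t * poisson r (x - t)) - pi * fourier_a f 0) / (2 * pi) = (LINT t|circ. f t * poisson r (x - t)) / (2 * pi) - fourier_a f 0 / 2"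
      by (simp add: diff_divide_distrib)
    have P: "(\<lambda>k. r ^ Suc k * harmonic f (Suc k) x) sums ((LINT t|circ. f t * poisson r (x - t)) / (2 * pi) - fourier_a f 0 / 2)"
      using P0 unfolding Pc Pe .
    have "(\<lambda>k. harmonic f (Suc k) x - r ^ Suc k * harmonic f (Suc k) x) sums
        (S - ((LINT t|circ. f t * poisson r (x - t)) / (2 * pi) - fourier_a f 0 / 2))"
      unfolding S_def by (intro sums_diff P summable_sums sh)
    note T = this
    have "\<bar>S - ((LINT t|circ. f t * poisson r (x - t)) / (2 * pi) - fourier_a f 0 / 2)\<bar> \<le> C * (1 - r) * (1 / (1 - q)\<^sup>2)"
    proof -
      have b: "norm (harmonic f (Suc k) x - r ^ Suc k * harmonic f (Suc k) x) \<le> C * (1 - r) * (real (Suc k) * q ^ k)" for k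
      proof -
        \<comment> \<open>Bernoulli's inequality makes the loss by damping at most
          \<open>Suc k * (1 - r)\<close> times the harmonic; the weights \<open>Suc k\<close> remain
          summable against \<open>q ^ k\<close>.\<close>
        have "1 + real (Suc k) * (r - 1) \<le> (1 + (r - 1)) ^ Suc k"
          by (rule Bernoulli_inequality) (use r in auto)
        then have g: "1 - r ^ Suc k \<le> real (Suc k) * (1 - r)" by (simp add: algebra_simps)
        have g0: "0 \<le> 1 - r ^ Suc k" using power_le_one[of r "Suc k"] r by simp
        have "norm (harmonic f (Suc k) x - r ^ Suc k * harmonic f (Suc k) x) = (1 - r ^ Suc k) * \<bar>harmonic f (Suc k) x\<bar>"
          by (subst left_diff_distrib[of 1 "r ^ Suc k", unfolded mult_1, symmetric]) (use g0 in \<open>simp only: abs_mult real_norm_def abs_of_nonneg\<close>)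
        also have "\<dots> \<le> (real (Suc k) * (1 - r)) * (C * q ^ k)"
          using g g0 bd[of k] by (intro mult_mono) auto
        finally show ?thesis by (simp add: mult_ac)
      qed
      have "norm (S - ((LINT t|circ. f t * poisson r (x - t)) / (2 * pi) - fourier_a f 0 / 2)) \<le> (\<Sum>k. C * (1 - r) * (real (Suc k) * q ^ k))"
        unfolding sums_unique[OF T]
        by (rule norm_suminf_le[OF b]) (intro summable_mult sums_summable[OF sg2])
      also have "\<dots> = C * (1 - r) * (1 / (1 - q)\<^sup>2)"
        by (rule sums_unique[symmetric], intro sums_mult sg2)
      finally show ?thesis by simp
    qed
    moreover have "\<bar>f x - (LINT t|circ. f t * poisson r (x - t)) / (2 * pi)\<bar> \<le> e + D * (1 - r)"
    proof -
      have i1: "integrable circ (\<lambda>t. poisson r (x - t))"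
        using LINT_poisson_sums(1)[OF _ r', of "\<lambda>_. 1" x] by (simp add: integrable_circ_continuous)
      have i2: "integrable circ (\<lambda>t. f t * poisson r (x - t))" by (rule LINT_poisson_sums(1)[OF fi r'])
      have i3: "integrable circ (\<lambda>t. (1 - cos (x - t)) * poisson r (x - t))"
        by (rule LINT_poisson_sums(1)[OF _ r']) (rule integrable_circ_continuous, intro continuous_intros)
      have eqi: "f x * (2 * pi) - (LINT t|circ. f t * poisson r (x - t)) = (LINT t|circ. f x * poisson r (x - t) - f t * poisson r (x - t))"
        by (subst Bochner_Integration.integral_diff) (use i1 i2 in \<open>simp_all add: LINT_poisson[OF r', of x]\<close>)
      have "\<bar>f x * (2 * pi) - (LINT t|circ. f t * poisson r (x - t))\<bar> \<le> (LINT t|circ. e * poisson r (x - t) + D * ((1 - cos (x - t)) * poisson r (x - t)))"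
        unfolding eqi
      proof (rule integral_abs_bound[THEN order_trans], rule integral_mono)
        fix t
        have "\<bar>f x * poisson r (x - t) - f t * poisson r (x - t)\<bar> = \<bar>f x - f t\<bar> * poisson r (x - t)"
          using poisson_pos[OF r', of "x - t"] by (subst left_diff_distrib[symmetric]) (simp only: abs_mult abs_of_pos)
        also have "\<dots> \<le> (e + D * (1 - cos (x - t))) * poisson r (x - t)"
          using D(2)[of t] poisson_pos[OF r', of "x - t"] by (intro mult_right_mono) auto
        finally show "\<bar>f x * poisson r (x - t) - f t * poisson r (x - t)\<bar> \<le> e * poisson r (x - t) + D * ((1 - cos (x - t)) * poisson r (x - t))"
          by (simp only: distrib_right mult.assoc)
      qed (use i1 i2 i3 in auto)
      also have "\<dots> = (e + D * (1 - r)) * (2 * pi)"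
        by (subst Bochner_Integration.integral_add)
          (use i1 i3 in \<open>simp_all add: LINT_poisson[OF r', of x] LINT_one_minus_cos_poisson[OF r', of x] distrib_right\<close>)
      finally have "\<bar>f x * (2 * pi) - (LINT t|circ. f t * poisson r (x - t))\<bar> / (2 * pi) \<le> e + D * (1 - r)"
        by (subst pos_divide_le_eq) simp_all
      moreover have "f x - (LINT t|circ. f t * poisson r (x - t)) / (2 * pi) = (f x * (2 * pi) - (LINT t|circ. f t * poisson r (x - t))) / (2 * pi)"
        by (simp add: diff_divide_distrib)
      ultimately show ?thesis by (simp add: abs_divide)
    qed
    ultimately have "\<bar>f x - (fourier_a f 0 / 2 + S)\<bar> \<le> (e + D * (1 - r)) + C * (1 - r) * (1 / (1 - q)\<^sup>2)"
      by linarith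
    then show ?thesis by (simp add: algebra_simps)
  qed
  have "\<bar>f x - (fourier_a f 0 / 2 + S)\<bar> \<le> e" if e: "e > 0" for e
  proof -
    obtain D where D: "D \<ge> 0" "\<And>t. \<bar>f x - f t\<bar> \<le> e + D * (1 - cos (x - t))"
      using C_per_korovkin[OF f e] by blast
    have "((\<lambda>r. e + (D + C / (1 - q)\<^sup>2) * (1 - r)) \<longlongrightarrow> e + (D + C / (1 - q)\<^sup>2) * (1 - 1)) (at_left 1)"
      by (intro tendsto_intros)
    moreover have "\<forall>\<^sub>F r in at_left 1. \<bar>f x - (fourier_a f 0 / 2 + S)\<bar> \<le> e + (D + C / (1 - q)\<^sup>2) * (1 - r)"
      using eventually_at_left_real[of 0 "1::real"] by (rule eventually_mono) (use main[OF D] in auto)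
    ultimately show ?thesis
      using tendsto_lowerbound[of _ "e + (D + C / (1 - q)\<^sup>2) * (1 - 1)" "at_left (1::real)"] by force
  qed
  then have "\<bar>f x - (fourier_a f 0 / 2 + S)\<bar> \<le> 0" by (rule field_le_epsilon) simp
  then have "S = f x - fourier_a f 0 / 2" by simp
  then show ?thesis using sh S_def by (simp add: sums_iff)
qed

section \<open>Convolution representation of the deviation\<close>

lemma Ls_1_iff: "f \<in> Ls 1 \<longleftrightarrow> periodic2pi f \<and> f \<in> borel_measurable lebesgue \<and> integrable circ f"
proof -
  have "integrable circ (\<lambda>t. \<bar>f t\<bar>) \<longleftrightarrow> integrable circ f" if "f \<in> borel_measurable lebesgue"
    using borel_measurable_circ[OF that] by (rule integrable_abs_iff)
  then show ?thesis by (auto simp: Ls_def)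
qed

lemma neumann_psi_pos: "0 < q \<Longrightarrow> k \<ge> 1 \<Longrightarrow> neumann_psi q k > 0"
  by (simp add: neumann_psi_def)

lemma LINT_bounded_abs:
  assumes f: "integrable circ f" and e: "continuous_on UNIV e" "\<And>t. \<bar>e t\<bar> \<le> (1::real)"
  shows "\<bar>LINT t|circ. f t * e t\<bar> \<le> (LINT t|circ. \<bar>f t\<bar>)"
proof (rule integral_abs_bound[THEN order_trans], rule integral_mono)
  show "integrable circ (\<lambda>t. \<bar>f t * e t\<bar>)" "integrable circ (\<lambda>t. \<bar>f t\<bar>)"
    using integrable_mult_bounded_continuous[OF f e] f by auto
  show "\<bar>f t * e t\<bar> \<le> \<bar>f t\<bar>" for t using mult_left_le[OF e(2)[of t], of "\<bar>f t\<bar>"] by (simp add: abs_mult)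
qed

text \<open>Rotating the phase of the \<open>k\<close>-th harmonic by
  \<open>\<beta> * pi / 2\<close> amounts to moving its argument by
  \<open>\<beta> * pi / (2 * k)\<close>. Evaluating the harmonic of \<open>\<phi>\<close> at the
  moved point undoes the rotation in the definition of the derivative.\<close>

lemma harmonic_psi_beta:
  assumes q: "0 < q" and D: "is_psi_beta_derivative (neumann_psi q) \<beta> f \<phi>" and k: "k \<ge> 1"
  shows "harmonic f k x = neumann_psi q k * (LINT t|circ. \<phi> t * cos (real k * (x - t) - \<beta> * pi / 2)) / pi"
proof -
  have \<phi>: "integrable circ \<phi>" using D by (simp add: is_psi_beta_derivative_def Ls_1_iff)
  define x' where "x' = x - \<beta> * pi / 2 / real k"
  have kx: "real k * x' = real k * x - \<beta> * pi / 2" using k by (simp add: x'_def algebra_simps)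
  have "harmonic \<phi> k x' = 1 / neumann_psi q k * harmonic f k x"
  proof -
    have "harmonic \<phi> k x' = 1 / neumann_psi q k * (fourier_a f k * cos (real k * x' + \<beta> * pi / 2) + fourier_b f k * sin (real k * x' + \<beta> * pi / 2))"
      using D k unfolding is_psi_beta_derivative_def harmonic_def by blast
    then show ?thesis by (simp add: kx harmonic_def)
  qed
  then have "harmonic f k x = neumann_psi q k * harmonic \<phi> k x'"
    using neumann_psi_pos[OF q k] by simp
  also have "real k * (x' - t) = real k * (x - t) - \<beta> * pi / 2" for t
    using kx by (simp add: algebra_simps)
  then have "harmonic \<phi> k x' = (LINT t|circ. \<phi> t * cos (real k * (x - t) - \<beta> * pi / 2)) / pi"
    by (simp add: harmonic_eq_LINT[OF \<phi>])
  finally show ?thesis by simp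
qed

text \<open>With \<open>m = n - p + 1\<close>, the weight \<open>min (j + 1) p / p\<close> is the
  proportion of the \<open>p\<close> averaged partial sums that do not yet contain the harmonic
  \<open>m + j\<close>.\<close>

definition vp_kernel :: "real \<Rightarrow> real \<Rightarrow> nat \<Rightarrow> nat \<Rightarrow> real \<Rightarrow> real" where
  "vp_kernel q \<beta> m p u = (\<Sum>j. min (real (Suc j)) (real p) / real p * neumann_psi q (m + j) *
     cos (real (m + j) * u - \<beta> * pi / 2))"

lemma fourier_sum_harmonic: "fourier_sum m f x = fourier_a f 0 / 2 + (\<Sum>k<m. harmonic f (Suc k) x)"
proof -
  have "(\<Sum>k=1..m. harmonic f k x) = (\<Sum>k<m. harmonic f (Suc k) x)"
    by (rule sum.reindex_bij_witness[of _ Suc "\<lambda>k. k - 1"]) auto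
  then show ?thesis by (simp add: fourier_sum_def harmonic_def)
qed

lemma sum_if_le_min: "(\<Sum>i<p. if i \<le> (j::nat) then a else 0) = min (real (Suc j)) (real p) * (a::real)"
proof -
  have "(\<Sum>i<p. if i \<le> j then a else 0) = (\<Sum>i\<in>{i\<in>{..<p}. i \<le> j}. a)"
    by (rule sum.inter_filter[symmetric]) simp
  also have "{i\<in>{..<p}. i \<le> j} = {..<min (Suc j) p}" by auto
  finally show ?thesis by (simp add: of_nat_min)
qed

lemma summable_vp_coeff:
  assumes "0 < q" "q < 1"
  shows "summable (\<lambda>j. \<bar>min (real (Suc j)) (real p) / real p * neumann_psi q (m + j)\<bar>)"
proof (rule summable_comparison_test[OF _ summable_geometric[of q]], intro exI allI impI)
  fix j
  have a: "\<bar>min (real (Suc j)) (real p) / real p\<bar> \<le> 1" by (auto simp: divide_le_eq_1)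
  have b: "\<bar>neumann_psi q (m + j)\<bar> \<le> q ^ j"
  \<comment> \<open>For index 0 the coefficient is a division by zero and hence 0.\<close>
  proof (cases "m + j = 0")
    case False
    have "\<bar>neumann_psi q (m + j)\<bar> \<le> q ^ (m + j) / 1"
    proof -
      have "real (m + j) \<ge> real 1" using False by (intro of_nat_mono) linarith
      then show ?thesis unfolding neumann_psi_def using assms by (simp add: divide_le_eq)
    qed
    also have "q ^ (m + j) / 1 \<le> q ^ j" using assms by (simp add: power_decreasing)
    finally show ?thesis .
  qed (use assms in \<open>simp add: neumann_psi_def\<close>)
  show "norm \<bar>min (real (Suc j)) (real p) / real p * neumann_psi q (m + j)\<bar> \<le> q ^ j"
    using mult_mono[OF a b] by (simp add: abs_mult)
qed (use assms in simp)

text \<open>By Fourier inversion, subtracting the partial sum of order \<open>n - p + i\<close>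
  leaves the harmonics \<open>m + j\<close> with \<open>i \<le> j\<close>. Averaging over
  \<open>i < p\<close> produces the weights of \<open>vp_kernel\<close>, and each harmonic of
  \<open>f\<close> is an integral against \<open>\<phi>\<close>.\<close>

lemma vp_error_eq_LINT:
  assumes q: "0 < q" "q < 1" and p: "1 \<le> p" "p \<le> n"
    and f: "f \<in> C_per" and D: "is_psi_beta_derivative (neumann_psi q) \<beta> f \<phi>"
  shows "integrable circ (\<lambda>t. \<phi> t * vp_kernel q \<beta> (n - p + 1) p (x - t))"
    and "f x - vallee_poussin n p f x = (LINT t|circ. \<phi> t * vp_kernel q \<beta> (n - p + 1) p (x - t)) / pi"
proof -
  define m where "m = n - p + 1"
  have \<phi>: "integrable circ \<phi>" using D by (simp add: is_psi_beta_derivative_def Ls_1_iff)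
  define I where "I = (LINT t|circ. \<bar>\<phi> t\<bar>)"
  define J where "J k = (LINT t|circ. \<phi> t * cos (real k * (x - t) - \<beta> * pi / 2))" for k
  have J: "\<bar>J k\<bar> \<le> I" for k
    unfolding J_def I_def by (rule LINT_bounded_abs[OF \<phi>]) (auto intro!: continuous_intros)
  have h: "harmonic f k x = neumann_psi q k * J k / pi" if "k \<ge> 1" for k
    unfolding J_def by (rule harmonic_psi_beta[OF q(1) D that])
  have bd: "\<bar>harmonic f (Suc k) x\<bar> \<le> I / pi * q ^ k" for k
  proof -
    have "\<bar>neumann_psi q (Suc k)\<bar> \<le> q ^ k"
    proof -
      have "\<bar>neumann_psi q (Suc k)\<bar> \<le> q ^ Suc k / 1"
        unfolding neumann_psi_def using q by (simp add: divide_le_eq mult_ge1_I)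
      also have "\<dots> \<le> q ^ k" using q by (simp add: mult_left_le_one_le)
      finally show ?thesis .
    qed
    then have "\<bar>neumann_psi q (Suc k)\<bar> * \<bar>J (Suc k)\<bar> \<le> q ^ k * I"
      using J[of "Suc k"] q by (intro mult_mono) auto
    then show ?thesis by (simp add: h abs_mult field_simps)
  qed
  have S: "(\<lambda>k. harmonic f (Suc k) x) sums (f x - fourier_a f 0 / 2)"
    by (rule Fourier_inversion[OF f q bd])
  have diff: "(\<lambda>j. if i \<le> j then harmonic f (m + j) x else 0) sums (f x - fourier_sum (n - p + i) f x)" for i
  proof -
    have "(\<lambda>j. harmonic f (Suc (j + (n - p + i))) x) sums (f x - fourier_a f 0 / 2 - (\<Sum>k<n - p + i. harmonic f (Suc k) x))"
      using S by (rule sums_split_initial_segment)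
    then have "(\<lambda>j. harmonic f (m + (j + i)) x) sums (f x - fourier_sum (n - p + i) f x)"
      by (simp add: fourier_sum_harmonic m_def algebra_simps)
    then have "(\<lambda>j. if i \<le> j + i then harmonic f (m + (j + i)) x else 0) sums (f x - fourier_sum (n - p + i) f x - (\<Sum>j<i. if i \<le> j then harmonic f (m + j) x else 0))"
      by simp
    then show ?thesis
      by (subst (asm) sums_iff_shift) simp
  qed
  have "(\<lambda>j. (\<Sum>i<p. if i \<le> j then harmonic f (m + j) x else 0) / real p) sums
      ((\<Sum>i<p. f x - fourier_sum (n - p + i) f x) / real p)"
    by (intro sums_divide sums_sum diff)
  moreover have "(\<Sum>i<p. f x - fourier_sum (n - p + i) f x) / real p = f x - vallee_poussin n p f x"
  proof -
    have "(\<Sum>k\<in>{n - p..<n}. fourier_sum k f x) = (\<Sum>i<p. fourier_sum (n - p + i) f x)"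
      by (rule sum.reindex_bij_witness[of _ "\<lambda>i. n - p + i" "\<lambda>k. k - (n - p)"]) (use p in auto)
    then show ?thesis using p
      by (simp add: vallee_poussin_def sum_subtractf diff_divide_distrib)
  qed
  ultimately have A: "(\<lambda>j. min (real (Suc j)) (real p) / real p * harmonic f (m + j) x) sums (f x - vallee_poussin n p f x)"
    by (simp add: sum_if_le_min)
  define c where "c j = min (real (Suc j)) (real p) / real p * neumann_psi q (m + j)" for j
  have cs: "summable (\<lambda>j. \<bar>c j\<bar>)" unfolding c_def by (rule summable_vp_coeff[OF q])
  have e: "continuous_on UNIV (\<lambda>t. cos (real (m + j) * (x - t) - \<beta> * pi / 2))"
    "\<bar>cos (real (m + j) * (x - t) - \<beta> * pi / 2)\<bar> \<le> 1" for j t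
    by (auto intro!: continuous_intros)
  have v: "vp_kernel q \<beta> m p (x - t) = (\<Sum>j. c j * cos (real (m + j) * (x - t) - \<beta> * pi / 2))" for t
    by (simp add: vp_kernel_def c_def)
  have B: "(\<lambda>j. c j * J (m + j)) sums (LINT t|circ. \<phi> t * vp_kernel q \<beta> m p (x - t))"
    unfolding v J_def by (rule cos_series_sums_LINT(2)[OF \<phi> cs e])
  have "(\<lambda>j. c j * J (m + j) / pi) sums ((LINT t|circ. \<phi> t * vp_kernel q \<beta> m p (x - t)) / pi)"
    by (rule sums_divide[OF B])
  moreover have "c j * J (m + j) / pi = min (real (Suc j)) (real p) / real p * harmonic f (m + j) x" for j
    by (subst h) (auto simp: m_def c_def)
  ultimately show "f x - vallee_poussin n p f x = (LINT t|circ. \<phi> t * vp_kernel q \<beta> (n - p + 1) p (x - t)) / pi"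
    using A unfolding m_def by (metis (no_types, lifting) sums_cong sums_unique2)
  show "integrable circ (\<lambda>t. \<phi> t * vp_kernel q \<beta> (n - p + 1) p (x - t))"
    unfolding m_def[symmetric] v by (rule cos_series_sums_LINT(1)[OF \<phi> cs e])
qed

text \<open>The coefficients prescribed by \<open>\<phi>\<close> are bounded multiples of
  \<open>neumann_psi q k\<close>, so the series for \<open>f\<close> converges uniformly and its own
  coefficients follow by termwise integration. Its phases are turned by \<open>- b\<close>, which
  cancels the rotation by \<open>b\<close> in the definition of the derivative.\<close>

lemma exists_psi_beta_integral:
  assumes q: "0 < q" "q < 1" and \<phi>: "\<phi> \<in> Ls 1" and mean: "(LINT t|circ. \<phi> t) = 0"
  obtains f where "f \<in> C_per" "f \<in> Ls 1" "is_psi_beta_derivative (neumann_psi q) \<beta> f \<phi>"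
proof -
  define b where "b = \<beta> * pi / 2"
  define \<alpha>1 \<alpha>2 where "\<alpha>1 = fourier_a \<phi>" and "\<alpha>2 = fourier_b \<phi>"
  have \<phi>i: "integrable circ \<phi>" using \<phi> by (simp add: Ls_1_iff)
  define I where "I = (LINT t|circ. \<bar>\<phi> t\<bar>)"
  have I0: "I \<ge> 0" unfolding I_def by simp
  have bd: "\<bar>\<alpha>1 k\<bar> \<le> I" "\<bar>\<alpha>2 k\<bar> \<le> I" for k
  proof -
    have "\<bar>LINT t|circ. \<phi> t * cos (real k * t)\<bar> \<le> I" "\<bar>LINT t|circ. \<phi> t * sin (real k * t)\<bar> \<le> I"
      unfolding I_def by (rule LINT_bounded_abs[OF \<phi>i]; auto intro!: continuous_intros)+
    moreover have "I \<le> I * pi" using I0 pi_gt3 by (simp add: mult_le_cancel_left1)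
    ultimately show "\<bar>\<alpha>1 k\<bar> \<le> I" "\<bar>\<alpha>2 k\<bar> \<le> I"
      unfolding \<alpha>1_def \<alpha>2_def fourier_a_def fourier_b_def by (auto simp: abs_mult abs_divide field_simps)
  qed
  \<comment> \<open>Both coefficients of \<open>\<phi>\<close> are at most \<open>I\<close> in
    absolute value, so division by \<open>C\<close> brings every harmonic below 1, as termwise
    integration requires. The summand 1 keeps \<open>C\<close> positive when
    \<open>I = 0\<close>.\<close>
  define C where "C = 2 * I + 1"
  have C: "C > 0" using I0 by (simp add: C_def)
  define e where "e k t = (\<alpha>1 k * cos (real k * t - b) + \<alpha>2 k * sin (real k * t - b)) / C" for k t
  have e: "continuous_on UNIV (e k)" "\<bar>e k t\<bar> \<le> 1" for k t
  proof -
    show "continuous_on UNIV (e k)" unfolding e_def[abs_def] using C by (auto intro!: continuous_intros)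
    have "\<bar>\<alpha>1 k * cos (real k * t - b)\<bar> \<le> I * 1" "\<bar>\<alpha>2 k * sin (real k * t - b)\<bar> \<le> I * 1"
      unfolding abs_mult by (intro mult_mono; use bd I0 in auto)+
    then show "\<bar>e k t\<bar> \<le> 1" using C unfolding e_def C_def by (auto simp: abs_divide)
  qed
  \<comment> \<open>At \<open>k = 0\<close> the factor \<open>neumann_psi q 0\<close> is a division
    by zero, hence 0, and \<open>f\<close> gets no constant term.\<close>
  define c where "c k = neumann_psi q k * C" for k
  have cs: "summable (\<lambda>k. \<bar>c k\<bar>)"
  proof (rule summable_comparison_test[OF _ summable_mult2[OF summable_geometric[of q], of C]], intro exI allI impI)
    fix k
    have "\<bar>neumann_psi q k\<bar> \<le> q ^ k"
      unfolding neumann_psi_def using q by (cases "k = 0") (simp_all add: divide_le_eq mult_ge1_I)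
    then show "norm \<bar>c k\<bar> \<le> q ^ k * C" using C by (simp add: c_def abs_mult mult_right_mono)
  qed (use q in simp)
  define f where "f t = (\<Sum>k. c k * e k t)" for t
  have cont: "continuous_on UNIV f" unfolding f_def[abs_def] by (rule cos_series_continuous[OF cs e])
  have eper: "e k (t + 2 * pi) = e k t" for k t
    using periodic_cos_nat[of k t "- b"] periodic_sin_nat[of k t "- b"] by (simp add: e_def)
  have per: "periodic2pi f" unfolding periodic2pi_def f_def by (simp add: eper)
  have fC: "f \<in> C_per" using cont per by (simp add: C_per_def)
  have f1: "f \<in> Ls 1"
    using per integrable_circ_continuous[OF cont] borel_measurable_continuous_onI[OF cont]
    by (simp add: Ls_1_iff measurable_completion)
  have coef: "(LINT t|circ. cos (real l * t + a) * f t) = neumann_psi q l * pi * (\<alpha>1 l * cos (a + b) - \<alpha>2 l * sin (a + b))"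
    if l: "l \<ge> 1" for l a
  proof -
    have ic: "integrable circ (\<lambda>t. cos (real l * t + a))"
      by (rule integrable_circ_continuous) (intro continuous_intros)
    have "(\<lambda>k. c k * (LINT t|circ. cos (real l * t + a) * e k t)) sums (LINT t|circ. cos (real l * t + a) * f t)"
      unfolding f_def by (rule cos_series_sums_LINT(2)[OF ic cs e])
    moreover have "(LINT t|circ. cos (real l * t + a) * e k t) = (if k = l then pi * (\<alpha>1 l * cos (a + b) - \<alpha>2 l * sin (a + b)) / C else 0)" for k
    proof -
      have i: "integrable circ (\<lambda>t. cos (real l * t + a) * cos (real k * t + y))" for y
        by (rule integrable_circ_continuous) (intro continuous_intros)
      have s: "sin (real k * t - b) = cos (real k * t + (- b - pi / 2))" for t
        by (simp add: cos_add sin_diff cos_diff)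
      have "(LINT t|circ. cos (real l * t + a) * e k t) =
          (LINT t|circ. \<alpha>1 k / C * (cos (real l * t + a) * cos (real k * t + - b)) + \<alpha>2 k / C * (cos (real l * t + a) * cos (real k * t + (- b - pi / 2))))"
        unfolding e_def s by (rule Bochner_Integration.integral_cong) (simp_all add: distrib_left add_divide_distrib mult_ac)
      also have "\<dots> = \<alpha>1 k / C * (LINT t|circ. cos (real l * t + a) * cos (real k * t + - b)) + \<alpha>2 k / C * (LINT t|circ. cos (real l * t + a) * cos (real k * t + (- b - pi / 2)))"
        using i by (subst Bochner_Integration.integral_add) (auto simp del: add_uminus_conv_diff)
      also have "\<dots> = (if k = l then pi * (\<alpha>1 l * cos (a + b) - \<alpha>2 l * sin (a + b)) / C else 0)"
        using l LINT_circ_cos_cos[of l a k "- b"] LINT_circ_cos_cos[of l a k "- b - pi / 2"]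
          cos_add[of "a + b" "pi / 2"]
        by (auto simp: algebra_simps diff_divide_distrib)
      finally show ?thesis .
    qed
    ultimately have "(\<lambda>k. if k = l then c k * (pi * (\<alpha>1 l * cos (a + b) - \<alpha>2 l * sin (a + b)) / C) else 0) sums (LINT t|circ. cos (real l * t + a) * f t)"
      by (simp add: if_distrib cong: if_cong)
    then have "(LINT t|circ. cos (real l * t + a) * f t) = c l * (pi * (\<alpha>1 l * cos (a + b) - \<alpha>2 l * sin (a + b)) / C)"
      using sums_single[of l "\<lambda>k. c k * (pi * (\<alpha>1 l * cos (a + b) - \<alpha>2 l * sin (a + b)) / C)"] sums_unique2 by blast
    then show ?thesis using C by (simp add: c_def)
  qed
  have fa: "fourier_a f l = neumann_psi q l * (\<alpha>1 l * cos b - \<alpha>2 l * sin b)" if "l \<ge> 1" for l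
    using coef[OF that, of 0] by (simp add: fourier_a_def mult.commute)
  have fb: "fourier_b f l = neumann_psi q l * (\<alpha>1 l * sin b + \<alpha>2 l * cos b)" if "l \<ge> 1" for l
  proof -
    have "sin x = cos (x + - (pi / 2))" for x :: real by (simp add: cos_diff)
    moreover have "cos (- (pi / 2) + b) = sin b" "sin (- (pi / 2) + b) = - cos b"
      by (simp_all add: cos_diff sin_diff)
    ultimately show ?thesis
      using coef[OF that, of "- (pi / 2)"] by (simp add: fourier_b_def mult.commute)
  qed
  have "is_psi_beta_derivative (neumann_psi q) \<beta> f \<phi>"
    unfolding is_psi_beta_derivative_def
  proof (intro conjI allI impI \<phi>)
    show "fourier_a \<phi> 0 = 0" using mean by (simp add: fourier_a_def)
    fix l :: nat and x :: real
    assume l: "1 \<le> l"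
    define y where "y = real l * x + b"
    have id: "real l * x = y - b" by (simp add: y_def)
    have "1 / neumann_psi q l * (fourier_a f l * cos y + fourier_b f l * sin y) =
      (\<alpha>1 l * cos b - \<alpha>2 l * sin b) * cos y + (\<alpha>1 l * sin b + \<alpha>2 l * cos b) * sin y"
      using neumann_psi_pos[OF q(1) l] by (simp add: fa[OF l] fb[OF l] field_simps)
    also have "\<dots> = \<alpha>1 l * cos (y - b) + \<alpha>2 l * sin (y - b)"
      by (simp add: cos_diff sin_diff algebra_simps)
    finally show "fourier_a \<phi> l * cos (real l * x) + fourier_b \<phi> l * sin (real l * x) =
        1 / neumann_psi q l * (fourier_a f l * cos (real l * x + \<beta> * pi / 2) + fourier_b f l * sin (real l * x + \<beta> * pi / 2))"
      unfolding id by (simp add: \<alpha>1_def \<alpha>2_def b_def)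
  qed
  then show ?thesis using fC f1 that by blast
qed

section \<open>Waves with slowly varying phase and the classes \<open>H_class\<close>\<close>

lemma modulus_of_continuityD:
  assumes "modulus_of_continuity \<omega>"
  shows "\<And>x y. 0 \<le> x \<Longrightarrow> x \<le> y \<Longrightarrow> \<omega> x \<le> \<omega> y" "\<omega> 0 = 0" "\<And>x. 0 \<le> x \<Longrightarrow> 0 \<le> \<omega> x"
    "\<And>x y. 0 \<le> x \<Longrightarrow> 0 \<le> y \<Longrightarrow> \<omega> (x + y) \<le> \<omega> x + \<omega> y" "continuous_on {0..} \<omega>"
proof -
  show m: "\<omega> x \<le> \<omega> y" if "0 \<le> x" "x \<le> y" for x y
    using assms that mono_onD[of "{0..}" \<omega> x y] by (auto simp: modulus_of_continuity_def)
  show z: "\<omega> 0 = 0" using assms by (simp add: modulus_of_continuity_def)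
  show "0 \<le> \<omega> x" if "0 \<le> x" for x using m[of 0 x] z that by simp
qed (use assms in \<open>auto simp: modulus_of_continuity_def\<close>)

text \<open>The point \<open>x\<close> divides the segment from 0 to \<open>c * x\<close> with
  weight \<open>1 / c\<close>, and \<open>\<omega> 0 = 0\<close>. Through this inequality a
  distortion of distances by a factor near 1 becomes a relative error in
  \<open>\<omega>\<close>.\<close>

lemma concave_modulus_scale:
  assumes \<omega>: "modulus_of_continuity \<omega>" "concave_on {0..} \<omega>" and c: "c \<ge> 1" and x: "x \<ge> 0"
  shows "\<omega> (c * x) \<le> c * \<omega> x"
proof -
  have "(1 / c) *\<^sub>R (c * x) + (1 - 1 / c) *\<^sub>R 0 = x" using c by simp
  moreover have "\<omega> ((1 - 1 / c) *\<^sub>R 0 + (1 / c) *\<^sub>R (c * x)) \<ge> (1 - 1 / c) * \<omega> 0 + (1 / c) * \<omega> (c * x)"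
    using c x by (intro concave_onD[OF \<omega>(2)]) auto
  ultimately have "(1 / c) * \<omega> (c * x) \<le> \<omega> x"
    using modulus_of_continuityD(2)[OF \<omega>(1)] c by simp
  then show ?thesis using c by (simp add: field_simps)
qed

lemma C_norm_bounded_le:
  assumes "\<And>t. \<bar>f t\<bar> \<le> c"
  shows "C_norm f \<le> c"
  unfolding C_norm_def by (rule cSUP_least) (use assms in auto)

lemma le_C_norm:
  assumes "\<And>t. \<bar>f t\<bar> \<le> M"
  shows "\<bar>f t\<bar> \<le> C_norm f"
  unfolding C_norm_def by (rule cSUP_upper) (use assms in \<open>auto intro!: bdd_aboveI\<close>)

lemma H_classI:
  assumes "\<phi> \<in> C_per" "\<And>x y. \<bar>\<phi> x - \<phi> y\<bar> \<le> \<omega> \<bar>x - y\<bar>" "modulus_of_continuity \<omega>"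
  shows "\<phi> \<in> H_class \<omega>"
proof -
  have "modulus \<phi> t \<le> \<omega> t" if t: "t \<ge> 0" for t
    unfolding modulus_def
  proof (rule cSUP_least)
    fix h assume h: "h \<in> {h. \<bar>h\<bar> \<le> t}"
    have "\<bar>\<phi> (x + h) - \<phi> x\<bar> \<le> \<omega> t" for x
      using assms(2)[of "x + h" x] modulus_of_continuityD(1)[OF assms(3), of "\<bar>h\<bar>" t] h by simp
    then show "C_norm (\<lambda>x. \<phi> (x + h) - \<phi> x) \<le> \<omega> t" by (rule C_norm_bounded_le)
  qed (use t in \<open>auto intro!: exI[of _ 0]\<close>)
  then show ?thesis using assms(1) by (simp add: H_class_def)
qed

text \<open>A real supremum bounds its members only if they are bounded above. Here the bound
  \<open>2 * M\<close> comes from the boundedness of continuous periodic functions.\<close>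

lemma H_classD:
  assumes "\<phi> \<in> H_class \<omega>"
  shows "\<bar>\<phi> x - \<phi> y\<bar> \<le> \<omega> \<bar>x - y\<bar>"
proof -
  have C: "\<phi> \<in> C_per" and m: "\<And>t. t \<ge> 0 \<Longrightarrow> modulus \<phi> t \<le> \<omega> t" using assms by (auto simp: H_class_def)
  obtain M where M: "\<And>t. \<bar>\<phi> t\<bar> \<le> M" "M \<ge> 0" using C_per_bounded[OF C] by blast
  define h where "h = x - y"
  have b: "\<bar>\<phi> (z + k) - \<phi> z\<bar> \<le> 2 * M" for z k using M(1)[of "z + k"] M(1)[of z] by linarith
  have "\<bar>\<phi> (y + h) - \<phi> y\<bar> \<le> C_norm (\<lambda>z. \<phi> (z + h) - \<phi> z)" by (rule le_C_norm[OF b])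
  also have "\<dots> \<le> modulus \<phi> \<bar>h\<bar>"
    unfolding modulus_def
    by (rule cSUP_upper) (auto intro!: bdd_aboveI[of _ "2 * M"] C_norm_bounded_le b)
  also have "\<dots> \<le> \<omega> \<bar>h\<bar>" by (rule m) simp
  finally show ?thesis by (simp add: h_def)
qed

text \<open>Periodicity brings any two points within distance \<open>pi\<close>. Subtracting one
  value of \<open>\<phi>\<close> therefore leaves a function bounded by \<open>\<omega> pi\<close>,
  the quantity that scales the error term.\<close>

lemma H_class_oscillation:
  assumes "\<phi> \<in> H_class \<omega>" "modulus_of_continuity \<omega>"
  shows "\<bar>\<phi> x - \<phi> y\<bar> \<le> \<omega> pi"
proof -
  obtain k :: int where k: "\<bar>(x - y) + of_int k * (2 * pi)\<bar> \<le> pi" by (rule real_mod_2pi)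
  have "\<phi> x = \<phi> (x + of_int k * (2 * pi))"
    using assms(1) by (intro periodic_int_multiple[symmetric]) (simp add: H_class_def C_per_def periodic2pi_def)
  then have "\<bar>\<phi> x - \<phi> y\<bar> \<le> \<omega> \<bar>(x - y) + of_int k * (2 * pi)\<bar>"
    using H_classD[OF assms(1), of "x + of_int k * (2 * pi)" y] by (simp add: algebra_simps)
  then show ?thesis using modulus_of_continuityD(1)[OF assms(2) _ k] by simp
qed

section \<open>Integrals against one half-period of the cosine\<close>

lemma integral_half_wave:
  fixes \<psi> :: "real \<Rightarrow> real"
  assumes c: "continuous_on UNIV \<psi>"
  shows "integral {0..pi} (\<lambda>v. \<psi> v * cos v) = integral {0..pi/2} (\<lambda>x. (\<psi> (pi/2 - x) - \<psi> (pi/2 + x)) * sin x)"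
proof -
  have ci: "(\<lambda>v. \<psi> (a + c * v) * f v) integrable_on {u..w}" if "continuous_on UNIV f" for a c u w :: real and f
    by (intro integrable_continuous_interval continuous_intros continuous_on_compose2[OF c] continuous_on_subset[OF that]) auto
  have i: "(\<lambda>v. \<psi> v * cos v) integrable_on {u..w}" for u w
    using ci[of cos 0 1 u w] by (simp add: continuous_on_cos)
  have "integral {0..pi} (\<lambda>v. \<psi> v * cos v) = integral {0..pi/2} (\<lambda>v. \<psi> v * cos v) + integral {pi/2..pi} (\<lambda>v. \<psi> v * cos v)"
    by (rule Henstock_Kurzweil_Integration.integral_combine[symmetric]) (use i in auto)
  also have "integral {pi/2..pi} (\<lambda>v. \<psi> v * cos v) = integral {0..pi/2} (\<lambda>x. \<psi> (pi/2 + x) * - sin x)"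
    using integral_shift_real_ivl[of "pi/2" "pi/2" pi "\<lambda>v. \<psi> v * cos v"]
    by (simp add: add.commute cos_add)
  also have "integral {0..pi/2} (\<lambda>v. \<psi> v * cos v) = integral {-(pi/2)..0} (\<lambda>x. \<psi> (pi/2 + x) * - sin x)"
    using integral_shift_real_ivl[of 0 "pi/2" "pi/2" "\<lambda>v. \<psi> v * cos v"]
    by (simp add: add.commute cos_add)
  also have "\<dots> = integral {0..pi/2} (\<lambda>x. \<psi> (pi/2 - x) * sin x)"
    using Henstock_Kurzweil_Integration.integral_reflect_real[of "pi/2" 0 "\<lambda>x. \<psi> (pi/2 - x) * sin x"]
    by simp
  also have "integral {0..pi/2} (\<lambda>x. \<psi> (pi/2 - x) * sin x) + integral {0..pi/2} (\<lambda>x. \<psi> (pi/2 + x) * - sin x) =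
    integral {0..pi/2} (\<lambda>x. \<psi> (pi/2 - x) * sin x + \<psi> (pi/2 + x) * - sin x)"
    using ci[of sin "pi/2" "-1" 0 "pi/2"] ci[of "\<lambda>x. - sin x" "pi/2" 1 0 "pi/2"] continuous_on_sin[OF continuous_on_id, of UNIV]
      continuous_on_minus[OF continuous_on_sin[OF continuous_on_id, of UNIV]]
    by (intro Henstock_Kurzweil_Integration.integral_add[symmetric]) simp_all
  finally show ?thesis by (simp add: algebra_simps)
qed

lemma cos_nat_pi_add: "cos (real j * pi + v) = (-1) ^ j * cos v"
  by (simp add: cos_add mult.commute)

text \<open>The point \<open>z\<close> is the zero of \<open>cos (m u)\<close> in the
  \<open>j\<close>-th half-period. The cosine is odd about \<open>z\<close>, so only differences of
  \<open>\<psi>\<close> at points symmetric about \<open>z\<close> enter, weighted by a sine; the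
  sign alternates with \<open>j\<close>.\<close>

lemma integral_cell:
  fixes \<psi> :: "real \<Rightarrow> real" and m j :: nat
  assumes c: "continuous_on UNIV \<psi>" and m: "m \<ge> 1"
  defines "z \<equiv> (real j + 1/2) * pi / real m"
  shows "integral {real j * pi / m..real (Suc j) * pi / m} (\<lambda>u. \<psi> u * cos (real m * u)) =
    (-1) ^ j / real m * integral {0..pi/2} (\<lambda>x. (\<psi> (z - x / m) - \<psi> (z + x / m)) * sin x)"
proof -
  have m0: "real m > 0" using m by simp
  define F where "F u = \<psi> u * cos (real m * u)" for u
  define a where "a = real j * pi / m"
  have z: "z - x / m = a + (pi/2 - x) / m" "z + x / m = a + (pi/2 + x) / m" for x
    using m0 by (simp_all add: a_def z_def field_simps)
  have Fc: "continuous_on S F" for S unfolding F_def[abs_def]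
    by (intro continuous_intros continuous_on_subset[OF c]) auto
  have "((\<lambda>v. (1 / real m) *\<^sub>R F (a + v / m)) has_integral integral {a + 0 / m..a + pi / m} F) {0..pi}"
    using m0 by (intro has_integral_substitution[of 0 pi _ a "a + pi / m"] Fc)
      (auto intro!: derivative_eq_intros simp: divide_right_mono)
  from integral_unique[OF this]
  have "integral {a..a + pi / m} F = integral {0..pi} (\<lambda>v. (1 / real m) *\<^sub>R F (a + v / m))"
    by simp
  also have "\<dots> = integral {0..pi} (\<lambda>v. ((-1) ^ j / real m) * (\<psi> (a + v / m) * cos v))"
  proof (rule Henstock_Kurzweil_Integration.integral_cong)
    fix v
    have "real m * (a + v / m) = real j * pi + v" using m0 by (simp add: a_def field_simps)
    then show "(1 / real m) *\<^sub>R F (a + v / m) = ((-1) ^ j / real m) * (\<psi> (a + v / m) * cos v)"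
      unfolding F_def by (simp add: cos_nat_pi_add)
  qed
  also have "\<dots> = (-1) ^ j / real m * integral {0..pi} (\<lambda>v. \<psi> (a + v / m) * cos v)"
    by (rule Henstock_Kurzweil_Integration.integral_mult_right)
  also have "integral {0..pi} (\<lambda>v. \<psi> (a + v / m) * cos v) =
      integral {0..pi/2} (\<lambda>x. (\<psi> (a + (pi/2 - x) / m) - \<psi> (a + (pi/2 + x) / m)) * sin x)"
    by (rule integral_half_wave) (intro continuous_intros continuous_on_compose2[OF c], use m0 in auto)
  finally show ?thesis
    unfolding z by (simp add: a_def F_def add_divide_distrib distrib_right add.commute)
qed

lemma integral_uniform_partition:
  fixes f :: "real \<Rightarrow> real" and n :: nat
  assumes n: "n \<ge> 1" and f: "f integrable_on {0..T}"
  shows "(\<Sum>j<n. integral {real j * T / n..real (Suc j) * T / n} f) = integral {0..T} f"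
proof (cases "T \<ge> 0")
  case True
  define c where "c j = real j * T / real n" for j :: nat
  have mono: "c i \<le> c j" if "i \<le> j" for i j
    using that True by (simp add: c_def divide_right_mono mult_right_mono)
  have c0: "c 0 = 0" "c n = T" using n by (simp_all add: c_def)
  have "(\<Sum>j<k. integral {c j..c (Suc j)} f) = integral {0..c k} f" if "k \<le> n" for k
    using that
  proof (induction k)
    case (Suc k)
    have "f integrable_on {0..c (Suc k)}"
      by (rule integrable_on_subinterval[OF f]) (use mono[OF Suc.prems] c0 in auto)
    then have "integral {0..c k} f + integral {c k..c (Suc k)} f = integral {0..c (Suc k)} f"
      using mono[of 0 k] mono[of k "Suc k"] c0
      by (intro Henstock_Kurzweil_Integration.integral_combine) auto
    then show ?case using Suc by simp
  qed (simp add: c0)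
  from this[of n] show ?thesis unfolding c0(2) by (simp add: c_def)
next
  case False
  have "{real j * T / n..real (Suc j) * T / n} = {}" for j
    using False n by (simp add: divide_less_cancel mult_less_cancel_right)
  then show ?thesis using False by simp
qed

text \<open>\<open>L\<close> is a logarithm of the complex amplitude. A bound on \<open>L'\<close>
  controls at once the relative change of the modulus, through the real part, and the drift of the
  phase, through the imaginary part; \<open>\<Lambda> \<le> m / 2\<close> keeps the derivative of
  the straightened phase \<open>tau\<close> between 1/2 and 3/2.\<close>

locale slow_phase =
  fixes L L' :: "real \<Rightarrow> complex" and m :: nat and \<Lambda> B :: real
  assumes per: "L (t + 2 * pi) = L t"
    and der: "(L has_vector_derivative L' t) (at t)"
    and cont': "continuous_on UNIV L'"
    and \<Lambda>: "cmod (L' t) \<le> \<Lambda>" and B: "cmod (exp (L t)) \<le> B"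
    and m: "m \<ge> 1" and \<Lambda>m: "\<Lambda> \<le> real m / 2"
begin

definition amp :: "real \<Rightarrow> real" where "amp t = exp (Re (L t))"
definition tau :: "real \<Rightarrow> real" where "tau t = t + Im (L t) / real m"
definition tau' :: "real \<Rightarrow> real" where "tau' t = 1 + Im (L' t) / real m"
definition wave :: "real \<Rightarrow> real" where "wave t = Re (exp (L t) * cis (real m * t))"
text \<open>At the nodes \<open>cos (m u)\<close> equals 1 or -1, so that each cell contains exactly
  one zero of it, the midpoint.\<close>

definition node :: "nat \<Rightarrow> real" where "node j = real j * pi / real m"
definition sig :: "real \<Rightarrow> real" where "sig = inv tau"
definition total :: real where "total = integral {0..2*pi} amp"

lemma m0: "real m > 0" using m by simp

lemma \<Lambda>0: "\<Lambda> \<ge> 0" using \<Lambda>[of 0] norm_ge_zero order_trans by blast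
lemma B0: "B \<ge> 0" using B[of 0] norm_ge_zero order_trans by blast

lemma amp_eq: "amp t = cmod (exp (L t))" by (simp add: amp_def)
lemma amp_pos: "amp t > 0" by (simp add: amp_def)
lemma amp_le: "amp t \<le> B" using B[of t] by (simp add: amp_eq)

lemma wave_eq: "wave t = amp t * cos (real m * tau t)"
proof -
  have "real m * tau t = real m * t + Im (L t)" using m0 by (simp add: tau_def field_simps)
  moreover have "exp (L t) * cis (real m * t) = of_real (amp t) * cis (real m * t + Im (L t))"
    by (simp add: amp_def exp_eq_polar cis_mult mult_ac add_ac)
  ultimately show ?thesis by (simp add: wave_def)
qed

lemma amp_per: "amp (t + 2 * pi) = amp t" by (simp add: amp_def per)
lemma tau_per: "tau (t + 2 * pi) = tau t + 2 * pi" by (simp add: tau_def per)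

lemma deriv_Re: "((\<lambda>t. Re (L t)) has_real_derivative Re (L' t)) (at t within S)"
  and deriv_Im: "((\<lambda>t. Im (L t)) has_real_derivative Im (L' t)) (at t within S)"
  unfolding has_real_derivative_iff_has_vector_derivative
  by (rule bounded_linear.has_vector_derivative[OF bounded_linear_Re has_vector_derivative_at_within[OF der]]
      bounded_linear.has_vector_derivative[OF bounded_linear_Im has_vector_derivative_at_within[OF der]])+

lemma tau_deriv: "(tau has_real_derivative tau' t) (at t within S)"
proof -
  have "((\<lambda>t. t + Im (L t) / real m) has_real_derivative 1 + Im (L' t) / real m) (at t within S)"
    by (rule DERIV_add[OF DERIV_ident DERIV_cdivide[OF deriv_Im]])
  then show ?thesis by (simp add: tau_def[abs_def] tau'_def)
qed

lemma amp_deriv: "(amp has_real_derivative Re (L' t) * amp t) (at t within S)"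
  unfolding amp_def[abs_def] using DERIV_chain2[OF DERIV_exp deriv_Re, of t S] by (simp add: mult.commute)

lemma L'_per: "L' (t + 2 * pi) = L' t"
proof -
  have "((\<lambda>s. s + 2 * pi) has_vector_derivative 1) (at t)"
    by (auto intro!: derivative_eq_intros)
  from vector_diff_chain_at[OF this der] have "(L has_vector_derivative L' (t + 2 * pi)) (at t)"
    by (simp add: o_def per)
  then show ?thesis using der vector_derivative_unique_at by blast
qed

lemma tau'_bounds: "\<bar>tau' t - 1\<bar> \<le> \<Lambda> / m" "tau' t \<ge> 1/2" "tau' t \<le> 3/2"
proof -
  have "\<bar>Im (L' t)\<bar> \<le> \<Lambda>" using \<Lambda>[of t] abs_Im_le_cmod order_trans by blast
  then show *: "\<bar>tau' t - 1\<bar> \<le> \<Lambda> / m" using m0 by (simp add: tau'_def divide_right_mono)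
  have "\<Lambda> / m \<le> 1/2" using \<Lambda>m m0 by (simp add: field_simps)
  with * show "tau' t \<ge> 1/2" "tau' t \<le> 3/2" by linarith+
qed

lemma tau_cont: "continuous_on S tau" by (rule DERIV_continuous_on) (rule tau_deriv)
lemma amp_cont: "continuous_on S amp" by (rule DERIV_continuous_on) (rule amp_deriv)
lemma tau'_cont: "continuous_on S tau'"
  unfolding tau'_def[abs_def] using m0 by (intro continuous_intros continuous_on_subset[OF cont']) auto

lemma tau_mvt:
  obtains \<xi> where "tau x - tau y = tau' \<xi> * (x - y)"
proof (cases x y rule: linorder_cases)
  case less
  then obtain \<xi> where "tau y - tau x = (y - x) * tau' \<xi>"
    using MVT2[of x y tau tau'] tau_deriv by blast
  then show ?thesis using that[of \<xi>] by (simp add: algebra_simps)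
next
  case greater
  then obtain \<xi> where "tau x - tau y = (x - y) * tau' \<xi>"
    using MVT2[of y x tau tau'] tau_deriv by blast
  then show ?thesis using that[of \<xi>] by (simp add: algebra_simps)
qed (use that in auto)

lemma tau_lipschitz: "\<bar>tau x - tau y\<bar> \<le> (1 + \<Lambda> / m) * \<bar>x - y\<bar>"
proof -
  obtain \<xi> where "tau x - tau y = tau' \<xi> * (x - y)" by (rule tau_mvt)
  moreover have "\<bar>tau' \<xi>\<bar> \<le> 1 + \<Lambda> / m" using tau'_bounds(1)[of \<xi>] by linarith
  ultimately show ?thesis by (simp add: abs_mult mult_right_mono)
qed

text \<open>By the mean value theorem the inverse of \<open>tau\<close> has Lipschitz constant
  \<open>1 / (1 - \<epsilon>)\<close> with \<open>\<epsilon> = \<Lambda> / m\<close>. For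
  \<open>\<epsilon> \<le> 1/2\<close> this is at most \<open>1 + 2 * \<epsilon>\<close>, which is
  easier to carry through the error terms.\<close>

lemma tau_expand: "\<bar>x - y\<bar> \<le> (1 + 2 * \<Lambda> / m) * \<bar>tau x - tau y\<bar>"
proof -
  obtain \<xi> where e: "tau x - tau y = tau' \<xi> * (x - y)" by (rule tau_mvt)
  define \<epsilon> where "\<epsilon> = \<Lambda> / m"
  have \<epsilon>: "0 \<le> \<epsilon>" "\<epsilon> \<le> 1/2" using \<Lambda>m m0 \<Lambda>0 by (auto simp: \<epsilon>_def field_simps)
  have t: "1 - \<epsilon> \<le> tau' \<xi>" using tau'_bounds(1)[of \<xi>] unfolding \<epsilon>_def by linarith
  have "1 \<le> (1 + 2 * \<epsilon>) * (1 - \<epsilon>)"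
  proof -
    have "\<epsilon> * \<epsilon> \<le> \<epsilon> * (1/2)" using \<epsilon> by (intro mult_left_mono) auto
    then show ?thesis by (simp add: algebra_simps)
  qed
  also have "\<dots> \<le> (1 + 2 * \<epsilon>) * tau' \<xi>" using t \<epsilon> by (intro mult_left_mono) auto
  finally have "1 * \<bar>x - y\<bar> \<le> (1 + 2 * \<epsilon>) * tau' \<xi> * \<bar>x - y\<bar>" by (intro mult_right_mono) auto
  then show ?thesis unfolding e using t \<epsilon> by (simp add: abs_mult \<epsilon>_def mult_ac)
qed

lemma tau_bij: "bij tau"
proof (rule bijI)
  show "inj tau"
  proof (rule injI)
    fix x y assume "tau x = tau y"
    then show "x = y" using tau_expand[of x y] by simp
  qed
  have "\<exists>x. tau x = y" for y
  proof (cases "y \<ge> tau 0")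
    case True
    \<comment> \<open>Since \<open>tau\<close> has slope at least 1/2, an argument of twice the
      required increment reaches or passes \<open>y\<close>, and the intermediate value theorem
      applies.\<close>
    obtain \<xi> where "tau (2 * (y - tau 0)) - tau 0 = tau' \<xi> * (2 * (y - tau 0) - 0)" by (rule tau_mvt)
    moreover have "tau' \<xi> * (2 * (y - tau 0)) \<ge> 1/2 * (2 * (y - tau 0))"
      using tau'_bounds(2) True by (intro mult_right_mono) auto
    ultimately have "y \<le> tau (2 * (y - tau 0))" by simp
    then show ?thesis using IVT'[of tau 0 y "2 * (y - tau 0)"] True tau_cont by auto
  next
    case False
    obtain \<xi> where "tau (2 * (y - tau 0)) - tau 0 = tau' \<xi> * (2 * (y - tau 0) - 0)" by (rule tau_mvt)
    moreover have "tau' \<xi> * (2 * (y - tau 0)) \<le> 1/2 * (2 * (y - tau 0))"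
      using tau'_bounds(2)[of \<xi>] False by (intro mult_right_mono_neg) auto
    ultimately have "tau (2 * (y - tau 0)) \<le> y" by simp
    then show ?thesis using IVT'[of tau "2 * (y - tau 0)" y 0] False tau_cont by auto
  qed
  then show "surj tau" unfolding surj_def by metis
qed

lemma sig_tau [simp]: "sig (tau t) = t" unfolding sig_def using tau_bij by (simp add: bij_is_inj)
lemma tau_sig [simp]: "tau (sig u) = u" unfolding sig_def using tau_bij by (simp add: bij_is_surj surj_f_inv_f)

lemma sig_lipschitz: "\<bar>sig u - sig v\<bar> \<le> (1 + 2 * \<Lambda> / m) * \<bar>u - v\<bar>"
  using tau_expand[of "sig u" "sig v"] by simp

lemma sig_lipschitz_2: "\<bar>sig u - sig v\<bar> \<le> 2 * \<bar>u - v\<bar>"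
proof -
  have "1 + 2 * \<Lambda> / m \<le> 2" using \<Lambda>m m0 by (simp add: field_simps)
  then show ?thesis using sig_lipschitz[of u v] by (meson abs_ge_zero mult_right_mono order_trans)
qed

lemma sig_cont: "continuous_on S sig"
proof (rule continuous_on_subset[of UNIV])
  show "continuous_on UNIV sig"
    unfolding continuous_on_iff
  proof (intro ballI allI impI)
    fix x e :: real assume e: "e > 0"
    have "dist (sig x') (sig x) < e" if "dist x' x < e / 2" for x'
    proof -
      have "\<bar>sig x' - sig x\<bar> \<le> 2 * \<bar>x' - x\<bar>" by (rule sig_lipschitz_2)
      also have "\<dots> < e" using that by (simp add: dist_real_def)
      finally show ?thesis by (simp add: dist_real_def)
    qed
    then show "\<exists>d>0. \<forall>x'\<in>UNIV. dist x' x < d \<longrightarrow> dist (sig x') (sig x) < e"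
      using e half_gt_zero by blast
  qed
qed simp

lemma sig_per: "sig (u + 2 * pi) = sig u + 2 * pi"
  using sig_tau[of "sig u + 2 * pi"] by (simp add: tau_per del: sig_tau)

lemma amp_lipschitz: "\<bar>amp x - amp y\<bar> \<le> \<Lambda> * B * \<bar>x - y\<bar>"
proof -
  have "norm (amp x - amp y) \<le> \<Lambda> * B * norm (x - y)"
  proof (rule field_differentiable_bound[of UNIV amp "\<lambda>t. Re (L' t) * amp t"])
    fix t
    show "norm (Re (L' t) * amp t) \<le> \<Lambda> * B"
      unfolding norm_mult using amp_le[of t] amp_pos[of t] \<Lambda>[of t] abs_Re_le_cmod[of "L' t"] \<Lambda>0
      by (intro mult_mono) auto
  qed (auto intro: amp_deriv)
  then show ?thesis by simp
qed

lemma node_Suc: "node (Suc j) = node j + pi / m" using m0 by (simp add: node_def field_simps)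

lemma integral_nodes:
  assumes "f integrable_on {0..2*pi}"
  shows "(\<Sum>j<2*m. integral {node j..node (Suc j)} f) = integral {0..2*pi} (f :: real \<Rightarrow> real)"
  using integral_uniform_partition[OF _ assms, of "2 * m"] m by (simp add: node_def)

text \<open>The substitution is carried out on the period starting at \<open>sig 0\<close>, on which
  \<open>tau\<close> runs exactly from 0 to \<open>2 * pi\<close>. The integrand, including the
  factor \<open>tau'\<close>, is periodic, so the standard period gives the same value.\<close>

lemma integral_tau:
  fixes F :: "real \<Rightarrow> real"
  assumes F: "continuous_on UNIV F" and Fper: "\<And>u. F (u + 2 * pi) = F u"
  shows "integral {0..2*pi} (\<lambda>t. tau' t * F (tau t)) = integral {0..2*pi} F"
proof -
  define a where "a = sig 0"
  have mono: "tau x \<le> tau y" if "x \<le> y" for x y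
  proof -
    obtain \<xi> where "tau y - tau x = tau' \<xi> * (y - x)" by (rule tau_mvt)
    moreover have "tau' \<xi> * (y - x) \<ge> 0" using that tau'_bounds(2)[of \<xi>] by simp
    ultimately show ?thesis by simp
  qed
  have ta: "tau a = 0" "tau (a + 2 * pi) = 2 * pi" by (simp_all add: a_def tau_per)
  have "((\<lambda>t. tau' t *\<^sub>R F (tau t)) has_integral integral {tau a..tau (a + 2 * pi)} F) {a..a + 2 * pi}"
  proof (rule has_integral_substitution[of _ _ _ 0 "2 * pi"])
    show "tau ` {a..a + 2 * pi} \<subseteq> {0..2*pi}" using mono[of a] mono[of _ "a + 2 * pi"] ta by auto
  qed (use ta F in \<open>auto intro: tau_deriv continuous_on_subset\<close>)
  then have "integral {a..a + 2 * pi} (\<lambda>t. tau' t * F (tau t)) = integral {0..2*pi} F"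
    by (simp add: ta integral_unique)
  moreover have "integral {a..a + 2 * pi} (\<lambda>t. tau' t * F (tau t)) = integral {0..2*pi} (\<lambda>t. tau' t * F (tau t))"
  proof (rule integral_periodic)
    show "tau' (t + 2 * pi) * F (tau (t + 2 * pi)) = tau' t * F (tau t)" for t
      by (simp add: tau_per Fper tau'_def L'_per)
    show "(\<lambda>t. tau' t * F (tau t)) integrable_on {u..v}" for u v
      by (intro integrable_continuous_interval continuous_intros tau'_cont continuous_on_compose2[OF F] tau_cont) auto
  qed simp
  ultimately show ?thesis by simp
qed

text \<open>Two errors of order \<open>\<Lambda> * B * W / m\<close> are made. Inserting the factor
  \<open>tau'\<close>, which differs from 1 by at most \<open>\<Lambda> / m\<close>, costs
  \<open>2 * pi\<close>; freezing the amplitude on the \<open>2 * m\<close> cells costs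
  \<open>4 * pi ^ 2\<close>, since it is Lipschitz with constant \<open>\<Lambda> * B\<close> and
  \<open>sig\<close> with constant 2. The sum of the two coefficients is below 50.\<close>

lemma freeze_amp:
  fixes h :: "real \<Rightarrow> real"
  assumes h: "continuous_on UNIV h" and hper: "\<And>u. h (u + 2 * pi) = h u" and W: "\<And>u. \<bar>h u\<bar> \<le> W"
  shows "\<bar>integral {0..2*pi} (\<lambda>t. h (tau t) * amp t) - (\<Sum>j<2*m. amp (sig (node j)) * integral {node j..node (Suc j)} h)\<bar>
    \<le> 50 * \<Lambda> * B * W / m"
proof -
  have W0: "W \<ge> 0" using W[of 0] by linarith
  define F where "F u = h u * amp (sig u)" for u
  have asc: "continuous_on S (\<lambda>u. amp (sig u))" for S
    by (rule continuous_on_compose2[OF amp_cont[of UNIV] sig_cont]) auto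
  have Fc: "continuous_on S F" for S unfolding F_def[abs_def]
    by (intro continuous_intros continuous_on_subset[OF h] asc) auto
  have hi: "h integrable_on {u..v}" for u v
    by (rule integrable_continuous_interval) (rule continuous_on_subset[OF h], simp)
  have Fi: "F integrable_on {u..v}" for u v by (rule integrable_continuous_interval[OF Fc])
  have 1: "integral {0..2*pi} (\<lambda>t. tau' t * (h (tau t) * amp t)) = integral {0..2*pi} F"
    using integral_tau[of F, OF Fc] by (simp add: F_def hper sig_per amp_per)
  have htc: "continuous_on S (\<lambda>t. h (tau t) * amp t)" for S
    by (intro continuous_intros amp_cont continuous_on_compose2[OF h] tau_cont) auto
  have 2: "\<bar>integral {0..2*pi} (\<lambda>t. h (tau t) * amp t) - integral {0..2*pi} F\<bar> \<le> (\<Lambda> / m * (W * B)) * (2 * pi - 0)"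
  proof -
    have "integral {0..2*pi} (\<lambda>t. h (tau t) * amp t) - integral {0..2*pi} F =
        integral {0..2*pi} (\<lambda>t. (1 - tau' t) * (h (tau t) * amp t))"
      unfolding 1[symmetric] left_diff_distrib mult_1
      by (intro Henstock_Kurzweil_Integration.integral_diff[symmetric] integrable_continuous_interval continuous_on_mult htc tau'_cont)
    moreover have "norm (integral {0..2*pi} (\<lambda>t. (1 - tau' t) * (h (tau t) * amp t))) \<le> (\<Lambda> / m * (W * B)) * (2 * pi - 0)"
    proof (rule integral_bound)
      fix t
      have "\<bar>1 - tau' t\<bar> \<le> \<Lambda> / m" using tau'_bounds(1)[of t] by (simp add: abs_minus_commute)
      then show "norm ((1 - tau' t) * (h (tau t) * amp t)) \<le> \<Lambda> / m * (W * B)"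
        unfolding norm_mult using W[of "tau t"] amp_le[of t] amp_pos[of t] \<Lambda>0 m0 W0
        by (intro mult_mono) auto
    qed (auto intro!: continuous_intros tau'_cont htc)
    ultimately show ?thesis by simp
  qed
  define \<delta> where "\<delta> = pi / m"
  have \<delta>: "\<delta> > 0" using m0 by (simp add: \<delta>_def)
  have 3: "\<bar>integral {node j..node (Suc j)} F - amp (sig (node j)) * integral {node j..node (Suc j)} h\<bar>
      \<le> W * (\<Lambda> * B * (2 * \<delta>)) * \<delta>" for j
  proof -
    have "integral {node j..node (Suc j)} F - amp (sig (node j)) * integral {node j..node (Suc j)} h =
        integral {node j..node (Suc j)} (\<lambda>u. F u - amp (sig (node j)) * h u)"
      using Fi hi by (simp add: Henstock_Kurzweil_Integration.integral_diff integrable_on_mult_right)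
    moreover have "norm (integral {node j..node (Suc j)} (\<lambda>u. F u - amp (sig (node j)) * h u)) \<le> W * (\<Lambda> * B * (2 * \<delta>)) * (node (Suc j) - node j)"
    proof (rule integral_bound)
      show "node j \<le> node (Suc j)" using m0 by (simp add: node_Suc)
      show "continuous_on {node j..node (Suc j)} (\<lambda>u. F u - amp (sig (node j)) * h u)"
        by (intro continuous_intros Fc continuous_on_subset[OF h]) auto
      fix u assume u: "u \<in> {node j..node (Suc j)}"
      have "\<bar>sig u - sig (node j)\<bar> \<le> 2 * \<delta>"
        using sig_lipschitz_2[of u "node j"] u by (auto simp: node_Suc \<delta>_def)
      then have "\<Lambda> * B * \<bar>sig u - sig (node j)\<bar> \<le> \<Lambda> * B * (2 * \<delta>)"
        using \<Lambda>0 B0 by (intro mult_left_mono) auto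
      then have "\<bar>amp (sig u) - amp (sig (node j))\<bar> \<le> \<Lambda> * B * (2 * \<delta>)"
        using amp_lipschitz[of "sig u" "sig (node j)"] by linarith
      then have "\<bar>h u\<bar> * \<bar>amp (sig u) - amp (sig (node j))\<bar> \<le> W * (\<Lambda> * B * (2 * \<delta>))"
        using W[of u] W0 by (intro mult_mono) auto
      then show "norm (F u - amp (sig (node j)) * h u) \<le> W * (\<Lambda> * B * (2 * \<delta>))"
        by (simp add: F_def algebra_simps flip: abs_mult)
    qed
    ultimately show ?thesis by (simp add: node_Suc \<delta>_def)
  qed
  have "\<bar>integral {0..2*pi} F - (\<Sum>j<2*m. amp (sig (node j)) * integral {node j..node (Suc j)} h)\<bar>
      = \<bar>\<Sum>j<2*m. integral {node j..node (Suc j)} F - amp (sig (node j)) * integral {node j..node (Suc j)} h\<bar>"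
    using integral_nodes[OF Fi] by (simp add: sum_subtractf)
  also have "\<dots> \<le> (\<Sum>j<2*m. W * (\<Lambda> * B * (2 * \<delta>)) * \<delta>)"
    by (rule sum_abs[THEN order_trans]) (intro sum_mono 3)
  also have "\<dots> = 4 * pi\<^sup>2 * (\<Lambda> * B * W / m)"
    using m0 by (simp add: \<delta>_def power2_eq_square field_simps)
  finally have 4: "\<bar>integral {0..2*pi} F - (\<Sum>j<2*m. amp (sig (node j)) * integral {node j..node (Suc j)} h)\<bar>
      \<le> 4 * pi\<^sup>2 * (\<Lambda> * B * W / m)" .
  have "pi\<^sup>2 \<le> 3.2\<^sup>2" using pi_approx by (intro power_mono) auto
  then have "2 * pi + 4 * pi\<^sup>2 \<le> 50" using pi_approx by (simp add: power2_eq_square)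
  then have "(2 * pi + 4 * pi\<^sup>2) * (\<Lambda> * B * W / m) \<le> 50 * (\<Lambda> * B * W / m)"
    using \<Lambda>0 B0 W0 m0 by (intro mult_right_mono) auto
  moreover have "(\<Lambda> / m * (W * B)) * (2 * pi - 0) = 2 * pi * (\<Lambda> * B * W / m)" by simp
  moreover have "50 * (\<Lambda> * B * W / m) = 50 * \<Lambda> * B * W / m" by simp
  ultimately show ?thesis using 2 4 unfolding distrib_right by linarith
qed

text \<open>After pairing about a zero of the cosine, points at distance \<open>2 * x / m\<close>
  carry values that differ by at most \<open>\<omega> (2 * x / m)\<close>. Divided by
  \<open>m\<close>, this integral thus bounds the integral of a function of \<open>u\<close> with
  modulus of continuity \<omega> against one half-period of \<open>cos (m u)\<close>.\<close>

definition cell_max :: "(real \<Rightarrow> real) \<Rightarrow> real" where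
  "cell_max \<omega> = integral {0..pi/2} (\<lambda>x. \<omega> (2 * x / m) * sin x)"

lemma modulus_sin_integrable:
  assumes "modulus_of_continuity \<omega>"
  shows "(\<lambda>x. \<omega> (2 * x / m) * sin x) integrable_on {0..pi/2}"
  by (intro integrable_continuous_interval continuous_intros
        continuous_on_compose2[OF modulus_of_continuityD(5)[OF assms]]) (use m0 in auto)

lemma cell_max_bounds:
  assumes "modulus_of_continuity \<omega>"
  shows "0 \<le> cell_max \<omega>" "cell_max \<omega> \<le> \<omega> pi"
proof -
  have *: "0 \<le> \<omega> (2 * x / m) * sin x" "\<omega> (2 * x / m) * sin x \<le> \<omega> pi * sin x" if "x \<in> {0..pi/2}" for x
  proof -
    have s: "sin x \<ge> 0" using that by (intro sin_ge_zero) auto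
    have "2 * x / m \<le> 2 * x / 1" using m that by (intro divide_left_mono) auto
    then have "2 * x / m \<le> pi" using that by simp
    then have "\<omega> (2 * x / m) \<le> \<omega> pi" using that by (intro modulus_of_continuityD(1)[OF assms]) auto
    then show "\<omega> (2 * x / m) * sin x \<le> \<omega> pi * sin x" using s by (intro mult_right_mono)
    show "0 \<le> \<omega> (2 * x / m) * sin x"
      using s that by (intro mult_nonneg_nonneg modulus_of_continuityD(3)[OF assms]) auto
  qed
  show "0 \<le> cell_max \<omega>"
    unfolding cell_max_def by (rule Henstock_Kurzweil_Integration.integral_nonneg[OF modulus_sin_integrable[OF assms] *(1)])
  have "(sin has_integral (- cos (pi/2) - - cos 0)) {0..pi/2}"
    by (rule fundamental_theorem_of_calculus)
      (auto intro!: derivative_eq_intros simp: has_real_derivative_iff_has_vector_derivative[symmetric])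
  then have s: "(sin has_integral 1) {0..pi/2}" by simp
  have "cell_max \<omega> \<le> integral {0..pi/2} (\<lambda>x. \<omega> pi * sin x)"
    unfolding cell_max_def
    by (rule integral_le[OF modulus_sin_integrable[OF assms]]) (use s * in \<open>auto intro!: integrable_on_mult_right\<close>)
  also have "\<dots> = \<omega> pi" using s by (simp add: integral_unique)
  finally show "cell_max \<omega> \<le> \<omega> pi" .
qed

definition node_sum :: real where "node_sum = (\<Sum>j<2*m. amp (sig (node j))) * pi / m"

text \<open>With \<open>h = 1\<close> the freezing estimate compares the integral of the amplitude
  over \<open>t\<close> with its Riemann sum at the equidistant nodes in \<open>u\<close>.\<close>

lemma node_sum_total: "\<bar>total - node_sum\<bar> \<le> 50 * \<Lambda> * B / m"
proof -
  have "integral {node j..node (Suc j)} (\<lambda>u. 1::real) = pi / m" for j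
    using m0 by (simp add: node_Suc)
  then show ?thesis
    using freeze_amp[of "\<lambda>_. 1" 1] by (simp add: total_def node_sum_def sum_distrib_right sum_divide_distrib)
qed

lemma total_bounds: "0 \<le> total" "total \<le> 2 * pi * B"
proof -
  show "0 \<le> total" unfolding total_def
    by (rule Henstock_Kurzweil_Integration.integral_nonneg) (use amp_pos less_imp_le in \<open>auto intro: integrable_continuous_interval amp_cont\<close>)
  have "norm (integral {0..2*pi} amp) \<le> B * (2 * pi - 0)"
    by (rule integral_bound) (use amp_le in \<open>auto intro: amp_cont simp: abs_of_pos[OF amp_pos]\<close>)
  then show "total \<le> 2 * pi * B" unfolding total_def by (simp add: mult_ac)
qed

text \<open>In the variable \<open>u = tau t\<close> the wave is an exact cosine of frequency
  \<open>m\<close>: the integrand is \<open>h (tau t) * amp t\<close> with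
  \<open>h u = \<phi> (sig u) * cos (m u)\<close>, so the amplitude can be frozen cell by
  cell.\<close>

lemma wave_integral_cells:
  fixes \<phi> :: "real \<Rightarrow> real"
  assumes c: "continuous_on UNIV \<phi>" and p: "\<And>t. \<phi> (t + 2 * pi) = \<phi> t" and W: "\<And>t. \<bar>\<phi> t\<bar> \<le> W"
  shows "\<bar>integral {0..2*pi} (\<lambda>t. \<phi> t * wave t) -
      (\<Sum>j<2*m. amp (sig (node j)) * integral {node j..node (Suc j)} (\<lambda>u. \<phi> (sig u) * cos (real m * u)))\<bar>
    \<le> 50 * \<Lambda> * B * W / m"
proof -
  define h where "h u = \<phi> (sig u) * cos (real m * u)" for u
  have W0: "W \<ge> 0" using W[of 0] by linarith
  have "continuous_on UNIV h" unfolding h_def[abs_def]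
    by (intro continuous_intros continuous_on_compose2[OF c] sig_cont) auto
  moreover have "h (u + 2 * pi) = h u" for u
    using periodic_cos_nat[of m u 0] by (simp add: h_def sig_per p)
  moreover have "\<bar>h u\<bar> \<le> W" for u
    using mult_mono[OF W[of "sig u"] abs_cos_le_one[of "real m * u"]] W0 by (simp add: h_def abs_mult)
  ultimately have "\<bar>integral {0..2*pi} (\<lambda>t. h (tau t) * amp t) - (\<Sum>j<2*m. amp (sig (node j)) * integral {node j..node (Suc j)} h)\<bar>
    \<le> 50 * \<Lambda> * B * W / m" by (rule freeze_amp)
  moreover have "h (tau t) * amp t = \<phi> t * wave t" for t by (simp add: h_def wave_eq)
  then have "(\<lambda>t. h (tau t) * amp t) = (\<lambda>t. \<phi> t * wave t)" by (rule ext)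
  ultimately show ?thesis unfolding h_def[abs_def] by metis
qed

text \<open>Paired points at distance \<open>2 * x / m\<close> in \<open>u\<close> come from points
  in \<open>t\<close> at most \<open>1 + 2 * \<Lambda> / m\<close> times as far apart, and concavity
  takes this factor out of \<open>\<omega>\<close>.\<close>

lemma wave_cell_le:
  assumes \<omega>: "modulus_of_continuity \<omega>" "concave_on {0..} \<omega>" and \<phi>: "\<phi> \<in> H_class \<omega>"
  shows "\<bar>integral {node j..node (Suc j)} (\<lambda>u. \<phi> (sig u) * cos (real m * u))\<bar> \<le> (1 + 2 * \<Lambda> / m) * (cell_max \<omega> / m)"
proof -
  define z where "z = (real j + 1/2) * pi / real m"
  have c: "continuous_on UNIV \<phi>" using \<phi> by (simp add: H_class_def C_per_def)
  have pc: "continuous_on S (\<lambda>u. \<phi> (sig u))" for S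
    by (intro continuous_on_compose2[OF c] sig_cont) auto
  define D where "D x = (\<phi> (sig (z - x / m)) - \<phi> (sig (z + x / m))) * sin x" for x
  have e: "integral {node j..node (Suc j)} (\<lambda>u. \<phi> (sig u) * cos (real m * u)) = (-1) ^ j / real m * integral {0..pi/2} D"
    unfolding node_def D_def[abs_def] z_def by (rule integral_cell[OF pc m])
  have Dc: "continuous_on {0..pi/2} D"
    unfolding D_def[abs_def]
    by (intro continuous_intros continuous_on_compose2[OF pc[of UNIV]]) (use m0 in auto)
  have "norm (integral {0..pi/2} D) \<le> integral {0..pi/2} (\<lambda>x. (1 + 2 * \<Lambda> / m) * (\<omega> (2 * x / m) * sin x))"
  proof (rule integral_norm_bound_integral)
    show "D integrable_on {0..pi/2}" by (rule integrable_continuous_interval[OF Dc])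
    show "(\<lambda>x. (1 + 2 * \<Lambda> / m) * (\<omega> (2 * x / m) * sin x)) integrable_on {0..pi/2}"
      by (intro integrable_on_mult_right modulus_sin_integrable \<omega>)
    fix x assume x: "x \<in> {0..pi/2}"
    have s: "sin x \<ge> 0" using x by (intro sin_ge_zero) auto
    have "\<bar>sig (z - x / m) - sig (z + x / m)\<bar> \<le> (1 + 2 * \<Lambda> / m) * (2 * x / m)"
      using sig_lipschitz[of "z - x / m" "z + x / m"] x by (simp add: mult.assoc)
    then have "\<omega> \<bar>sig (z - x / m) - sig (z + x / m)\<bar> \<le> \<omega> ((1 + 2 * \<Lambda> / m) * (2 * x / m))"
      by (intro modulus_of_continuityD(1)[OF \<omega>(1)]) auto
    also have "\<dots> \<le> (1 + 2 * \<Lambda> / m) * \<omega> (2 * x / m)"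
      using \<Lambda>0 x by (intro concave_modulus_scale \<omega>) auto
    finally have "\<bar>\<phi> (sig (z - x / m)) - \<phi> (sig (z + x / m))\<bar> \<le> (1 + 2 * \<Lambda> / m) * \<omega> (2 * x / m)"
      using H_classD[OF \<phi>] order_trans by blast
    then have "\<bar>\<phi> (sig (z - x / m)) - \<phi> (sig (z + x / m))\<bar> * sin x \<le> (1 + 2 * \<Lambda> / m) * \<omega> (2 * x / m) * sin x"
      using s by (rule mult_right_mono)
    then show "norm (D x) \<le> (1 + 2 * \<Lambda> / m) * (\<omega> (2 * x / m) * sin x)"
      using s by (simp only: D_def real_norm_def abs_mult abs_of_nonneg mult.assoc)
  qed
  also have "\<dots> = (1 + 2 * \<Lambda> / m) * cell_max \<omega>" by (simp add: cell_max_def)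
  finally have "\<bar>integral {0..pi/2} D\<bar> / m \<le> (1 + 2 * \<Lambda> / m) * cell_max \<omega> / m"
    using m0 by (simp add: divide_right_mono)
  moreover have "\<bar>(-1) ^ j / real m * integral {0..pi/2} D\<bar> = \<bar>integral {0..pi/2} D\<bar> / m"
    unfolding abs_mult abs_divide by simp
  ultimately show ?thesis unfolding e by (simp only: times_divide_eq_right)
qed

lemma integral_wave_le:
  assumes \<omega>: "modulus_of_continuity \<omega>" "concave_on {0..} \<omega>" and \<phi>: "\<phi> \<in> H_class \<omega>"
    and W: "\<And>t. \<bar>\<phi> t\<bar> \<le> \<omega> pi"
  shows "\<bar>integral {0..2*pi} (\<lambda>t. \<phi> t * wave t)\<bar> \<le> cell_max \<omega> * total / pi + 100 * (\<Lambda> * B * \<omega> pi / m)"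
proof -
  define \<Omega> where "\<Omega> = cell_max \<omega>"
  define E where "E = \<Lambda> * B / m"
  define \<epsilon> where "\<epsilon> = \<Lambda> / m"
  have \<epsilon>: "0 \<le> \<epsilon>" "\<epsilon> \<le> 1/2" using \<Lambda>m m0 \<Lambda>0 by (auto simp: \<epsilon>_def field_simps)
  have E0: "E \<ge> 0" using \<Lambda>0 B0 m0 by (simp add: E_def)
  have \<Omega>: "0 \<le> \<Omega>" "\<Omega> \<le> \<omega> pi" using cell_max_bounds[OF \<omega>(1)] by (auto simp: \<Omega>_def)
  define S where "S = (\<Sum>j<2*m. amp (sig (node j)) * integral {node j..node (Suc j)} (\<lambda>u. \<phi> (sig u) * cos (real m * u)))"
  have 1: "\<bar>integral {0..2*pi} (\<lambda>t. \<phi> t * wave t) - S\<bar> \<le> 50 * E * \<omega> pi"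
    using wave_integral_cells[of \<phi> "\<omega> pi"] \<phi> W by (simp add: H_class_def C_per_def periodic2pi_def S_def E_def)
  have "\<bar>S\<bar> \<le> (\<Sum>j<2*m. amp (sig (node j)) * ((1 + 2 * \<epsilon>) * (\<Omega> / m)))"
    unfolding S_def
  proof (rule sum_abs[THEN order_trans], rule sum_mono)
    fix j
    have "\<bar>integral {node j..node (Suc j)} (\<lambda>u. \<phi> (sig u) * cos (real m * u))\<bar> \<le> (1 + 2 * \<epsilon>) * (\<Omega> / m)"
      using wave_cell_le[OF \<omega> \<phi>, of j] by (simp add: \<epsilon>_def \<Omega>_def)
    then show "\<bar>amp (sig (node j)) * integral {node j..node (Suc j)} (\<lambda>u. \<phi> (sig u) * cos (real m * u))\<bar> \<le> amp (sig (node j)) * ((1 + 2 * \<epsilon>) * (\<Omega> / m))"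
      unfolding abs_mult abs_of_pos[OF amp_pos] using amp_pos[of "sig (node j)"] by (intro mult_left_mono) auto
  qed
  also have "\<dots> = (1 + 2 * \<epsilon>) * \<Omega> / pi * node_sum"
    unfolding sum_distrib_right[symmetric] by (simp add: node_sum_def)
  also have "\<dots> \<le> (1 + 2 * \<epsilon>) * \<Omega> / pi * (total + 50 * E)"
    using node_sum_total \<epsilon> \<Omega> by (intro mult_left_mono) (auto simp: E_def abs_le_iff)
  also have "\<dots> = \<Omega> * total / pi + 2 * \<epsilon> * \<Omega> * total / pi + (1 + 2 * \<epsilon>) / pi * (50 * E * \<Omega>)"
    by (simp add: field_simps)
  \<comment> \<open>In units of \<open>E * \<omega> pi\<close>, the distortion of distances costs 4
    and the passage from the node sum to the integral \<open>100 / 3\<close>; with the 50 from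
    freezing the sum stays below 100.\<close>
  also have "\<dots> \<le> \<Omega> * total / pi + 4 * (E * \<omega> pi) + 2 / 3 * (50 * E * \<omega> pi)"
  proof (intro add_mono order_refl)
    have "\<Omega> * total \<le> \<omega> pi * (2 * pi * B)" using \<Omega> total_bounds B0 by (intro mult_mono) auto
    then have "2 * \<epsilon> / pi * (\<Omega> * total) \<le> 2 * \<epsilon> / pi * (\<omega> pi * (2 * pi * B))" using \<epsilon> by (intro mult_left_mono) auto
    then show "2 * \<epsilon> * \<Omega> * total / pi \<le> 4 * (E * \<omega> pi)" by (simp add: \<epsilon>_def E_def mult_ac)
    have "(1 + 2 * \<epsilon>) / pi \<le> 2 / 3" using \<epsilon> pi_gt3 by (intro frac_le) auto
    then show "(1 + 2 * \<epsilon>) / pi * (50 * E * \<Omega>) \<le> 2 / 3 * (50 * E * \<omega> pi)"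
      using \<Omega> E0 \<epsilon> by (intro mult_mono) auto
  qed
  finally have "\<bar>S\<bar> \<le> \<Omega> * total / pi + 4 * (E * \<omega> pi) + 2 / 3 * (50 * E * \<omega> pi)" .
  moreover have "E * \<omega> pi \<ge> 0" using E0 \<Omega> by simp
  ultimately have "\<bar>integral {0..2*pi} (\<lambda>t. \<phi> t * wave t)\<bar> \<le> \<Omega> * total / pi + 100 * (E * \<omega> pi)"
    using 1 by linarith
  then show ?thesis by (simp add: \<Omega>_def E_def)
qed

end

section \<open>The folded odd function and its modulus of continuity\<close>

lemma arccos_cos_le: "arccos (cos z) \<le> \<bar>z\<bar>"
proof (cases "\<bar>z\<bar> \<le> pi")
  case True
  then have "arccos (cos \<bar>z\<bar>) = \<bar>z\<bar>" by (intro arccos_cos) auto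
  then show ?thesis by simp
next
  case False
  then show ?thesis using arccos_ubound[of "cos z"] by simp
qed

lemma arccos_cos_eq_dist:
  obtains k :: int where "arccos (cos y) = \<bar>y + of_int k * (2 * pi)\<bar>"
proof -
  obtain k :: int where k: "\<bar>y + of_int k * (2 * pi)\<bar> \<le> pi" by (rule real_mod_2pi)
  have "arccos (cos \<bar>y + of_int k * (2 * pi)\<bar>) = \<bar>y + of_int k * (2 * pi)\<bar>"
    using k by (intro arccos_cos) auto
  then show ?thesis using that[of k] cos_periodic_int[of y k] by simp
qed

text \<open>\<open>arccos (cos y)\<close> is the distance from \<open>y\<close> to the nearest
  multiple of \<open>2 * pi\<close>, and a distance to a set is 1-Lipschitz.\<close>

lemma arccos_cos_lipschitz: "\<bar>arccos (cos x) - arccos (cos y)\<bar> \<le> \<bar>x - y\<bar>"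
proof -
  have "arccos (cos x) - arccos (cos y) \<le> \<bar>x - y\<bar>" for x y
  proof -
    obtain k :: int where k: "arccos (cos y) = \<bar>y + of_int k * (2 * pi)\<bar>" by (rule arccos_cos_eq_dist)
    have "arccos (cos x) \<le> \<bar>x + of_int k * (2 * pi)\<bar>"
      using arccos_cos_le[of "x + of_int k * (2 * pi)"] by (simp add: cos_periodic_int)
    then show ?thesis using k by linarith
  qed
  from this[of x y] this[of y x] show ?thesis by linarith
qed

text \<open>The two factors are chosen so that the values at \<open>x\<close> and
  \<open>- x\<close>, points at distance \<open>2 * x\<close>, differ by exactly
  \<open>\<omega> (2 * x)\<close>, the largest difference that the class permits.\<close>

definition odd_half :: "(real \<Rightarrow> real) \<Rightarrow> real \<Rightarrow> real" where
  "odd_half \<omega> x = sgn x * \<omega> (2 * \<bar>x\<bar>) / 2"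

lemma odd_half_nonneg: "\<omega> 0 = 0 \<Longrightarrow> x \<ge> 0 \<Longrightarrow> odd_half \<omega> x = \<omega> (2 * x) / 2"
  by (cases "x = 0") (auto simp: odd_half_def)

lemma odd_half_minus: "odd_half \<omega> (- x) = - odd_half \<omega> x"
  by (simp add: odd_half_def sgn_minus)

text \<open>For arguments of the same sign, subadditivity reduces the claim to
  \<open>\<omega> (2 * d) \<le> 2 * \<omega> d\<close>. For opposite signs the two values add up,
  and concavity at the midpoint of \<open>2 * a\<close> and \<open>2 * b\<close> gives
  \<open>\<omega> (2 * a) + \<omega> (2 * b) \<le> 2 * \<omega> (a + b)\<close>.\<close>

lemma odd_half_modulus:
  assumes \<omega>: "modulus_of_continuity \<omega>" "concave_on {0..} \<omega>"
  shows "\<bar>odd_half \<omega> x - odd_half \<omega> y\<bar> \<le> \<omega> \<bar>x - y\<bar>"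
proof -
  note mono = modulus_of_continuityD(1)[OF \<omega>(1)] and sub = modulus_of_continuityD(4)[OF \<omega>(1)]
    and nn = modulus_of_continuityD(3)[OF \<omega>(1)]
  have same: "\<omega> (2 * a) - \<omega> (2 * b) \<le> 2 * \<omega> (a - b)" if "0 \<le> b" "b \<le> a" for a b
  proof -
    have "\<omega> (2 * b + 2 * (a - b)) \<le> \<omega> (2 * b) + \<omega> (2 * (a - b))" using that by (intro sub) auto
    moreover have "\<omega> (2 * (a - b)) \<le> 2 * \<omega> (a - b)" using that by (intro concave_modulus_scale \<omega>) auto
    ultimately show ?thesis by (simp add: algebra_simps)
  qed
  have same': "\<bar>\<omega> (2 * a) - \<omega> (2 * b)\<bar> \<le> 2 * \<omega> \<bar>a - b\<bar>" if "0 \<le> a" "0 \<le> b" for a b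
  proof (cases "b \<le> a")
    case True
    then show ?thesis using same[of b a] mono[of "2 * b" "2 * a"] that by simp
  next
    case False
    then show ?thesis using same[of a b] mono[of "2 * a" "2 * b"] that by simp
  qed
  have opp: "\<omega> (2 * a) + \<omega> (2 * b) \<le> 2 * \<omega> (a + b)" if "0 \<le> a" "0 \<le> b" for a b
  proof -
    have "\<omega> ((1 - 1/2) *\<^sub>R (2 * a) + (1/2) *\<^sub>R (2 * b)) \<ge> (1 - 1/2) * \<omega> (2 * a) + (1/2) * \<omega> (2 * b)"
      using that by (intro concave_onD[OF \<omega>(2)]) auto
    then show ?thesis by simp
  qed
  have z: "\<omega> 0 = 0" by (rule modulus_of_continuityD(2)[OF \<omega>(1)])
  have r: "odd_half \<omega> x = \<omega> (2 * x) / 2" if "x \<ge> 0" for x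
    using that z by (cases "x = 0") (auto simp: odd_half_def)
  have l: "odd_half \<omega> x = - \<omega> (2 * (- x)) / 2" if "x \<le> 0" for x
    using that z by (cases "x = 0") (auto simp: odd_half_def)
  consider "x \<ge> 0" "y \<ge> 0" | "x \<le> 0" "y \<le> 0" | "x \<ge> 0" "y \<le> 0" | "x \<le> 0" "y \<ge> 0" by linarith
  then show ?thesis
  proof cases
    case 1
    then show ?thesis using same'[of x y] r[of x] r[of y] by linarith
  next
    case 2
    have "\<bar>x - y\<bar> = \<bar>- x - - y\<bar>" by linarith
    moreover have "\<bar>\<omega> (2 * - x) - \<omega> (2 * - y)\<bar> \<le> 2 * \<omega> \<bar>- x - - y\<bar>" using same'[of "- x" "- y"] 2 by simp
    ultimately show ?thesis unfolding l[OF 2(1)] l[OF 2(2)] by (simp add: abs_le_iff)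
  next
    case 3
    have "\<bar>x - y\<bar> = x + - y" using 3 by linarith
    then show ?thesis using opp[of x "- y"] r[of x] l[of y] 3 nn[of "2 * x"] nn[of "2 * - y"] by simp
  next
    case 4
    have "\<bar>x - y\<bar> = - x + y" using 4 by linarith
    then show ?thesis using opp[of "- x" y] l[of x] r[of y] 4 nn[of "2 * - x"] nn[of "2 * y"] by simp
  qed
qed

lemma continuous_on_of_modulus:
  assumes \<omega>: "modulus_of_continuity \<omega>" and \<phi>: "\<And>x y. \<bar>\<phi> x - \<phi> y\<bar> \<le> \<omega> \<bar>x - y\<bar>"
  shows "continuous_on UNIV \<phi>"
  unfolding continuous_on_iff
proof (intro ballI allI impI)
  fix x e :: real assume e: "e > 0"
  obtain d where d: "d > 0" "\<And>t. t \<ge> 0 \<Longrightarrow> dist t 0 < d \<Longrightarrow> dist (\<omega> t) (\<omega> 0) < e"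
    using modulus_of_continuityD(5)[OF \<omega>] e unfolding continuous_on_iff by force
  have "dist (\<phi> x') (\<phi> x) < e" if "dist x' x < d" for x'
  proof -
    have "dist (\<omega> \<bar>x' - x\<bar>) (\<omega> 0) < e" using that by (intro d) (auto simp: dist_real_def)
    then have "\<omega> \<bar>x' - x\<bar> < e" using modulus_of_continuityD(2)[OF \<omega>] by (simp add: dist_real_def)
    then show ?thesis using \<phi>[of x' x] by (simp add: dist_real_def)
  qed
  then show "\<exists>d>0. \<forall>x'\<in>UNIV. dist x' x < d \<longrightarrow> dist (\<phi> x') (\<phi> x) < e" using d(1) by blast
qed

context slow_phase
begin

text \<open>\<open>fold\<close> is a triangle wave in \<open>u\<close> with slopes 1 and -1 that
  vanishes at the zeros of \<open>cos (m u)\<close> and has its sign. Composed with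
  \<open>odd_half \<omega>\<close> it attains the bound of the pairing in every cell with the same
  sign. The divisor \<open>1 + \<epsilon>\<close> makes up for the stretching by \<open>tau\<close>,
  so that the composite has modulus of continuity \<omega> in the variable \<open>t\<close>; it
  costs only a relative error \<epsilon>.\<close>

lemma integral_wave_extremal:
  assumes \<omega>: "modulus_of_continuity \<omega>" "concave_on {0..} \<omega>"
  obtains \<phi> where "\<phi> \<in> H_class \<omega>" "\<And>t. \<bar>\<phi> t\<bar> \<le> \<omega> pi"
    "integral {0..2*pi} (\<lambda>t. \<phi> t * wave t) \<ge> cell_max \<omega> * total / pi - 100 * (\<Lambda> * B * \<omega> pi / m)"
proof -
  define \<epsilon> where "\<epsilon> = \<Lambda> / m"
  have \<epsilon>: "0 \<le> \<epsilon>" "\<epsilon> \<le> 1/2" using \<Lambda>m m0 \<Lambda>0 by (auto simp: \<epsilon>_def field_simps)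
  define fold where "fold u = (pi / 2 - arccos (cos (real m * u))) / real m" for u
  define \<phi>1 where "\<phi>1 u = odd_half \<omega> (fold u) / (1 + \<epsilon>)" for u
  define \<phi> where "\<phi> t = \<phi>1 (tau t)" for t
  have fold_lip: "\<bar>fold u - fold v\<bar> \<le> \<bar>u - v\<bar>" for u v
  proof -
    have "\<bar>fold u - fold v\<bar> = \<bar>arccos (cos (real m * u)) - arccos (cos (real m * v))\<bar> / m"
      unfolding fold_def diff_divide_distrib[symmetric] abs_divide using m0 by (simp add: abs_minus_commute)
    also have "\<dots> \<le> \<bar>real m * u - real m * v\<bar> / m"
      using m0 by (intro divide_right_mono arccos_cos_lipschitz) auto
    also have "\<dots> = \<bar>u - v\<bar>" unfolding right_diff_distrib[symmetric] abs_mult using m0 by simp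
    finally show ?thesis .
  qed
  have mod: "\<bar>\<phi> x - \<phi> y\<bar> \<le> \<omega> \<bar>x - y\<bar>" for x y
  proof -
    have "\<bar>odd_half \<omega> (fold (tau x)) - odd_half \<omega> (fold (tau y))\<bar> \<le> \<omega> \<bar>fold (tau x) - fold (tau y)\<bar>"
      by (rule odd_half_modulus[OF \<omega>])
    also have "\<dots> \<le> \<omega> ((1 + \<epsilon>) * \<bar>x - y\<bar>)"
      using fold_lip[of "tau x" "tau y"] tau_lipschitz[of x y] unfolding \<epsilon>_def
      by (intro modulus_of_continuityD(1)[OF \<omega>(1)]) auto
    also have "\<dots> \<le> (1 + \<epsilon>) * \<omega> \<bar>x - y\<bar>"
      using \<epsilon> by (intro concave_modulus_scale \<omega>) auto
    finally have *: "\<bar>odd_half \<omega> (fold (tau x)) - odd_half \<omega> (fold (tau y))\<bar> / (1 + \<epsilon>) \<le> \<omega> \<bar>x - y\<bar>"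
      using \<epsilon> by (subst pos_divide_le_eq) (auto simp: mult.commute)
    have "\<phi> x - \<phi> y = (odd_half \<omega> (fold (tau x)) - odd_half \<omega> (fold (tau y))) / (1 + \<epsilon>)"
      by (simp add: \<phi>_def \<phi>1_def diff_divide_distrib)
    then have "\<bar>\<phi> x - \<phi> y\<bar> = \<bar>odd_half \<omega> (fold (tau x)) - odd_half \<omega> (fold (tau y))\<bar> / (1 + \<epsilon>)"
      using \<epsilon> by (simp add: abs_divide)
    with * show ?thesis by simp
  qed
  have cont: "continuous_on UNIV \<phi>" by (rule continuous_on_of_modulus[OF \<omega>(1) mod])
  have per\<phi>: "\<phi> (t + 2 * pi) = \<phi> t" for t
    using periodic_cos_nat[of m "tau t" 0] by (simp add: \<phi>_def \<phi>1_def fold_def tau_per)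
  have C: "\<phi> \<in> C_per" using cont per\<phi> by (simp add: C_per_def periodic2pi_def)
  have H: "\<phi> \<in> H_class \<omega>" by (rule H_classI[OF C mod \<omega>(1)])
  have \<phi>1_cont: "continuous_on S \<phi>1" for S
  proof -
    have "\<phi>1 = (\<lambda>u. \<phi> (sig u))" by (simp add: \<phi>_def fun_eq_iff)
    then show ?thesis using continuous_on_compose2[OF cont sig_cont, of S] by simp
  qed
  have bd: "\<bar>\<phi> t\<bar> \<le> \<omega> pi" for t
  proof -
    have a: "0 \<le> arccos (cos (real m * tau t))" "arccos (cos (real m * tau t)) \<le> pi"
      by (simp_all add: arccos_lbound arccos_ubound)
    have absb: "\<bar>pi / 2 - y\<bar> \<le> pi / 2" if "0 \<le> y" "y \<le> pi" for y :: real
      using that by (simp add: abs_real_def)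
    have "\<bar>fold (tau t)\<bar> \<le> pi / 2"
    proof -
      have "\<bar>fold (tau t)\<bar> = \<bar>pi / 2 - arccos (cos (real m * tau t))\<bar> / m" using m0 by (simp add: fold_def)
      also have "\<dots> \<le> (pi / 2) / 1"
      proof (rule frac_le)
        show "\<bar>pi / 2 - arccos (cos (real m * tau t))\<bar> \<le> pi / 2" using absb[OF a] .
      qed (use m in auto)
      finally show ?thesis by simp
    qed
    then have w: "\<omega> (2 * \<bar>fold (tau t)\<bar>) \<le> \<omega> pi" by (intro modulus_of_continuityD(1)[OF \<omega>(1)]) auto
    have w0: "0 \<le> \<omega> (2 * \<bar>fold (tau t)\<bar>)" by (rule modulus_of_continuityD(3)[OF \<omega>(1)]) simp
    have "\<bar>odd_half \<omega> (fold (tau t))\<bar> \<le> \<omega> (2 * \<bar>fold (tau t)\<bar>)"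
      using w0 by (auto simp: odd_half_def abs_mult sgn_if)
    then have "\<bar>odd_half \<omega> (fold (tau t))\<bar> \<le> \<omega> pi" using w by linarith
    moreover have "\<bar>odd_half \<omega> (fold (tau t))\<bar> / (1 + \<epsilon>) \<le> \<bar>odd_half \<omega> (fold (tau t))\<bar> / 1"
      using \<epsilon> by (intro divide_left_mono) auto
    moreover have "\<bar>\<phi> t\<bar> = \<bar>odd_half \<omega> (fold (tau t))\<bar> / (1 + \<epsilon>)"
      using \<epsilon> by (simp add: \<phi>_def \<phi>1_def abs_divide)
    ultimately show ?thesis by simp
  qed
  have cell: "integral {node j..node (Suc j)} (\<lambda>u. \<phi> (sig u) * cos (real m * u)) = cell_max \<omega> / m / (1 + \<epsilon>)" for j
  proof -
    define z where "z = (real j + 1/2) * pi / real m"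
    have zero: "\<omega> 0 = 0" by (rule modulus_of_continuityD(2)[OF \<omega>(1)])
    have v: "\<phi>1 (z - x / m) - \<phi>1 (z + x / m) = (-1) ^ j * \<omega> (2 * x / m) / (1 + \<epsilon>)" if x: "x \<in> {0..pi/2}" for x
    proof -
      have a: "real m * (z - x / m) = real j * pi + (pi / 2 - x)" "real m * (z + x / m) = real j * pi + (pi / 2 + x)"
        using m0 by (simp_all add: z_def field_simps)
      have c: "arccos (cos (pi / 2 - x)) = pi / 2 - x" "arccos (cos (pi / 2 + x)) = pi / 2 + x"
        using x by (intro arccos_cos; simp)+
      have o: "odd_half \<omega> (x / m) = \<omega> (2 * x / m) / 2" "odd_half \<omega> (- x / m) = - \<omega> (2 * x / m) / 2"
        using odd_half_nonneg[of \<omega> "x / m", OF zero] odd_half_minus[of \<omega> "x / m"] x m0 by (simp_all add: mult.commute)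
      show ?thesis
      proof (cases "even j")
        case True
        then have "fold (z - x / m) = x / m" "fold (z + x / m) = - x / m"
          using c unfolding fold_def a cos_nat_pi_add by simp_all
        then have "\<phi>1 (z - x / m) - \<phi>1 (z + x / m) = (\<omega> (2 * x / m) / 2 - - \<omega> (2 * x / m) / 2) / (1 + \<epsilon>)"
          by (simp only: \<phi>1_def o diff_divide_distrib)
        then show ?thesis using True by simp
      next
        case False
        have "arccos (- cos (pi / 2 - x)) = pi - (pi / 2 - x)" "arccos (- cos (pi / 2 + x)) = pi - (pi / 2 + x)"
          using c by (subst arccos_minus; simp)+
        then have "fold (z - x / m) = - x / m" "fold (z + x / m) = x / m"
          using False unfolding fold_def a cos_nat_pi_add by simp_all
        then have "\<phi>1 (z - x / m) - \<phi>1 (z + x / m) = (- \<omega> (2 * x / m) / 2 - \<omega> (2 * x / m) / 2) / (1 + \<epsilon>)"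
          by (simp only: \<phi>1_def o diff_divide_distrib)
        then show ?thesis using False by simp
      qed
    qed
    have "integral {node j..node (Suc j)} (\<lambda>u. \<phi>1 u * cos (real m * u)) =
       (-1) ^ j / real m * integral {0..pi/2} (\<lambda>x. (\<phi>1 (z - x / m) - \<phi>1 (z + x / m)) * sin x)"
      unfolding node_def z_def by (rule integral_cell[OF \<phi>1_cont m])
    also have "integral {0..pi/2} (\<lambda>x. (\<phi>1 (z - x / m) - \<phi>1 (z + x / m)) * sin x) =
        integral {0..pi/2} (\<lambda>x. (-1) ^ j / (1 + \<epsilon>) * (\<omega> (2 * x / m) * sin x))"
      by (rule Henstock_Kurzweil_Integration.integral_cong) (simp add: v)
    also have "\<dots> = (-1) ^ j / (1 + \<epsilon>) * cell_max \<omega>"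
      unfolding cell_max_def by (rule Henstock_Kurzweil_Integration.integral_mult_right)
    also have "(-1) ^ j / real m * ((-1) ^ j / (1 + \<epsilon>) * cell_max \<omega>) = ((-1) ^ j * (-1) ^ j) * (cell_max \<omega> / m / (1 + \<epsilon>))"
      by (simp add: mult_ac)
    also have "((-1) ^ j * (-1) ^ j :: real) = 1" by (simp flip: power_mult_distrib)
    finally show ?thesis by (simp add: \<phi>_def)
  qed
  define \<Omega> where "\<Omega> = cell_max \<omega>"
  define E where "E = \<Lambda> * B / m"
  have E0: "E \<ge> 0" using \<Lambda>0 B0 m0 by (simp add: E_def)
  have \<Omega>: "0 \<le> \<Omega>" "\<Omega> \<le> \<omega> pi" using cell_max_bounds[OF \<omega>(1)] by (auto simp: \<Omega>_def)
  define S where "S = (\<Sum>j<2*m. amp (sig (node j)) * (\<Omega> / m / (1 + \<epsilon>)))"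
  have 1: "\<bar>integral {0..2*pi} (\<lambda>t. \<phi> t * wave t) - S\<bar> \<le> 50 * E * \<omega> pi"
    using wave_integral_cells[OF cont per\<phi> bd] by (simp add: cell S_def E_def \<Omega>_def)
  have S: "S = \<Omega> / pi / (1 + \<epsilon>) * node_sum"
    unfolding S_def sum_distrib_right[symmetric] by (simp add: node_sum_def mult.commute)
  have "\<Omega> * total / pi - 2 * (E * \<omega> pi) - 1 / 3 * (50 * (E * \<omega> pi)) \<le> S"
  proof -
    have "\<Omega> / pi / (1 + \<epsilon>) * (total - 50 * E) \<le> S"
      unfolding S using node_sum_total \<epsilon> \<Omega> by (intro mult_left_mono) (auto simp: E_def abs_le_iff)
    moreover have "\<Omega> / pi / (1 + \<epsilon>) * (50 * E) \<le> 1 / 3 * (50 * (E * \<omega> pi))"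
    proof -
      have "\<Omega> / pi / (1 + \<epsilon>) \<le> \<omega> pi / 3 / 1" using \<Omega> \<epsilon> pi_gt3 by (intro frac_le) auto
      then have "\<Omega> / pi / (1 + \<epsilon>) * (50 * E) \<le> \<omega> pi / 3 / 1 * (50 * E)" using E0 by (intro mult_right_mono) auto
      then show ?thesis by (simp add: mult_ac)
    qed
    moreover have "\<Omega> * total / pi - \<epsilon> * (\<Omega> * total / pi) \<le> \<Omega> / pi / (1 + \<epsilon>) * total"
    proof -
      have "1 - \<epsilon> \<le> 1 / (1 + \<epsilon>)" using \<epsilon> by (subst pos_le_divide_eq) (auto simp: algebra_simps)
      then have "(1 - \<epsilon>) * (\<Omega> * total / pi) \<le> 1 / (1 + \<epsilon>) * (\<Omega> * total / pi)"
        using \<Omega> total_bounds by (intro mult_right_mono) auto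
      moreover have "1 / (1 + \<epsilon>) * (\<Omega> * total / pi) = \<Omega> / pi / (1 + \<epsilon>) * total" by (simp add: mult.commute)
      ultimately show ?thesis unfolding left_diff_distrib mult_1 by linarith
    qed
    moreover have "\<epsilon> * (\<Omega> * total / pi) \<le> 2 * (E * \<omega> pi)"
    proof -
      have "\<Omega> * total \<le> \<omega> pi * (2 * pi * B)" using \<Omega> total_bounds B0 by (intro mult_mono) auto
      then have "\<epsilon> / pi * (\<Omega> * total) \<le> \<epsilon> / pi * (\<omega> pi * (2 * pi * B))" using \<epsilon> by (intro mult_left_mono) auto
      then show ?thesis by (simp add: \<epsilon>_def E_def mult_ac)
    qed
    ultimately show ?thesis unfolding right_diff_distrib by linarith
  qed
  moreover have "E * \<omega> pi \<ge> 0" using E0 \<Omega> by simp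
  ultimately have "integral {0..2*pi} (\<lambda>t. \<phi> t * wave t) \<ge> \<Omega> * total / pi - 100 * (E * \<omega> pi)"
    using 1 by linarith
  then show ?thesis using that[OF H bd] by (simp add: \<Omega>_def E_def)
qed

end

section \<open>The kernel of the de la Vallee Poussin deviation\<close>

definition vp_mult :: "real \<Rightarrow> nat \<Rightarrow> real \<Rightarrow> complex" where
  "vp_mult q p u = (1 - (of_real q * cis u) ^ p) / (1 - of_real q * cis u)\<^sup>2"

text \<open>The coefficient \<open>min (j + 1) p\<close> counts the \<open>i < p\<close> with
  \<open>i \<le> j\<close>. The series is therefore the sum over \<open>i < p\<close> of the tails
  \<open>z ^ i / (1 - z)\<close>, again a geometric sum.\<close>

lemma vp_mult_sums:
  assumes q: "0 < q" "q < 1"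
  shows "(\<lambda>j. of_real (min (real (Suc j)) (real p)) * (of_real q * cis u) ^ j) sums vp_mult q p u"
proof -
  define z where "z = of_real q * cis u"
  have nz: "cmod z < 1" using q by (simp add: z_def norm_mult)
  then have nz1: "1 - z \<noteq> 0" by force
  have tail: "(\<lambda>j. if i \<le> j then z ^ j else 0) sums (z ^ i / (1 - z))" for i
  proof -
    have "(\<lambda>j. z ^ i * z ^ j) sums (z ^ i * (1 / (1 - z)))" by (intro sums_mult geometric_sums nz)
    then have "(\<lambda>j. if i \<le> j + i then z ^ (j + i) else 0) sums (z ^ i / (1 - z) - (\<Sum>j<i. if i \<le> j then z ^ j else 0))"
      by (simp add: power_add mult.commute)
    then show ?thesis by (subst (asm) sums_iff_shift) simp
  qed
  have "(\<lambda>j. \<Sum>i<p. if i \<le> j then z ^ j else 0) sums (\<Sum>i<p. z ^ i / (1 - z))"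
    by (intro sums_sum tail)
  moreover have "(\<Sum>i<p. if i \<le> j then z ^ j else 0) = of_real (min (real (Suc j)) (real p)) * z ^ j" for j
  proof -
    have "(\<Sum>i<p. if i \<le> j then z ^ j else 0) = (\<Sum>i\<in>{i\<in>{..<p}. i \<le> j}. z ^ j)"
      by (rule sum.inter_filter[symmetric]) simp
    also have "{i\<in>{..<p}. i \<le> j} = {..<min (Suc j) p}" by auto
    also have "(\<Sum>i\<in>{..<min (Suc j) p}. z ^ j) = of_real (real (min (Suc j) p)) * z ^ j" by simp
    finally show ?thesis by (simp only: of_nat_min)
  qed
  moreover have "(\<Sum>i<p. z ^ i / (1 - z)) = (1 - z ^ p) / (1 - z)\<^sup>2"
    using nz1 by (simp add: sum_gp_strict power2_eq_square flip: sum_divide_distrib)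
  ultimately show ?thesis by (simp add: vp_mult_def z_def)
qed

text \<open>The Cauchy product of the series for \<open>1 / (1 - q) ^ 2\<close> and
  \<open>1 / (1 - q)\<close> has the triangular numbers as coefficients.\<close>

lemma sums_triangular:
  fixes q :: real
  assumes "0 < q" "q < 1"
  shows "(\<lambda>k. real (Suc k) * real (Suc (Suc k)) * q ^ k) sums (2 / (1 - q) ^ 3)"
proof -
  have "(\<lambda>k. \<Sum>i\<le>k. (real (Suc i) * q ^ i) * q ^ (k - i)) sums ((\<Sum>k. real (Suc k) * q ^ k) * (\<Sum>k. q ^ k))"
  proof (rule Cauchy_product_sums)
    show "summable (\<lambda>k. norm (real (Suc k) * q ^ k))"
      using sums_summable[OF geometric_deriv_sums[of q]] assms by (simp add: abs_mult)
    show "summable (\<lambda>k. norm (q ^ k))" using assms by (simp add: summable_geometric)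
  qed
  moreover have e1: "(\<Sum>k. real (Suc k) * q ^ k) = 1 / (1 - q)\<^sup>2"
    using geometric_deriv_sums[of q] assms by (simp add: sums_iff)
  moreover have e2: "(\<Sum>k. q ^ k) = 1 / (1 - q)" using assms by (simp add: suminf_geometric)
  moreover have e3: "(\<Sum>i\<le>k. (real (Suc i) * q ^ i) * q ^ (k - i)) = real (Suc k) * real (Suc (Suc k)) * q ^ k / 2" for k
  proof -
    have "(\<Sum>i\<le>k. (real (Suc i) * q ^ i) * q ^ (k - i)) = (\<Sum>i\<le>k. real (Suc i)) * q ^ k"
      unfolding sum_distrib_right by (rule sum.cong) (auto simp: mult.assoc simp flip: power_add)
    also have "(\<Sum>i\<le>k. real (Suc i)) = real (Suc k) * real (Suc (Suc k)) / 2"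
      by (induction k) (simp_all add: field_simps)
    finally show ?thesis by simp
  qed
  moreover have "1 / (1 - q)\<^sup>2 * (1 / (1 - q)) = 1 / (1 - q) ^ 3"
    by (simp add: power2_eq_square power3_eq_cube)
  ultimately have "(\<lambda>k. real (Suc k) * real (Suc (Suc k)) * q ^ k / 2) sums (1 / (1 - q) ^ 3)"
    by (simp only: e1 e2 e3)
  then have "(\<lambda>k. 2 * (real (Suc k) * real (Suc (Suc k)) * q ^ k / 2)) sums (2 * (1 / (1 - q) ^ 3))"
    by (rule sums_mult)
  then show ?thesis by simp
qed

text \<open>Replacing \<open>1 / (m + j)\<close> by \<open>1 / m\<close> in the kernel leaves this
  sum as its error. Bounding the minimum by \<open>p\<close> and by \<open>j + 1\<close> gives the
  two candidates \<open>q * p / (1 - q) ^ 2\<close> and \<open>2 * q / (1 - q) ^ 3\<close>; the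
  second is responsible for the factor 2.\<close>

lemma suminf_remainder_le:
  fixes q :: real
  assumes q: "0 < q" "q < 1" and p: "p \<ge> 1"
  shows "summable (\<lambda>j. real j * min (real (Suc j)) (real p) * q ^ j)"
    and "(\<Sum>j. real j * min (real (Suc j)) (real p) * q ^ j) \<le> 2 * (q / (1 - q)\<^sup>2 * min (real p) (1 / (1 - q)))"
proof -
  have s1: "(\<lambda>j. real j * q ^ j) sums (q / (1 - q)\<^sup>2)"
  proof -
    have "(\<lambda>j. q * (real (Suc j) * q ^ j)) sums (q * (1 / (1 - q)\<^sup>2))"
      using geometric_deriv_sums[of q] q by (intro sums_mult) simp
    then have "(\<lambda>j. real (Suc j) * q ^ Suc j) sums (q / (1 - q)\<^sup>2)" by (simp add: mult_ac)
    then show ?thesis by (subst (asm) sums_Suc_iff) simp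
  qed
  have s2: "(\<lambda>j. real j * real (Suc j) * q ^ j) sums (2 * q / (1 - q) ^ 3)"
  proof -
    have "(\<lambda>j. q * (real (Suc j) * real (Suc (Suc j)) * q ^ j)) sums (q * (2 / (1 - q) ^ 3))"
      by (intro sums_mult sums_triangular q)
    then have "(\<lambda>j. real (Suc j) * real (Suc (Suc j)) * q ^ Suc j) sums (2 * q / (1 - q) ^ 3)" by (simp add: mult_ac)
    then show ?thesis by (subst (asm) sums_Suc_iff) simp
  qed
  show sm: "summable (\<lambda>j. real j * min (real (Suc j)) (real p) * q ^ j)"
    by (rule summable_comparison_test[OF _ sums_summable[OF s2]])
      (use q in \<open>auto simp: abs_mult intro!: mult_right_mono mult_left_mono\<close>)
  have "(\<Sum>j. real j * min (real (Suc j)) (real p) * q ^ j) \<le> (\<Sum>j. real p * (real j * q ^ j))"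
  proof (rule suminf_le[OF _ sm])
    show "summable (\<lambda>j. real p * (real j * q ^ j))" by (intro summable_mult sums_summable[OF s1])
    show "real j * min (real (Suc j)) (real p) * q ^ j \<le> real p * (real j * q ^ j)" for j
    proof -
      have "real j * min (real (Suc j)) (real p) * q ^ j \<le> real j * real p * q ^ j"
        using q by (intro mult_right_mono mult_left_mono) auto
      then show ?thesis by (simp only: mult_ac)
    qed
  qed
  also have "\<dots> = real p * (q / (1 - q)\<^sup>2)" using sums_mult[OF s1, of "real p"] by (simp add: sums_iff)
  finally have 1: "(\<Sum>j. real j * min (real (Suc j)) (real p) * q ^ j) \<le> q / (1 - q)\<^sup>2 * real p" by (simp add: mult.commute)
  have "(\<Sum>j. real j * min (real (Suc j)) (real p) * q ^ j) \<le> (\<Sum>j. real j * real (Suc j) * q ^ j)"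
    by (rule suminf_le[OF _ sm sums_summable[OF s2]]) (use q in \<open>auto intro!: mult_right_mono mult_left_mono\<close>)
  also have "\<dots> = 2 * q / (1 - q) ^ 3" using s2 by (simp add: sums_iff)
  also have "\<dots> = 2 * (q / (1 - q)\<^sup>2 * (1 / (1 - q)))" by (simp add: power2_eq_square power3_eq_cube)
  finally have 2: "(\<Sum>j. real j * min (real (Suc j)) (real p) * q ^ j) \<le> 2 * (q / (1 - q)\<^sup>2 * (1 / (1 - q)))" .
  have "0 \<le> q / (1 - q)\<^sup>2 * real p" using q by simp
  have nn: "0 \<le> q / (1 - q)\<^sup>2 * real p" using q by simp
  show "(\<Sum>j. real j * min (real (Suc j)) (real p) * q ^ j) \<le> 2 * (q / (1 - q)\<^sup>2 * min (real p) (1 / (1 - q)))"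
  proof (cases "real p \<le> 1 / (1 - q)")
    case True
    then have "min (real p) (1 / (1 - q)) = real p" by (rule min_absorb1)
    then show ?thesis using 1 nn by simp
  next
    case False
    then have "min (real p) (1 / (1 - q)) = 1 / (1 - q)" by (intro min_absorb2) simp
    then show ?thesis using 2 by simp
  qed
qed

text \<open>The difference of \<open>1 / m\<close> and \<open>1 / (m + j)\<close> is
  \<open>j / (m * (m + j))\<close>, at most \<open>j / m ^ 2\<close>. The term \<open>j = 0\<close>
  is exact, which is why the error carries a factor \<open>q\<close>.\<close>

lemma vp_kernel_approx:
  assumes q: "0 < q" "q < 1" and p: "p \<ge> 1" and m: "m \<ge> 1"
  shows "\<bar>vp_kernel q \<beta> m p u - q ^ m / (real p * real m) * Re (cis (real m * u - \<beta> * pi / 2) * vp_mult q p u)\<bar>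
    \<le> q ^ m / (real p * real m) * (2 * (q / (1 - q)\<^sup>2 * min (real p) (1 / (1 - q))) / real m)"
proof -
  define Q where "Q = q ^ m / (real p * real m)"
  have Q: "Q \<ge> 0" using q by (simp add: Q_def)
  define w where "w j = min (real (Suc j)) (real p)" for j
  define \<theta> where "\<theta> j = real (m + j) * u - \<beta> * pi / 2" for j
  have w0: "w j \<ge> 0" for j using p by (simp add: w_def)
  have "(\<lambda>j. cis (real m * u - \<beta> * pi / 2) * (of_real (w j) * (of_real q * cis u) ^ j)) sums
      (cis (real m * u - \<beta> * pi / 2) * vp_mult q p u)"
    unfolding w_def by (intro sums_mult vp_mult_sums q)
  then have "(\<lambda>j. Re (cis (real m * u - \<beta> * pi / 2) * (of_real (w j) * (of_real q * cis u) ^ j))) sums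
      Re (cis (real m * u - \<beta> * pi / 2) * vp_mult q p u)"
    by (rule sums_Re)
  moreover have "Re (cis (real m * u - \<beta> * pi / 2) * (of_real (w j) * (of_real q * cis u) ^ j)) = w j * q ^ j * cos (\<theta> j)" for j
  proof -
    have "cis (real m * u - \<beta> * pi / 2) * (of_real (w j) * (of_real q * cis u) ^ j) = of_real (w j * q ^ j) * cis (\<theta> j)"
    proof -
      have "cis (real m * u - \<beta> * pi / 2) * cis (real j * u) = cis (\<theta> j)"
        unfolding cis_mult \<theta>_def by (rule arg_cong[where f = cis]) (simp add: algebra_simps)
      then show ?thesis
        unfolding power_mult_distrib Complex.DeMoivre by (simp add: mult_ac)
    qed
    moreover have "Re (of_real (w j * q ^ j) * cis (\<theta> j)) = w j * q ^ j * cos (\<theta> j)"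
      by simp
    ultimately show ?thesis by metis
  qed
  ultimately have "(\<lambda>j. w j * q ^ j * cos (\<theta> j)) sums Re (cis (real m * u - \<beta> * pi / 2) * vp_mult q p u)"
    by simp
  then have main: "(\<lambda>j. Q * (w j * q ^ j * cos (\<theta> j))) sums (Q * Re (cis (real m * u - \<beta> * pi / 2) * vp_mult q p u))"
    by (rule sums_mult)
  have "summable (\<lambda>j. w j / real p * neumann_psi q (m + j) * cos (\<theta> j))"
  proof (rule summable_comparison_test[OF _ summable_vp_coeff[OF q, of p m]], intro exI allI impI)
    fix j
    show "norm (w j / real p * neumann_psi q (m + j) * cos (\<theta> j)) \<le> \<bar>min (real (Suc j)) (real p) / real p * neumann_psi q (m + j)\<bar>"
      unfolding w_def real_norm_def abs_mult[of _ "cos (\<theta> j)"] by (rule mult_left_le) simp_all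
  qed
  then have ker: "(\<lambda>j. w j / real p * neumann_psi q (m + j) * cos (\<theta> j)) sums vp_kernel q \<beta> m p u"
    unfolding vp_kernel_def w_def \<theta>_def by (rule summable_sums)
  have diff: "(\<lambda>j. w j / real p * neumann_psi q (m + j) * cos (\<theta> j) - Q * (w j * q ^ j * cos (\<theta> j))) sums
      (vp_kernel q \<beta> m p u - Q * Re (cis (real m * u - \<beta> * pi / 2) * vp_mult q p u))"
    by (rule sums_diff[OF ker main])
  have sm: "summable (\<lambda>j. Q / real m * (real j * w j * q ^ j))"
    unfolding w_def by (intro summable_mult suminf_remainder_le(1) q p)
  have "norm (\<Sum>j. w j / real p * neumann_psi q (m + j) * cos (\<theta> j) - Q * (w j * q ^ j * cos (\<theta> j)))
      \<le> (\<Sum>j. Q / real m * (real j * w j * q ^ j))"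
  proof (rule norm_suminf_le[OF _ sm])
    fix j
    have "w j / real p * neumann_psi q (m + j) - Q * (w j * q ^ j) = - (Q * w j * q ^ j * (real j / real (m + j)))"
      using m p by (simp add: Q_def neumann_psi_def power_add divide_simps) (simp add: algebra_simps)
    then have "w j / real p * neumann_psi q (m + j) * cos (\<theta> j) - Q * (w j * q ^ j * cos (\<theta> j)) = - (Q * w j * q ^ j * (real j / real (m + j))) * cos (\<theta> j)"
      by (metis (no_types, lifting) left_diff_distrib mult.assoc)
    then have "norm (w j / real p * neumann_psi q (m + j) * cos (\<theta> j) - Q * (w j * q ^ j * cos (\<theta> j))) = (Q * w j * q ^ j * (real j / real (m + j))) * \<bar>cos (\<theta> j)\<bar>"
      using Q w0[of j] q by (simp add: abs_mult)
    also have "\<dots> \<le> (Q * w j * q ^ j * (real j / real m)) * 1"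
      using Q w0[of j] q m by (intro mult_mono divide_left_mono) auto
    finally show "norm (w j / real p * neumann_psi q (m + j) * cos (\<theta> j) - Q * (w j * q ^ j * cos (\<theta> j))) \<le> Q / real m * (real j * w j * q ^ j)"
      by (simp add: mult_ac)
  qed
  also have "\<dots> = Q / real m * (\<Sum>j. real j * w j * q ^ j)"
    unfolding w_def by (intro suminf_mult suminf_remainder_le(1) q p)
  also have "\<dots> \<le> Q / real m * (2 * (q / (1 - q)\<^sup>2 * min (real p) (1 / (1 - q))))"
    unfolding w_def using Q by (intro mult_left_mono suminf_remainder_le(2) q p) auto
  finally show ?thesis using sums_unique[OF diff] by (simp add: Q_def mult_ac)
qed

lemma continuous_vp_kernel:
  assumes q: "0 < q" "q < 1"
  shows "continuous_on UNIV (vp_kernel q \<beta> m p)"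
  unfolding vp_kernel_def[abs_def]
  by (rule cos_series_continuous[OF summable_vp_coeff[OF q]]) (auto intro!: continuous_intros)

text \<open>All frequencies \<open>m + j\<close> are positive, so the kernel is orthogonal to
  constants. Functions paired with it may thus be shifted by a constant.\<close>

lemma LINT_vp_kernel:
  assumes q: "0 < q" "q < 1" and m: "m \<ge> 1"
  shows "(LINT t|circ. vp_kernel q \<beta> m p (x - t)) = 0"
proof -
  have e: "continuous_on UNIV (\<lambda>t. cos (real (m + j) * (x - t) - \<beta> * pi / 2))"
    "\<bar>cos (real (m + j) * (x - t) - \<beta> * pi / 2)\<bar> \<le> 1" for j t
    by (auto intro!: continuous_intros)
  have i1: "integrable circ (\<lambda>t. 1::real)" by (rule integrable_circ_continuous) simp
  have "(\<lambda>j. min (real (Suc j)) (real p) / real p * neumann_psi q (m + j) * (LINT t|circ. 1 * cos (real (m + j) * (x - t) - \<beta> * pi / 2))) sums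
      (LINT t|circ. 1 * vp_kernel q \<beta> m p (x - t))"
    unfolding vp_kernel_def by (rule cos_series_sums_LINT(2)[OF i1 summable_vp_coeff[OF q] e])
  moreover have "(LINT t|circ. 1 * cos (real (m + j) * (x - t) - \<beta> * pi / 2)) = 0" for j
  proof -
    have "1 * cos (real (m + j) * (x - t) - \<beta> * pi / 2) = cos (real (m + j) * t + (\<beta> * pi / 2 - real (m + j) * x))" for t
      by (subst cos_minus[symmetric]) (simp add: algebra_simps)
    then show ?thesis using LINT_circ_cos[of "m + j"] m by simp
  qed
  ultimately have "(\<lambda>j::nat. 0) sums (LINT t|circ. vp_kernel q \<beta> m p (x - t))" by simp
  then show ?thesis using sums_unique2 sums_zero by blast
qed

text \<open>Both \<open>1 - z\<close> and \<open>1 - z ^ p\<close> have positive real part, so each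
  factor has a smooth periodic principal logarithm. The logarithm is assembled from these because
  the argument of the quotient need not stay in the principal range.\<close>

definition vp_log :: "real \<Rightarrow> nat \<Rightarrow> real \<Rightarrow> complex" where
  "vp_log q p u = Ln (1 - (of_real q * cis u) ^ p) - 2 * Ln (1 - of_real q * cis u)"

definition vp_log' :: "real \<Rightarrow> nat \<Rightarrow> real \<Rightarrow> complex" where
  "vp_log' q p u = \<i> * (2 * (of_real q * cis u) / (1 - of_real q * cis u) -
     of_nat p * (of_real q * cis u) ^ p / (1 - (of_real q * cis u) ^ p))"

lemma cmod_one_minus_ge: "cmod w \<le> r \<Longrightarrow> 1 - r \<le> cmod (1 - w)"
  using norm_triangle_ineq2[of 1 w] by simp

context
  fixes q :: real and p :: nat
  assumes q: "0 < q" "q < 1" and p: "p \<ge> 1"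
begin

lemma q_power: "0 < q ^ p" "q ^ p \<le> q"
  using q p power_decreasing[of 1 p q] by auto

lemma one_minus_z: "1 - q \<le> cmod (1 - of_real q * cis u)" "1 - of_real q * cis u \<noteq> 0"
  "1 - of_real q * cis u \<notin> \<real>\<^sub>\<le>\<^sub>0"
proof -
  show a: "1 - q \<le> cmod (1 - of_real q * cis u)"
    by (rule cmod_one_minus_ge) (use q in \<open>simp add: norm_mult\<close>)
  then show "1 - of_real q * cis u \<noteq> 0" using q by force
  have "q * cos u \<le> q * 1" using q by (intro mult_left_mono) auto
  then have "q * cos u < 1" using q by linarith
  then have "Re (1 - of_real q * cis u) > 0" by simp
  then show "1 - of_real q * cis u \<notin> \<real>\<^sub>\<le>\<^sub>0" by (auto simp: complex_nonpos_Reals_iff)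
qed

lemma one_minus_zp: "1 - q ^ p \<le> cmod (1 - (of_real q * cis u) ^ p)" "1 - (of_real q * cis u) ^ p \<noteq> 0"
  "1 - (of_real q * cis u) ^ p \<notin> \<real>\<^sub>\<le>\<^sub>0"
proof -
  have n: "cmod ((of_real q * cis u) ^ p) = q ^ p" using q by (simp add: norm_mult norm_power)
  show a: "1 - q ^ p \<le> cmod (1 - (of_real q * cis u) ^ p)"
    by (rule cmod_one_minus_ge) (simp add: n)
  have qp: "q ^ p < 1" using q_power q by linarith
  then show "1 - (of_real q * cis u) ^ p \<noteq> 0" using a by force
  have "Re ((of_real q * cis u) ^ p) \<le> q ^ p" using complex_Re_le_cmod[of "(of_real q * cis u) ^ p"] n by simp
  then have "Re (1 - (of_real q * cis u) ^ p) > 0" using qp by simp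
  then show "1 - (of_real q * cis u) ^ p \<notin> \<real>\<^sub>\<le>\<^sub>0" by (auto simp: complex_nonpos_Reals_iff)
qed

lemma exp_vp_log: "exp (vp_log q p u) = vp_mult q p u"
proof -
  have "exp (2 * Ln (1 - of_real q * cis u)) = (1 - of_real q * cis u)\<^sup>2"
    using one_minus_z(2)[of u] by (simp add: exp_double exp_Ln)
  then show ?thesis
    unfolding vp_log_def exp_diff vp_mult_def using one_minus_zp(2)[of u] by (simp add: exp_Ln)
qed

lemma vp_log_per: "vp_log q p (u + 2 * pi) = vp_log q p u"
  by (simp add: vp_log_def flip: cis_mult)

lemma vp_mult_per: "vp_mult q p (u + 2 * pi) = vp_mult q p u"
  by (simp add: vp_mult_def flip: cis_mult)

lemma vp_log_deriv: "(vp_log q p has_vector_derivative vp_log' q p u) (at u)"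
proof -
  define z where "z u = of_real q * cis u" for u
  have z: "(z has_vector_derivative \<i> * z u) (at u)"
  proof -
    have "((\<lambda>u. of_real q * exp (\<i> * of_real u)) has_vector_derivative of_real q * (exp (\<i> * of_real u) * \<i>)) (at u)"
      by (intro has_vector_derivative_mult_right)
        (auto intro!: derivative_eq_intros has_vector_derivative_real_field simp: mult_ac)
    then show ?thesis by (simp add: z_def[abs_def] cis_conv_exp mult_ac)
  qed
  define G where "G w = Ln (1 - w ^ p) - 2 * Ln (1 - w)" for w
  have n: "1 - z u \<notin> \<real>\<^sub>\<le>\<^sub>0" "1 - z u ^ p \<notin> \<real>\<^sub>\<le>\<^sub>0" using one_minus_z one_minus_zp by (auto simp: z_def)
  have n': "1 - z u \<noteq> 0" "1 - z u ^ p \<noteq> 0" using one_minus_z one_minus_zp by (auto simp: z_def)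
  have "(G has_field_derivative (- (of_nat p * z u ^ (p - 1)) / (1 - z u ^ p) + 2 / (1 - z u))) (at (z u))"
    unfolding G_def[abs_def] using n n'
    by (auto intro!: derivative_eq_intros simp: divide_simps)
  from field_vector_diff_chain_at[OF z this]
  have "((\<lambda>u. G (z u)) has_vector_derivative (\<i> * z u) * (- (of_nat p * z u ^ (p - 1)) / (1 - z u ^ p) + 2 / (1 - z u))) (at u)"
    by (simp add: o_def)
  moreover have "z u * z u ^ (p - 1) = z u ^ p" using p by (cases p) auto
  then have "(\<i> * z u) * (- (of_nat p * z u ^ (p - 1)) / (1 - z u ^ p) + 2 / (1 - z u)) = vp_log' q p u"
    unfolding vp_log'_def z_def[symmetric] by (simp add: algebra_simps)
  ultimately show ?thesis by (simp add: G_def z_def vp_log_def[abs_def])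
qed

lemma vp_log'_cont: "continuous_on UNIV (vp_log' q p)"
  unfolding vp_log'_def[abs_def]
  by (intro continuous_intros) (use one_minus_z one_minus_zp in auto)

text \<open>The squared denominator contributes at most \<open>2 / (1 - q)\<close>. For the
  numerator, \<open>p * q ^ p\<close> is at most
  \<open>1 + q + ... + q ^ (p - 1) = (1 - q ^ p) / (1 - q)\<close>; division by
  \<open>1 - q ^ p\<close> leaves \<open>1 / (1 - q)\<close>, uniformly in \<open>p\<close>.\<close>

lemma vp_log'_bound: "cmod (vp_log' q p u) \<le> 3 / (1 - q)"
proof -
  define z where "z = of_real q * cis u"
  have nz: "cmod z = q" using q by (simp add: z_def norm_mult)
  have 1: "cmod (2 * z / (1 - z)) \<le> 2 * 1 / (1 - q)"
    unfolding norm_divide norm_mult nz using one_minus_z(1)[of u] q by (intro frac_le) (auto simp: z_def)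
  have 2: "cmod (of_nat p * z ^ p / (1 - z ^ p)) \<le> 1 / (1 - q)"
  proof -
    have "real p * q ^ p \<le> (\<Sum>i<p. q ^ i)"
    proof -
      have "(\<Sum>i<p. q ^ p) \<le> (\<Sum>i<p. q ^ i)" using q by (intro sum_mono power_decreasing) auto
      then show ?thesis by simp
    qed
    also have "\<dots> = (1 - q ^ p) / (1 - q)" using q by (simp add: sum_gp_strict)
    finally have a: "real p * q ^ p \<le> (1 - q ^ p) / (1 - q)" .
    have qp: "1 - q ^ p > 0" using q_power q by simp
    have "cmod (of_nat p * z ^ p / (1 - z ^ p)) = real p * q ^ p / cmod (1 - z ^ p)"
      by (simp add: norm_divide norm_mult norm_power nz)
    also have "\<dots> \<le> ((1 - q ^ p) / (1 - q)) / (1 - q ^ p)"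
      using a qp one_minus_zp(1)[of u] q by (intro frac_le) (auto simp: z_def)
    also have "\<dots> = 1 / (1 - q)" using qp by simp
    finally show ?thesis .
  qed
  have "cmod (vp_log' q p u) = cmod (2 * z / (1 - z) - of_nat p * z ^ p / (1 - z ^ p))"
    by (simp add: vp_log'_def z_def norm_mult)
  also have "\<dots> \<le> cmod (2 * z / (1 - z)) + cmod (of_nat p * z ^ p / (1 - z ^ p))" by (rule norm_triangle_ineq4)
  also have "\<dots> \<le> 3 / (1 - q)" using 1 2 by (simp add: add_divide_distrib[symmetric] order_trans)
  finally show ?thesis .
qed

text \<open>For \<open>p = 1\<close> the numerator cancels one factor of the denominator. This gain
  of one power of \<open>1 / (1 - q)\<close> is the origin of the case distinction on
  \<open>p\<close> in the exponents of the error terms.\<close>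

lemma vp_mult_bound: "cmod (vp_mult q p u) \<le> (if p = 1 then 1 / (1 - q) else 2 / (1 - q)\<^sup>2)"
proof (cases "p = 1")
  case True
  have "vp_mult q p u = 1 / (1 - of_real q * cis u)"
    using True one_minus_z(2)[of u] by (simp add: vp_mult_def power2_eq_square)
  then show ?thesis using True one_minus_z(1)[of u] q by (simp add: norm_divide frac_le)
next
  case False
  have "cmod (1 - (of_real q * cis u) ^ p) \<le> 1 + q ^ p"
    using norm_triangle_ineq4[of 1 "(of_real q * cis u) ^ p"] q by (simp add: norm_mult norm_power)
  then have "cmod (1 - (of_real q * cis u) ^ p) \<le> 2" using q_power q by linarith
  moreover have "(1 - q)\<^sup>2 \<le> (cmod (1 - of_real q * cis u))\<^sup>2"
    using one_minus_z(1)[of u] q by (intro power_mono) auto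
  ultimately show ?thesis using False q
    by (simp add: vp_mult_def norm_divide norm_power frac_le)
qed

text \<open>The quotient whose norm enters \<open>K_qp\<close> is the modulus of the amplitude; both
  distances come from the identity for the Poisson denominator, with parameters \<open>q\<close> and
  \<open>q ^ p\<close>.\<close>

lemma cmod_vp_mult:
  "cmod (vp_mult q p t) = sqrt (1 - 2 * q ^ p * cos (real p * t) + q ^ (2 * p)) / (1 - 2 * q * cos t + q\<^sup>2)"
proof -
  have "(of_real q * cis t) ^ p = of_real (q ^ p) * cis (real p * t)"
    by (simp add: power_mult_distrib Complex.DeMoivre)
  then have "cmod (1 - (of_real q * cis t) ^ p) = sqrt (1 - 2 * q ^ p * cos (real p * t) + (q ^ p)\<^sup>2)"
    unfolding poisson_denom by simp
  moreover have "(q ^ p)\<^sup>2 = q ^ (2 * p)" by (simp add: power_mult[symmetric] mult.commute)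
  ultimately show ?thesis
    unfolding vp_mult_def norm_divide norm_power poisson_denom[symmetric] by simp
qed

lemma vp_mult_cont: "continuous_on UNIV (vp_mult q p)"
  unfolding vp_mult_def[abs_def] by (intro continuous_intros) (use one_minus_z in auto)

lemma vp_mult_lipschitz:
  "cmod (vp_mult q p x - vp_mult q p y) \<le> 3 / (1 - q) * (if p = 1 then 1 / (1 - q) else 2 / (1 - q)\<^sup>2) * \<bar>x - y\<bar>"
proof -
  define D where "D = 3 / (1 - q) * (if p = 1 then 1 / (1 - q) else 2 / (1 - q)\<^sup>2)"
  have d: "(vp_mult q p has_vector_derivative vp_log' q p u * vp_mult q p u) (at u within UNIV)" for u
  proof -
    have "((\<lambda>u. exp (vp_log q p u)) has_vector_derivative vp_log' q p u * exp (vp_log q p u)) (at u)"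
      using field_vector_diff_chain_at[OF vp_log_deriv DERIV_exp, of u] by (simp add: o_def)
    then show ?thesis by (simp add: exp_vp_log)
  qed
  have "norm (vp_mult q p x - vp_mult q p y) \<le> D * norm (x - y)"
  proof (rule differentiable_bound[of UNIV "vp_mult q p" "\<lambda>u h. h *\<^sub>R (vp_log' q p u * vp_mult q p u)"])
    fix u
    show "(vp_mult q p has_derivative (\<lambda>h. h *\<^sub>R (vp_log' q p u * vp_mult q p u))) (at u within UNIV)"
      using d[of u] by (simp add: has_vector_derivative_def)
    have n: "cmod (vp_log' q p u * vp_mult q p u) \<le> D"
      unfolding D_def norm_mult using vp_log'_bound[of u] vp_mult_bound[of u] q by (intro mult_mono) auto
    show "onorm (\<lambda>h. h *\<^sub>R (vp_log' q p u * vp_mult q p u)) \<le> D"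
    proof (rule onorm_le)
      fix h :: real
      show "norm (h *\<^sub>R (vp_log' q p u * vp_mult q p u)) \<le> D * norm h"
        using mult_right_mono[OF n, of "\<bar>h\<bar>"] by (simp add: mult.commute)
    qed
  qed auto
  then show ?thesis by (simp add: D_def)
qed

end

section \<open>Duality in the Lebesgue spaces\<close>

text \<open>Frozen amplitudes and extremal functions are discontinuous. Bounded Borel functions
  contain them as well as the continuous periodic ones, are integrable over every bounded interval,
  and have the same Lebesgue and gauge integrals.\<close>

definition bdd_borel :: "(real \<Rightarrow> real) \<Rightarrow> bool" where
  "bdd_borel h \<longleftrightarrow> h \<in> borel_measurable borel \<and> (\<exists>C. \<forall>t. \<bar>h t\<bar> \<le> C)"

lemma bdd_borelI: "h \<in> borel_measurable borel \<Longrightarrow> (\<And>t. \<bar>h t\<bar> \<le> C) \<Longrightarrow> bdd_borel h"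
  by (auto simp: bdd_borel_def)

lemma bdd_borel_integrable: "bdd_borel h \<Longrightarrow> integrable circ h"
  unfolding bdd_borel_def by (metis integrable_lebesgue_on_bounded real_norm_def)

lemma bdd_borel_integrable_on: "bdd_borel h \<Longrightarrow> h integrable_on {a..b}"
  unfolding bdd_borel_def by (metis integrable_on_bounded_borel real_norm_def)

lemma bdd_borel_LINT: "bdd_borel h \<Longrightarrow> integral\<^sup>L circ h = integral {0..2*pi} h"
  by (rule LINT_circ_eq_integral) (rule bdd_borel_integrable)

lemma bdd_borel_diff: "bdd_borel f \<Longrightarrow> bdd_borel g \<Longrightarrow> bdd_borel (\<lambda>t. f t - g t)"
proof -
  assume "bdd_borel f" "bdd_borel g"
  then obtain C D where "\<And>t. \<bar>f t\<bar> \<le> C" "\<And>t. \<bar>g t\<bar> \<le> D" "f \<in> borel_measurable borel" "g \<in> borel_measurable borel"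
    by (auto simp: bdd_borel_def)
  moreover from this have "\<bar>f t - g t\<bar> \<le> C + D" for t
    by (meson abs_triangle_ineq4 add_mono order_trans)
  ultimately show ?thesis by (intro bdd_borelI[of _ "C + D"]) auto
qed

lemma bdd_borel_powr:
  assumes h: "bdd_borel h" and r: "r \<ge> 0"
  shows "bdd_borel (\<lambda>t. \<bar>h t\<bar> powr r)"
proof -
  obtain C where "\<And>t. \<bar>h t\<bar> \<le> C" "h \<in> borel_measurable borel" using h by (auto simp: bdd_borel_def)
  then show ?thesis using r
    by (intro bdd_borelI[of _ "C powr r"]) (auto intro!: powr_mono2)
qed

text \<open>The norm for a finite exponent given as a real number; it agrees with
  \<open>Ls_norm\<close> once the extended exponent is known to be finite.\<close>

definition Lr_norm :: "real \<Rightarrow> (real \<Rightarrow> real) \<Rightarrow> real" where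
  "Lr_norm r h = (LINT t|circ. \<bar>h t\<bar> powr r) powr (1 / r)"

lemma Lr_norm_nonneg: "Lr_norm r h \<ge> 0" by (simp add: Lr_norm_def)

lemma Lr_norm_powr: "r > 0 \<Longrightarrow> Lr_norm r h powr r = (LINT t|circ. \<bar>h t\<bar> powr r)"
  by (simp add: Lr_norm_def powr_powr integral_nonneg_AE)

lemma Lr_norm_mono:
  assumes "bdd_borel h" "bdd_borel k" "\<And>t. \<bar>h t\<bar> \<le> \<bar>k t\<bar>" and r: "r > 0"
  shows "Lr_norm r h \<le> Lr_norm r k"
  unfolding Lr_norm_def using assms
  by (intro powr_mono2 integral_mono bdd_borel_integrable bdd_borel_powr) auto

lemma Lr_norm_const:
  assumes r: "r > 0" and c: "c \<ge> 0"
  shows "Lr_norm r (\<lambda>_. c) = c * (2 * pi) powr (1 / r)"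
proof -
  have "(LINT t|circ. \<bar>c\<bar> powr r) = 2 * pi * \<bar>c\<bar> powr r" by simp
  then have "Lr_norm r (\<lambda>_. c) = (2 * pi * c powr r) powr (1 / r)" unfolding Lr_norm_def using c by (simp only: abs_of_nonneg)
  also have "\<dots> = (2 * pi) powr (1 / r) * c" using r c by (simp add: powr_mult powr_powr)
  finally show ?thesis by simp
qed

text \<open>The unit ball of the space conjugate to exponent \<open>r\<close>, written in terms of
  \<open>r\<close>. The case \<open>r = 1\<close>, with conjugate exponent infinity, is separate
  because \<open>r / (r - 1)\<close> would be a division by zero. Periodicity and mean zero are
  stated apart from it.\<close>

definition dual_ball :: "real \<Rightarrow> (real \<Rightarrow> real) \<Rightarrow> bool" where
  "dual_ball r \<phi> \<longleftrightarrow> \<phi> \<in> borel_measurable circ \<and>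
     (if r = 1 then AE t in circ. \<bar>\<phi> t\<bar> \<le> 1
      else integrable circ (\<lambda>t. \<bar>\<phi> t\<bar> powr (r / (r - 1))) \<and> (LINT t|circ. \<bar>\<phi> t\<bar> powr (r / (r - 1))) \<le> 1)"

lemma conj_exponents:
  assumes "r > (1::real)"
  shows "r / (r - 1) > 1" "1 / (r / (r - 1)) + 1 / r = 1" "(r - 1) * (r / (r - 1)) = r"
  using assms by (auto simp: field_simps)

text \<open>For \<open>r > 1\<close>, Young's inequality with second factor 1 dominates
  \<open>\<bar>\<phi> t\<bar>\<close> by a multiple of the integrable power plus a constant, which
  is integrable on a bounded interval.\<close>

lemma dual_ball_integrable:
  assumes r: "r \<ge> 1" and \<phi>: "dual_ball r \<phi>"
  shows "integrable circ \<phi>"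
proof (cases "r = 1")
  case True
  interpret finite_measure circ by (rule finite_measure_circ)
  show ?thesis using \<phi> True by (intro integrable_const_bound[of _ 1]) (auto simp: dual_ball_def)
next
  case False
  define s where "s = r / (r - 1)"
  have s: "s > 1" "1 / s + 1 / r = 1" "r > 1" using False r conj_exponents[of r] by (auto simp: s_def)
  have i1: "integrable circ (\<lambda>t. 1::real)" by (rule integrable_circ_continuous) simp
  show ?thesis
  proof (rule Bochner_Integration.integrable_bound[of _ "\<lambda>t. \<bar>\<phi> t\<bar> powr s / s + 1"])
    show "integrable circ (\<lambda>t. \<bar>\<phi> t\<bar> powr s / s + 1)"
      using \<phi> False i1 by (auto simp: dual_ball_def s_def)
    have "\<bar>\<phi> t\<bar> \<le> \<bar>\<phi> t\<bar> powr s / s + 1" for t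
      using Youngs_inequality[of s r "\<bar>\<phi> t\<bar>" 1] s by (simp add: divide_le_eq) (smt (verit) divide_le_eq_1)
    then show "AE t in circ. norm (\<phi> t) \<le> norm (\<bar>\<phi> t\<bar> powr s / s + 1)" using s by auto
  qed (use \<phi> in \<open>simp add: dual_ball_def\<close>)
qed

lemma dual_ball_mult_integrable:
  assumes r: "r \<ge> 1" and \<phi>: "dual_ball r \<phi>" and h: "bdd_borel h"
  shows "integrable circ (\<lambda>t. \<phi> t * h t)"
proof -
  obtain C where C: "\<And>t. \<bar>h t\<bar> \<le> C" and m: "h \<in> borel_measurable borel" using h by (auto simp: bdd_borel_def)
  note i = dual_ball_integrable[OF r \<phi>]
  show ?thesis
  proof (rule Bochner_Integration.integrable_bound[of _ "\<lambda>t. C * \<phi> t"])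
    show "(\<lambda>t. \<phi> t * h t) \<in> borel_measurable circ"
      using i borel_measurable_circ_borel[OF m] by (intro borel_measurable_times) auto
    have "\<bar>\<phi> t * h t\<bar> \<le> \<bar>C * \<phi> t\<bar>" for t
      using mult_left_mono[OF C[of t], of "\<bar>\<phi> t\<bar>"] C[of t] by (auto simp: abs_mult mult.commute)
    then show "AE t in circ. norm (\<phi> t * h t) \<le> norm (C * \<phi> t)" by simp
  qed (use i in simp)
qed

text \<open>For \<open>r > 1\<close> this is Young's inequality for
  \<open>\<bar>\<phi>\<bar>\<close> and \<open>\<bar>h\<bar> / N\<close>, integrated; the
  normalisation turns the right-hand side into \<open>N * (1 / s + 1 / r) = N\<close>. If
  \<open>N = 0\<close>, then \<open>h\<close> vanishes almost everywhere.\<close>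

lemma Hoelder_dual_ball:
  assumes r: "r \<ge> 1" and \<phi>: "dual_ball r \<phi>" and h: "bdd_borel h"
  shows "\<bar>LINT t|circ. \<phi> t * h t\<bar> \<le> Lr_norm r h"
proof (cases "r = 1")
  case True
  have "\<bar>LINT t|circ. \<phi> t * h t\<bar> \<le> (LINT t|circ. \<bar>\<phi> t * h t\<bar>)" by (rule integral_abs_bound)
  also have "\<dots> \<le> (LINT t|circ. \<bar>h t\<bar>)"
  proof (rule integral_mono_AE)
    show "integrable circ (\<lambda>t. \<bar>\<phi> t * h t\<bar>)" using dual_ball_mult_integrable[OF assms] by simp
    show "integrable circ (\<lambda>t. \<bar>h t\<bar>)" using bdd_borel_integrable[OF h] by simp
    have "AE t in circ. \<bar>\<phi> t\<bar> \<le> 1" using \<phi> True by (simp add: dual_ball_def)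
    then show "AE t in circ. \<bar>\<phi> t * h t\<bar> \<le> \<bar>h t\<bar>"
      by eventually_elim (simp add: abs_mult mult_left_le_one_le)
  qed
  also have "\<dots> = Lr_norm r h" using True by (simp add: Lr_norm_def)
  finally show ?thesis .
next
  case False
  define s where "s = r / (r - 1)"
  have s: "s > 1" "1 / s + 1 / r = 1" "r > 1" using False r conj_exponents[of r] by (auto simp: s_def)
  define N where "N = Lr_norm r h"
  have hr: "integrable circ (\<lambda>t. \<bar>h t\<bar> powr r)" using h s by (intro bdd_borel_integrable bdd_borel_powr) auto
  have Npow: "N powr r = (LINT t|circ. \<bar>h t\<bar> powr r)" unfolding N_def using s by (intro Lr_norm_powr) auto
  show ?thesis
  proof (cases "N = 0")
    case True
    then have "(LINT t|circ. \<bar>h t\<bar> powr r) = 0" using Npow s by simp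
    then have "AE t in circ. \<bar>h t\<bar> powr r = 0"
      using integral_nonneg_eq_0_iff_AE[OF hr] by simp
    then have "AE t in circ. \<phi> t * h t = 0" by eventually_elim simp
    then have "(LINT t|circ. \<phi> t * h t) = 0" by (rule integral_eq_zero_AE)
    then show ?thesis by (simp add: Lr_norm_nonneg)
  next
    case False
    then have N: "N > 0" using Lr_norm_nonneg[of r h] by (simp add: N_def less_le)
    have \<phi>s: "integrable circ (\<lambda>t. \<bar>\<phi> t\<bar> powr s)" "(LINT t|circ. \<bar>\<phi> t\<bar> powr s) \<le> 1"
      using \<phi> \<open>r > 1\<close> by (auto simp: dual_ball_def s_def)
    have "\<bar>LINT t|circ. \<phi> t * h t\<bar> \<le> (LINT t|circ. \<bar>\<phi> t * h t\<bar>)" by (rule integral_abs_bound)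
    also have "\<dots> \<le> (LINT t|circ. N * (\<bar>\<phi> t\<bar> powr s / s + \<bar>h t\<bar> powr r / N powr r / r))"
    proof (rule integral_mono)
      show "integrable circ (\<lambda>t. \<bar>\<phi> t * h t\<bar>)" using dual_ball_mult_integrable[OF assms] by simp
      show "integrable circ (\<lambda>t. N * (\<bar>\<phi> t\<bar> powr s / s + \<bar>h t\<bar> powr r / N powr r / r))"
        using \<phi>s hr by (intro integrable_mult_right Bochner_Integration.integrable_add integrable_divide) auto
      fix t
      have "\<bar>\<phi> t\<bar> * (\<bar>h t\<bar> / N) \<le> \<bar>\<phi> t\<bar> powr s / s + (\<bar>h t\<bar> / N) powr r / r"
        using N s by (intro Youngs_inequality) auto
      then have "N * (\<bar>\<phi> t\<bar> * (\<bar>h t\<bar> / N)) \<le> N * (\<bar>\<phi> t\<bar> powr s / s + (\<bar>h t\<bar> / N) powr r / r)"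
        using N by (intro mult_left_mono) auto
      then show "\<bar>\<phi> t * h t\<bar> \<le> N * (\<bar>\<phi> t\<bar> powr s / s + \<bar>h t\<bar> powr r / N powr r / r)"
        using N by (simp add: abs_mult powr_divide)
    qed
    also have "\<dots> = N * ((LINT t|circ. \<bar>\<phi> t\<bar> powr s) / s + N powr r / N powr r / r)"
      using \<phi>s(1) hr by (simp add: Npow)
    also have "\<dots> \<le> N * (1 / s + 1 / r)"
      using N \<phi>s(2) s by (intro mult_left_mono add_mono divide_right_mono) auto
    also have "\<dots> = N" using s by simp
    finally show ?thesis by (simp add: N_def)
  qed
qed

text \<open>Since \<open>\<Psi>\<close> is odd, the extremal function has mean zero as soon as \<open>h\<close> changes sign under a
  measure-preserving map.\<close>

lemma dual_extremal:
  assumes r: "r \<ge> 1" and h: "bdd_borel h"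
  obtains \<Psi> where "\<And>x. \<Psi> (- x) = - \<Psi> x" "\<Psi> \<in> borel_measurable borel" "bdd_borel (\<lambda>t. \<Psi> (h t))"
    "dual_ball r (\<lambda>t. \<Psi> (h t))" "(LINT t|circ. \<Psi> (h t) * h t) = Lr_norm r h"
proof -
  define N where "N = Lr_norm r h"
  have hr: "bdd_borel (\<lambda>t. \<bar>h t\<bar> powr r)" using h r by (intro bdd_borel_powr) auto
  have Npow: "N powr r = (LINT t|circ. \<bar>h t\<bar> powr r)" unfolding N_def using r by (intro Lr_norm_powr) auto
  have N0: "N \<ge> 0" by (simp add: N_def Lr_norm_nonneg)
  \<comment> \<open>This is the equality case of the Hoelder inequality. For \<open>r = 1\<close> it
    reduces to the sign function.\<close>
  define \<Psi> where "\<Psi> x = (if N = 0 then 0 else sgn x * \<bar>x\<bar> powr (r - 1) / N powr (r - 1))" for x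
  have odd: "\<Psi> (- x) = - \<Psi> x" for x by (simp add: \<Psi>_def sgn_minus)
  have abs\<Psi>: "\<bar>\<Psi> x\<bar> \<le> \<bar>x\<bar> powr (r - 1) / N powr (r - 1)" for x
    by (auto simp: \<Psi>_def abs_mult abs_divide sgn_if)
  have "(\<lambda>x. sgn x * \<bar>x\<bar> powr (r - 1) / N powr (r - 1)) \<in> borel_measurable borel"
    unfolding sgn_if by measurable
  then have meas: "\<Psi> \<in> borel_measurable borel" unfolding \<Psi>_def[abs_def] by (cases "N = 0") auto
  obtain C where C: "\<And>t. \<bar>h t\<bar> \<le> C" and hm: "h \<in> borel_measurable borel" using h by (auto simp: bdd_borel_def)
  have bdd: "bdd_borel (\<lambda>t. \<Psi> (h t))"
  proof (rule bdd_borelI)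
    show "(\<lambda>t. \<Psi> (h t)) \<in> borel_measurable borel" using meas hm by measurable
    show "\<bar>\<Psi> (h t)\<bar> \<le> C powr (r - 1) / N powr (r - 1)" for t
      by (rule order_trans[OF abs\<Psi>]) (use C[of t] r in \<open>auto intro!: divide_right_mono powr_mono2\<close>)
  qed
  have dual: "dual_ball r (\<lambda>t. \<Psi> (h t))"
  proof (cases "r = 1")
    case True
    have "\<bar>\<Psi> (h t)\<bar> \<le> 1" for t
      using N0 by (simp add: \<Psi>_def True sgn_if)
    then show ?thesis using True bdd by (simp add: dual_ball_def bdd_borel_def borel_measurable_circ_borel)
  next
    case False
    then have r1: "r > 1" using r by simp
    define s where "s = r / (r - 1)"
    have s: "s > 1" "(r - 1) * s = r" using conj_exponents[OF r1] by (auto simp: s_def)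
    have e: "\<bar>\<Psi> (h t)\<bar> powr s \<le> \<bar>h t\<bar> powr r / N powr r" for t
    proof -
      have "\<bar>\<Psi> (h t)\<bar> powr s \<le> (\<bar>h t\<bar> powr (r - 1) / N powr (r - 1)) powr s"
        using abs\<Psi>[of "h t"] s by (intro powr_mono2) auto
      also have "\<dots> = \<bar>h t\<bar> powr r / N powr r" by (simp add: powr_divide powr_powr s)
      finally show ?thesis .
    qed
    have i: "integrable circ (\<lambda>t. \<bar>\<Psi> (h t)\<bar> powr s)"
      using bdd s by (intro bdd_borel_integrable bdd_borel_powr) auto
    have "(LINT t|circ. \<bar>\<Psi> (h t)\<bar> powr s) \<le> (LINT t|circ. \<bar>h t\<bar> powr r / N powr r)"
      using e i bdd_borel_integrable[OF hr] by (intro integral_mono) auto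
    also have "\<dots> = N powr r / N powr r" using Npow by simp
    also have "\<dots> \<le> 1" by simp
    finally show ?thesis using i False bdd
      by (simp add: dual_ball_def s_def bdd_borel_def borel_measurable_circ_borel)
  qed
  have "(LINT t|circ. \<Psi> (h t) * h t) = N"
  proof (cases "N = 0")
    case False
    have "\<Psi> x * x = \<bar>x\<bar> powr r / N powr (r - 1)" for x
    proof (cases "x = 0")
      case x: False
      have "\<bar>x\<bar> powr r = \<bar>x\<bar> powr (r - 1) * \<bar>x\<bar>" using x powr_add[of "\<bar>x\<bar>" "r - 1" 1] by simp
      moreover have "sgn x * x = \<bar>x\<bar>" by (simp add: abs_sgn mult.commute)
      ultimately show ?thesis using False by (simp add: \<Psi>_def mult_ac)
    qed (simp add: \<Psi>_def)
    then have "(LINT t|circ. \<Psi> (h t) * h t) = N powr r / N powr (r - 1)" using Npow by simp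
    also have "\<dots> = N" using False N0 by (simp add: powr_diff)
    finally show ?thesis .
  qed (simp add: \<Psi>_def)
  then show ?thesis using that[OF odd meas bdd dual] by (simp add: N_def)
qed

text \<open>Minkowski's inequality by duality: \<open>h\<close> is tested against its own extremal
  function. The majorant \<open>d\<close> is a separate function so that the modulus of a complex
  difference can bound a difference of real waves.\<close>

lemma Lr_norm_triangle:
  assumes r: "r \<ge> 1" and h: "bdd_borel h" and k: "bdd_borel k" and d: "bdd_borel d"
    and le: "\<And>t. \<bar>h t - k t\<bar> \<le> \<bar>d t\<bar>"
  shows "Lr_norm r h \<le> Lr_norm r k + Lr_norm r d"
proof -
  obtain \<Psi> where \<Psi>: "bdd_borel (\<lambda>t. \<Psi> (h t))" "dual_ball r (\<lambda>t. \<Psi> (h t))" "(LINT t|circ. \<Psi> (h t) * h t) = Lr_norm r h"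
    using dual_extremal[OF r h] by metis
  note i = dual_ball_mult_integrable[OF r \<Psi>(2)]
  have hk: "bdd_borel (\<lambda>t. h t - k t)" by (rule bdd_borel_diff[OF h k])
  have "Lr_norm r h = (LINT t|circ. \<Psi> (h t) * k t + \<Psi> (h t) * (h t - k t))"
    using \<Psi>(3) by (simp add: algebra_simps)
  also have "\<dots> = (LINT t|circ. \<Psi> (h t) * k t) + (LINT t|circ. \<Psi> (h t) * (h t - k t))"
    by (rule Bochner_Integration.integral_add[OF i[OF k] i[OF hk]])
  also have "\<dots> \<le> Lr_norm r k + Lr_norm r (\<lambda>t. h t - k t)"
    using Hoelder_dual_ball[OF r \<Psi>(2) k] Hoelder_dual_ball[OF r \<Psi>(2) hk] by linarith
  also have "Lr_norm r (\<lambda>t. h t - k t) \<le> Lr_norm r d" using r by (intro Lr_norm_mono hk d le) auto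
  finally show ?thesis by simp
qed

section \<open>Waves with frozen amplitude\<close>

text \<open>In contrast to \<open>slow_phase\<close>, no logarithm of the amplitude is taken:
  \<open>Y\<close> is frozen as a complex number on full periods of length
  \<open>2 * pi / m\<close>, on which the value of the phase does not affect integrals.\<close>

locale frozen_phase =
  fixes Y :: "real \<Rightarrow> complex" and m :: nat
  assumes per: "Y (t + 2 * pi) = Y t" and cont: "continuous_on UNIV Y" and m: "m \<ge> 1"
begin

definition step :: "real \<Rightarrow> complex" where
  "step t = Y (2 * pi * of_int \<lfloor>real m * t / (2 * pi)\<rfloor> / real m)"
definition wave :: "real \<Rightarrow> real" where "wave t = Re (Y t * cis (real m * t))"
definition step_wave :: "real \<Rightarrow> real" where "step_wave t = Re (step t * cis (real m * t))"

lemma m0: "real m > 0" using m by simp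

lemma Y_bounded: obtains C where "\<And>t. cmod (Y t) \<le> C"
proof -
  have "(\<lambda>t. cmod (Y t)) \<in> C_per"
    using cont per by (auto simp: C_per_def periodic2pi_def intro: continuous_on_norm)
  from C_per_bounded[OF this] show ?thesis using that by (metis abs_norm_cancel)
qed

lemma step_per: "step (t + 2 * pi) = step t"
proof -
  have "real m * (t + 2 * pi) / (2 * pi) = real m * t / (2 * pi) + of_int (int m)"
    by (simp add: field_simps)
  then have f: "\<lfloor>real m * (t + 2 * pi) / (2 * pi)\<rfloor> = \<lfloor>real m * t / (2 * pi)\<rfloor> + int m"
    by (metis floor_add_int)
  have "2 * pi * of_int (\<lfloor>real m * t / (2 * pi)\<rfloor> + int m) / real m = 2 * pi * of_int \<lfloor>real m * t / (2 * pi)\<rfloor> / real m + 2 * pi"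
    using m0 by (simp add: field_simps)
  then show ?thesis unfolding step_def f by (simp only: per)
qed

lemma wave_per: "wave (t + 2 * pi) = wave t" and step_wave_per: "step_wave (t + 2 * pi) = step_wave t"
proof -
  have "cis (real m * (t + 2 * pi)) = cis (real m * t)"
    using periodic_cos_nat[of m t 0] periodic_sin_nat[of m t 0] by (simp add: complex_eq_iff)
  then show "wave (t + 2 * pi) = wave t" "step_wave (t + 2 * pi) = step_wave t"
    by (simp_all add: wave_def step_wave_def per step_per)
qed

lemma step_measurable: "step \<in> borel_measurable borel"
proof -
  have 1: "(\<lambda>t. \<lfloor>real m * t / (2 * pi)\<rfloor>) \<in> measurable borel (count_space UNIV)" by measurable
  have "(\<lambda>k::int. Y (2 * pi * of_int k / real m)) \<in> measurable (count_space UNIV) borel" by simp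
  from measurable_compose[OF 1 this] show ?thesis by (simp add: step_def[abs_def])
qed

lemma Y_measurable: "Y \<in> borel_measurable borel" by (rule borel_measurable_continuous_onI[OF cont])

lemma cis_measurable: "(\<lambda>t. cis (real m * t)) \<in> borel_measurable borel"
  by (intro borel_measurable_continuous_onI continuous_intros)

lemma bdd_wave: "bdd_borel wave" and bdd_step_wave: "bdd_borel step_wave"
  and bdd_amp: "bdd_borel (\<lambda>t. cmod (Y t))" and bdd_step_amp: "bdd_borel (\<lambda>t. cmod (step t))"
  and bdd_diff: "bdd_borel (\<lambda>t. cmod (Y t - step t))"
proof -
  obtain C where C: "\<And>t. cmod (Y t) \<le> C" using Y_bounded by metis
  have C': "cmod (step t) \<le> C" for t by (simp add: step_def C)
  have R: "\<bar>Re (w * cis x)\<bar> \<le> cmod w" for w x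
    using abs_Re_le_cmod[of "w * cis x"] by (simp add: norm_mult)
  note [measurable] = step_measurable Y_measurable cis_measurable
  have [measurable]: "(\<lambda>t. Re (f t)) \<in> borel_measurable borel" if "f \<in> borel_measurable borel" for f
    using borel_measurable_Re that measurable_compose by blast
  show "bdd_borel wave" unfolding wave_def[abs_def] by (rule bdd_borelI[of _ C]) (measurable, use R C order_trans in blast)
  show "bdd_borel step_wave" unfolding step_wave_def[abs_def] by (rule bdd_borelI[of _ C]) (measurable, use R C' order_trans in blast)
  show "bdd_borel (\<lambda>t. cmod (Y t))" by (rule bdd_borelI[of _ C]) (measurable, use C in simp)
  show "bdd_borel (\<lambda>t. cmod (step t))" by (rule bdd_borelI[of _ C]) (measurable, use C' in simp)
  have "cmod (Y t - step t) \<le> C + C" for t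
    using norm_triangle_ineq4[of "Y t" "step t"] C[of t] C'[of t] by linarith
  moreover have "(\<lambda>t. cmod (Y t - step t)) \<in> borel_measurable borel" by measurable
  ultimately show "bdd_borel (\<lambda>t. cmod (Y t - step t))" by (intro bdd_borelI[of _ "C + C"]) simp_all
qed

lemma wave_diff: "\<bar>wave t - step_wave t\<bar> \<le> \<bar>cmod (Y t - step t)\<bar>"
proof -
  have "wave t - step_wave t = Re ((Y t - step t) * cis (real m * t))"
    by (simp add: wave_def step_wave_def algebra_simps)
  then show ?thesis using abs_Re_le_cmod[of "(Y t - step t) * cis (real m * t)"] by (simp add: norm_mult)
qed

definition knot :: "nat \<Rightarrow> real" where "knot j = real j * (2 * pi) / real m"

lemma knot_Suc: "knot (Suc j) = knot j + 2 * pi / m"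
  using m0 by (simp add: knot_def field_simps)

lemma sum_knots: "(f :: real \<Rightarrow> real) integrable_on {0..2*pi} \<Longrightarrow> (\<Sum>j<m. integral {knot j..knot (Suc j)} f) = integral {0..2*pi} f"
  unfolding knot_def using integral_uniform_partition[OF m, of f "2 * pi"] by simp

lemma step_eq:
  assumes "t \<in> {knot j..<knot (Suc j)}"
  shows "step t = Y (knot j)"
proof -
  have "real j \<le> real m * t / (2 * pi)" "real m * t / (2 * pi) < real j + 1"
    using assms m0 by (simp_all add: knot_def field_simps)
  then have "\<lfloor>real m * t / (2 * pi)\<rfloor> = int j" by (intro floor_unique) auto
  then show ?thesis by (simp add: step_def knot_def mult.commute)
qed

lemma step_dist: "\<bar>t - 2 * pi * of_int \<lfloor>real m * t / (2 * pi)\<rfloor> / real m\<bar> \<le> 2 * pi / m"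
proof -
  define k where "k = \<lfloor>real m * t / (2 * pi)\<rfloor>"
  have "of_int k \<le> real m * t / (2 * pi)" "real m * t / (2 * pi) < of_int k + 1" unfolding k_def by linarith+
  then have "2 * pi * of_int k / m \<le> t" "t \<le> 2 * pi * of_int k / m + 2 * pi / m"
    using m0 by (simp_all add: field_simps)
  then show ?thesis unfolding k_def[symmetric] by linarith
qed

definition phase :: "nat \<Rightarrow> real" where "phase j = Arg (Y (knot j))"

lemma step_wave_eq:
  assumes "t \<in> {knot j..<knot (Suc j)}"
  shows "step_wave t = cmod (Y (knot j)) * cos (real m * t + phase j)"
proof -
  have "Y (knot j) = of_real (cmod (Y (knot j))) * cis (phase j)"
    unfolding phase_def using rcis_cmod_Arg[of "Y (knot j)"] by (simp add: rcis_def)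
  then have "step_wave t = Re (of_real (cmod (Y (knot j))) * cis (phase j) * cis (real m * t))"
    unfolding step_wave_def step_eq[OF assms] by metis
  then show ?thesis by (simp add: mult.assoc cis_mult add.commute)
qed

lemma integral_knot_cong:
  assumes "\<And>t. t \<in> {knot j..<knot (Suc j)} \<Longrightarrow> f t = g t"
  shows "integral {knot j..knot (Suc j)} f = integral {knot j..knot (Suc j)} (g :: real \<Rightarrow> real)"
  by (rule integral_spike[of "{knot (Suc j)}"]) (use assms in auto)

text \<open>The cell is a full period of \<open>cos (m t + \<theta>)\<close>, so the phase drops out
  by periodicity.\<close>

lemma integral_full_wave:
  fixes F :: "real \<Rightarrow> real"
  assumes F: "continuous_on UNIV F"
  shows "integral {knot j..knot (Suc j)} (\<lambda>t. F (cos (real m * t + \<theta>))) = integral {0..2*pi} (\<lambda>u. F (cos u)) / real m"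
proof -
  have Fc: "continuous_on S (\<lambda>u. F (cos u))" for S
    by (intro continuous_on_compose2[OF F] continuous_intros) auto
  define a b where "a = knot j" and "b = knot (Suc j)"
  have ab: "a \<le> b" "real m * b + \<theta> = real m * a + \<theta> + 2 * pi"
    using m0 by (simp_all add: a_def b_def knot_Suc field_simps)
  have "((\<lambda>t. real m *\<^sub>R F (cos (real m * t + \<theta>))) has_integral
      integral {real m * a + \<theta>..real m * b + \<theta>} (\<lambda>u. F (cos u))) {a..b}"
  proof (rule has_integral_substitution[OF ab(1) _ _ Fc])
    show "real m * a + \<theta> \<le> real m * b + \<theta>" using ab by simp
    show "(\<lambda>t. real m * t + \<theta>) ` {a..b} \<subseteq> {real m * a + \<theta>..real m * b + \<theta>}"
      using m0 by (auto intro: mult_left_mono)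
  qed (auto intro!: derivative_eq_intros)
  from integral_unique[OF this]
  have "real m * integral {a..b} (\<lambda>t. F (cos (real m * t + \<theta>))) = integral {real m * a + \<theta>..real m * b + \<theta>} (\<lambda>u. F (cos u))"
    by simp
  also have "\<dots> = integral {0..2*pi} (\<lambda>u. F (cos u))"
    unfolding ab(2) by (rule integral_periodic) (auto intro!: integrable_continuous_interval Fc)
  finally show ?thesis using m0 by (simp add: a_def b_def field_simps)
qed

lemma Lr_norm_step_wave:
  assumes r: "r \<ge> 1"
  shows "Lr_norm r step_wave = (2 * pi) powr (- 1 / r) * Lr_norm r cos * Lr_norm r (\<lambda>t. cmod (step t))"
proof -
  define c where "c = integral {0..2*pi} (\<lambda>u. \<bar>cos u\<bar> powr r)"
  have bc: "bdd_borel cos" by (rule bdd_borelI[of _ 1]) auto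
  have c: "(LINT t|circ. \<bar>cos t\<bar> powr r) = c"
    unfolding c_def using r by (intro bdd_borel_LINT bdd_borel_powr bc) auto
  have c0: "c \<ge> 0" unfolding c[symmetric] by (rule integral_nonneg_AE) simp
  have pc: "continuous_on UNIV (\<lambda>x::real. \<bar>x\<bar> powr r)" using r by (intro continuous_on_powr' continuous_intros) auto
  have bw: "bdd_borel (\<lambda>t. \<bar>step_wave t\<bar> powr r)" and bs: "bdd_borel (\<lambda>t. \<bar>cmod (step t)\<bar> powr r)"
    using r by (intro bdd_borel_powr bdd_step_wave bdd_step_amp; simp)+
  have cell: "integral {knot j..knot (Suc j)} (\<lambda>t. \<bar>step_wave t\<bar> powr r) = c / (2 * pi) * integral {knot j..knot (Suc j)} (\<lambda>t. \<bar>cmod (step t)\<bar> powr r)" for j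
  proof -
    define y where "y = cmod (Y (knot j))"
    have "integral {knot j..knot (Suc j)} (\<lambda>t. \<bar>step_wave t\<bar> powr r) =
        integral {knot j..knot (Suc j)} (\<lambda>t. y powr r * \<bar>cos (real m * t + phase j)\<bar> powr r)"
      by (rule integral_knot_cong) (simp add: step_wave_eq abs_mult powr_mult y_def)
    also have "\<dots> = y powr r * (c / m)"
      unfolding c_def using integral_full_wave[OF pc, of j "phase j"] by simp
    finally have 1: "integral {knot j..knot (Suc j)} (\<lambda>t. \<bar>step_wave t\<bar> powr r) = y powr r * (c / m)" .
    have "integral {knot j..knot (Suc j)} (\<lambda>t. \<bar>cmod (step t)\<bar> powr r) = integral {knot j..knot (Suc j)} (\<lambda>t. y powr r)"
      by (rule integral_knot_cong) (simp add: step_eq y_def)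
    also have "\<dots> = y powr r * (2 * pi / m)" using m0 by (simp add: knot_Suc mult.commute)
    finally show ?thesis unfolding 1 by simp
  qed
  have "(LINT t|circ. \<bar>step_wave t\<bar> powr r) = (\<Sum>j<m. c / (2 * pi) * integral {knot j..knot (Suc j)} (\<lambda>t. \<bar>cmod (step t)\<bar> powr r))"
    unfolding bdd_borel_LINT[OF bw] cell[symmetric] by (rule sum_knots[symmetric, OF bdd_borel_integrable_on[OF bw]])
  also have "\<dots> = c / (2 * pi) * (LINT t|circ. \<bar>cmod (step t)\<bar> powr r)"
    unfolding bdd_borel_LINT[OF bs] sum_distrib_left[symmetric] sum_knots[OF bdd_borel_integrable_on[OF bs]] ..
  finally have *: "(LINT t|circ. \<bar>step_wave t\<bar> powr r) = c / (2 * pi) * (LINT t|circ. \<bar>cmod (step t)\<bar> powr r)" .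
  have "Lr_norm r step_wave = (c / (2 * pi)) powr (1 / r) * Lr_norm r (\<lambda>t. cmod (step t))"
    unfolding Lr_norm_def * using c0 by (subst powr_mult) (auto intro: integral_nonneg_AE)
  also have "(c / (2 * pi)) powr (1 / r) = c powr (1 / r) / (2 * pi) powr (1 / r)"
    using c0 by (simp add: powr_divide)
  also have "\<dots> = (2 * pi) powr (- 1 / r) * Lr_norm r cos"
    by (simp add: Lr_norm_def c powr_minus_divide)
  finally show ?thesis .
qed

text \<open>Moving by half a period within a cell changes the sign of the cosine and hence of the
  odd function \<open>\<Psi>\<close>, so the two halves of every cell cancel.\<close>

lemma LINT_odd_step_wave:
  assumes odd: "\<And>x. \<Psi> (- x) = - \<Psi> x" and b: "bdd_borel (\<lambda>t. \<Psi> (step_wave t))"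
  shows "(LINT t|circ. \<Psi> (step_wave t)) = 0"
proof -
  have cell: "integral {knot j..knot (Suc j)} (\<lambda>t. \<Psi> (step_wave t)) = 0" for j
  proof -
    define a where "a = knot j"
    define d where "d = pi / m"
    have d: "d > 0" "knot (Suc j) = a + d + d" using m0 by (simp_all add: d_def a_def knot_Suc)
    define f where "f t = \<Psi> (cmod (Y (knot j)) * cos (real m * t + phase j))" for t
    have eq: "\<Psi> (step_wave t) = f t" if "t \<in> {knot j..<knot (Suc j)}" for t
      using step_wave_eq[OF that] by (simp add: f_def)
    have fd: "f (t + d) = - f t" for t
    proof -
      have "real m * (t + d) + phase j = real m * t + phase j + pi" using m0 by (simp add: d_def field_simps)
      then have "cos (real m * (t + d) + phase j) = - cos (real m * t + phase j)" by (simp only: cos_periodic_pi)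
      then show ?thesis by (simp add: f_def odd)
    qed
    have fi: "f integrable_on {a..a + d + d}"
    proof (rule integrable_spike[of _ _ "{a + d + d}"])
      show "(\<lambda>t. \<Psi> (step_wave t)) integrable_on {a..a + d + d}" by (rule bdd_borel_integrable_on[OF b])
    qed (use eq d in \<open>auto simp: a_def\<close>)
    have "integral {a..a + d + d} f = integral {a..a + d} f + integral {a + d..a + d + d} f"
      using d fi by (intro Henstock_Kurzweil_Integration.integral_combine[symmetric]) auto
    also have "integral {a + d..a + d + d} f = integral {a..a + d} (\<lambda>t. f (t + d))"
      using integral_shift_real_ivl[of "a + d" d "a + d + d" f] by (simp add: add.commute)
    also have "\<dots> = - integral {a..a + d} f" by (simp add: fd)
    finally have "integral {a..a + d + d} f = 0" by simp
    moreover have "integral {knot j..knot (Suc j)} (\<lambda>t. \<Psi> (step_wave t)) = integral {knot j..knot (Suc j)} f"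
      by (rule integral_knot_cong) (rule eq)
    ultimately show ?thesis using d(2) by (simp add: a_def)
  qed
  show ?thesis unfolding bdd_borel_LINT[OF b] sum_knots[OF bdd_borel_integrable_on[OF b], symmetric]
    by (simp add: cell)
qed

definition err :: "real \<Rightarrow> real" where "err r = Lr_norm r (\<lambda>t. cmod (Y t - step t))"

text \<open>\<open>\<bar>cos\<bar> \<le> 1\<close>, and \<open>(2 * pi) powr (1 / r)\<close> is the
  norm of the constant 1. Freezing errors are therefore not enlarged when they are multiplied by
  this factor.\<close>

lemma cos_factor:
  assumes r: "r \<ge> 1"
  shows "(2 * pi) powr (- 1 / r) * Lr_norm r cos \<le> 1"
proof -
  have "Lr_norm r cos \<le> Lr_norm r (\<lambda>_. 1)" using r by (intro Lr_norm_mono bdd_borelI[of _ 1]) auto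
  also have "\<dots> = (2 * pi) powr (1 / r)" using r Lr_norm_const[of r 1] by simp
  finally have "(2 * pi) powr (- 1 / r) * Lr_norm r cos \<le> (2 * pi) powr (- 1 / r) * (2 * pi) powr (1 / r)"
    by (rule mult_left_mono) simp
  also have "\<dots> = 1" by (simp flip: powr_add)
  finally show ?thesis .
qed

lemma step_amp_triangle:
  assumes r: "r \<ge> 1"
  shows "Lr_norm r (\<lambda>t. cmod (step t)) \<le> Lr_norm r (\<lambda>t. cmod (Y t)) + err r"
    "Lr_norm r (\<lambda>t. cmod (Y t)) \<le> Lr_norm r (\<lambda>t. cmod (step t)) + err r"
proof -
  have "\<bar>cmod (step t) - cmod (Y t)\<bar> \<le> \<bar>cmod (Y t - step t)\<bar>" for t
    using norm_triangle_ineq3[of "step t" "Y t"] by (simp add: norm_minus_commute)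
  then show "Lr_norm r (\<lambda>t. cmod (step t)) \<le> Lr_norm r (\<lambda>t. cmod (Y t)) + err r"
    "Lr_norm r (\<lambda>t. cmod (Y t)) \<le> Lr_norm r (\<lambda>t. cmod (step t)) + err r"
    unfolding err_def
    by (intro Lr_norm_triangle[OF r] bdd_step_amp bdd_amp bdd_diff; simp add: abs_minus_commute)+
qed

lemma wave_pairing_le:
  assumes r: "r \<ge> 1" and \<phi>: "dual_ball r \<phi>"
  shows "\<bar>LINT t|circ. \<phi> t * wave t\<bar> \<le> (2 * pi) powr (- 1 / r) * Lr_norm r cos * Lr_norm r (\<lambda>t. cmod (Y t)) + 2 * err r"
proof -
  define \<kappa> where "\<kappa> = (2 * pi) powr (- 1 / r) * Lr_norm r cos"
  have \<kappa>: "0 \<le> \<kappa>" "\<kappa> \<le> 1" using cos_factor[OF r] by (auto simp: \<kappa>_def Lr_norm_nonneg)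
  have "\<bar>LINT t|circ. \<phi> t * wave t\<bar> \<le> Lr_norm r wave" by (rule Hoelder_dual_ball[OF r \<phi> bdd_wave])
  also have "\<dots> \<le> Lr_norm r step_wave + err r"
    unfolding err_def by (intro Lr_norm_triangle[OF r] bdd_wave bdd_step_wave bdd_diff wave_diff)
  also have "Lr_norm r step_wave = \<kappa> * Lr_norm r (\<lambda>t. cmod (step t))" by (simp add: Lr_norm_step_wave[OF r] \<kappa>_def)
  also have "\<dots> \<le> \<kappa> * (Lr_norm r (\<lambda>t. cmod (Y t)) + err r)"
    using \<kappa> step_amp_triangle[OF r] by (intro mult_left_mono) auto
  also have "\<dots> \<le> \<kappa> * Lr_norm r (\<lambda>t. cmod (Y t)) + err r"
    using \<kappa> by (simp add: distrib_left err_def Lr_norm_nonneg mult_left_le_one_le)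
  finally show ?thesis by (simp add: \<kappa>_def)
qed

lemma wave_pairing_extremal:
  assumes r: "r \<ge> 1"
  obtains \<psi> where "bdd_borel \<psi>" "\<And>t. \<psi> (t + 2 * pi) = \<psi> t" "(LINT t|circ. \<psi> t) = 0" "dual_ball r \<psi>"
    "(LINT t|circ. \<psi> t * wave t) \<ge> (2 * pi) powr (- 1 / r) * Lr_norm r cos * Lr_norm r (\<lambda>t. cmod (Y t)) - 2 * err r"
proof -
  define \<kappa> where "\<kappa> = (2 * pi) powr (- 1 / r) * Lr_norm r cos"
  have \<kappa>: "0 \<le> \<kappa>" "\<kappa> \<le> 1" using cos_factor[OF r] by (auto simp: \<kappa>_def Lr_norm_nonneg)
  obtain \<Psi> where \<Psi>: "\<And>x. \<Psi> (- x) = - \<Psi> x" "\<Psi> \<in> borel_measurable borel" "bdd_borel (\<lambda>t. \<Psi> (step_wave t))"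
    "dual_ball r (\<lambda>t. \<Psi> (step_wave t))" "(LINT t|circ. \<Psi> (step_wave t) * step_wave t) = Lr_norm r step_wave"
    using dual_extremal[OF r bdd_step_wave] by metis
  note i = dual_ball_mult_integrable[OF r \<Psi>(4)]
  have d: "bdd_borel (\<lambda>t. wave t - step_wave t)" by (rule bdd_borel_diff[OF bdd_wave bdd_step_wave])
  have "(LINT t|circ. \<Psi> (step_wave t) * wave t) = (LINT t|circ. \<Psi> (step_wave t) * step_wave t + \<Psi> (step_wave t) * (wave t - step_wave t))"
    by (simp add: algebra_simps)
  also have "\<dots> = Lr_norm r step_wave + (LINT t|circ. \<Psi> (step_wave t) * (wave t - step_wave t))"
    by (subst Bochner_Integration.integral_add[OF i[OF bdd_step_wave] i[OF d]]) (simp add: \<Psi>)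
  also have "\<dots> \<ge> Lr_norm r step_wave - err r"
  proof -
    have "\<bar>LINT t|circ. \<Psi> (step_wave t) * (wave t - step_wave t)\<bar> \<le> Lr_norm r (\<lambda>t. wave t - step_wave t)"
      by (rule Hoelder_dual_ball[OF r \<Psi>(4) d])
    also have "\<dots> \<le> err r" unfolding err_def using r by (intro Lr_norm_mono d bdd_diff wave_diff) auto
    finally show ?thesis by linarith
  qed
  finally have "(LINT t|circ. \<Psi> (step_wave t) * wave t) \<ge> Lr_norm r step_wave - err r" .
  moreover have "Lr_norm r step_wave \<ge> \<kappa> * Lr_norm r (\<lambda>t. cmod (Y t)) - err r"
  proof -
    have "\<kappa> * (Lr_norm r (\<lambda>t. cmod (Y t)) - err r) \<le> \<kappa> * Lr_norm r (\<lambda>t. cmod (step t))"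
      using \<kappa> step_amp_triangle[OF r] by (intro mult_left_mono) auto
    also have "\<dots> = Lr_norm r step_wave" by (simp add: Lr_norm_step_wave[OF r] \<kappa>_def)
    finally have "\<kappa> * Lr_norm r (\<lambda>t. cmod (Y t)) - \<kappa> * err r \<le> Lr_norm r step_wave" by (simp add: right_diff_distrib)
    moreover have "\<kappa> * err r \<le> err r" using \<kappa> by (simp add: err_def Lr_norm_nonneg mult_left_le_one_le)
    ultimately show ?thesis by linarith
  qed
  ultimately have "(LINT t|circ. \<Psi> (step_wave t) * wave t) \<ge> \<kappa> * Lr_norm r (\<lambda>t. cmod (Y t)) - 2 * err r" by linarith
  moreover have "\<Psi> (step_wave (t + 2 * pi)) = \<Psi> (step_wave t)" for t by (simp add: step_wave_per)
  moreover have "(LINT t|circ. \<Psi> (step_wave t)) = 0" by (rule LINT_odd_step_wave[OF \<Psi>(1,3)])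
  ultimately show ?thesis using that[of "\<lambda>t. \<Psi> (step_wave t)"] \<Psi>(3,4) by (simp add: \<kappa>_def)
qed

text \<open>\<open>step\<close> looks back by at most \<open>2 * pi / m\<close>, and the norm of a
  constant is at most \<open>2 * pi\<close> times its value; \<open>4 * pi ^ 2\<close> is below
  48.\<close>

lemma err_le_lipschitz:
  assumes r: "r \<ge> 1" and lip: "\<And>x y. cmod (Y x - Y y) \<le> D * \<bar>x - y\<bar>"
  shows "err r \<le> 48 * D / m"
proof -
  have D: "D \<ge> 0" using order_trans[OF norm_ge_zero lip[of 1 0]] by simp
  have "cmod (Y t - step t) \<le> D * (2 * pi / m)" for t
    using lip[of t "2 * pi * of_int \<lfloor>real m * t / (2 * pi)\<rfloor> / real m"] mult_left_mono[OF step_dist[of t] D]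
    unfolding step_def by linarith
  then have "err r \<le> Lr_norm r (\<lambda>_. D * (2 * pi / m))"
    unfolding err_def using r D m0 by (intro Lr_norm_mono bdd_diff bdd_borelI[of _ "D * (2 * pi / m)"]) auto
  also have "\<dots> = D * (2 * pi / m) * (2 * pi) powr (1 / r)" using r D m0 by (intro Lr_norm_const) auto
  also have "\<dots> \<le> D * (2 * pi / m) * (2 * pi) powr 1"
    using r D m0 pi_gt3 by (intro mult_left_mono powr_mono) auto
  also have "\<dots> = (4 * pi\<^sup>2) * (D / m)" by (simp add: power2_eq_square)
  also have "\<dots> \<le> 48 * (D / m)"
  proof (rule mult_right_mono)
    have "pi\<^sup>2 \<le> 3.2\<^sup>2" using pi_approx by (intro power_mono) auto
    then show "4 * pi\<^sup>2 \<le> 48" by (simp add: power2_eq_square)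
  qed (use D in simp)
  finally show ?thesis by simp
qed

end

section \<open>The elliptic integral\<close>

lemma LINT_circ_dilate:
  fixes G :: "real \<Rightarrow> real"
  assumes per: "\<And>t. G (t + 2 * pi) = G t" and cont: "continuous_on UNIV G" and p: "p \<ge> 1"
  shows "(LINT t|circ. G (real p * t)) = integral\<^sup>L circ G"
proof -
  have Gc: "continuous_on S G" for S by (rule continuous_on_subset[OF cont]) simp
  have Gi: "G integrable_on {a..b}" for a b by (rule integrable_continuous_interval[OF Gc])
  have dc: "continuous_on UNIV (\<lambda>t. G (real p * t))"
    by (intro continuous_on_compose2[OF cont] continuous_intros) auto
  have "((\<lambda>t. real p *\<^sub>R G (real p * t)) has_integral integral {real p * 0..real p * (2 * pi)} G) {0..2*pi}"
  proof (rule has_integral_substitution[OF _ _ _ Gc])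
    show "(*) (real p) ` {0..2 * pi} \<subseteq> {0..real p * (2 * pi)}"
      using mult_left_mono[of _ "2 * pi" "real p"] by auto
  qed (auto intro!: derivative_eq_intros)
  from integral_unique[OF this]
  have "real p * integral {0..2*pi} (\<lambda>t. G (real p * t)) = integral {0..real p * (2 * pi)} G" by simp
  also have "\<dots> = (\<Sum>j<p. integral {real j * (real p * (2 * pi)) / real p..real (Suc j) * (real p * (2 * pi)) / real p} G)"
    by (rule integral_uniform_partition[OF p Gi, symmetric])
  also have "\<dots> = (\<Sum>j<p. integral {0..2*pi} G)"
  proof (rule sum.cong[OF refl])
    fix j
    have "real j * (real p * (2 * pi)) / real p = real j * (2 * pi)"
      "real (Suc j) * (real p * (2 * pi)) / real p = real j * (2 * pi) + 2 * pi"
      using p by (simp_all add: field_simps)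
    then show "integral {real j * (real p * (2 * pi)) / real p..real (Suc j) * (real p * (2 * pi)) / real p} G = integral {0..2*pi} G"
      using integral_periodic[of G, OF per _ Gi] by simp
  qed
  also have "\<dots> = real p * integral {0..2*pi} G" by simp
  finally show ?thesis using p by (simp add: LINT_circ_continuous[OF dc] LINT_circ_continuous[OF cont])
qed

text \<open>The function \<open>h (p t)\<close> is invariant under the shift by
  \<open>2 * pi / p\<close>, while the pair \<open>cos (k t)\<close>, \<open>sin (k t)\<close> is
  rotated by \<theta>. The vector \<open>(I, J)\<close> is therefore fixed by a rotation that is
  nontrivial when \<open>p\<close> does not divide \<open>k\<close>, and so it vanishes.\<close>

lemma LINT_dilate_cos_eq_0:
  fixes h :: "real \<Rightarrow> real"
  assumes per: "\<And>t. h (t + 2 * pi) = h t" and cont: "continuous_on UNIV h" and p: "p \<ge> 1" and k: "\<not> p dvd k"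
  shows "(LINT t|circ. h (real p * t) * cos (real k * t)) = 0"
proof -
  define \<theta> where "\<theta> = real k * (2 * pi / real p)"
  define I J where "I = (LINT t|circ. h (real p * t) * cos (real k * t))" and "J = (LINT t|circ. h (real p * t) * sin (real k * t))"
  have hc: "continuous_on UNIV (\<lambda>t. h (real p * t))"
    by (intro continuous_on_compose2[OF cont] continuous_intros) auto
  have hper: "h (real p * (t + 2 * pi)) = h (real p * t)" for t
    using periodic_int_multiple[of h "2 * pi" "real p * t" "int p", OF per] by (simp add: algebra_simps)
  have shift: "real p * (t + 2 * pi / real p) = real p * t + 2 * pi" "real k * (t + 2 * pi / real p) = real k * t + \<theta>" for t
    using p by (simp_all add: \<theta>_def distrib_left)
  have i: "integrable circ (\<lambda>t. h (real p * t) * cos (real k * t))" "integrable circ (\<lambda>t. h (real p * t) * sin (real k * t))"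
    by (rule integrable_circ_continuous; intro continuous_intros hc)+
  have pc: "cos (real k * (t + 2 * pi)) = cos (real k * t)" "sin (real k * (t + 2 * pi)) = sin (real k * t)" for t
    using periodic_cos_nat[of k t 0] periodic_sin_nat[of k t 0] by simp_all
  have "I = (LINT t|circ. h (real p * (t + 2 * pi / real p)) * cos (real k * (t + 2 * pi / real p)))"
    unfolding I_def
    by (rule LINT_circ_shift[of "\<lambda>t. h (real p * t) * cos (real k * t)", symmetric])
      (simp_all only: hper pc, intro continuous_intros hc)
  also have "\<dots> = (LINT t|circ. h (real p * t) * cos (real k * t) * cos \<theta> - h (real p * t) * sin (real k * t) * sin \<theta>)"
    unfolding shift per cos_add by (simp add: algebra_simps)
  also have "\<dots> = I * cos \<theta> - J * sin \<theta>" using i by (simp add: I_def J_def)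
  finally have e1: "I = I * cos \<theta> - J * sin \<theta>" .
  have "J = (LINT t|circ. h (real p * (t + 2 * pi / real p)) * sin (real k * (t + 2 * pi / real p)))"
    unfolding J_def
    by (rule LINT_circ_shift[of "\<lambda>t. h (real p * t) * sin (real k * t)", symmetric])
      (simp_all only: hper pc, intro continuous_intros hc)
  also have "\<dots> = (LINT t|circ. h (real p * t) * sin (real k * t) * cos \<theta> + h (real p * t) * cos (real k * t) * sin \<theta>)"
    unfolding shift per sin_add by (simp add: algebra_simps)
  also have "\<dots> = J * cos \<theta> + I * sin \<theta>" using i by (simp add: I_def J_def)
  finally have e2: "J = J * cos \<theta> + I * sin \<theta>" .
  have "cos \<theta> \<noteq> 1"
  proof
    assume "cos \<theta> = 1"
    then obtain n :: int where "\<theta> = of_int n * 2 * pi" unfolding cos_one_2pi_int by blast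
    then have "real k = of_int n * real p" using p by (simp add: \<theta>_def field_simps)
    then have "int k = n * int p" by (metis of_int_eq_iff of_int_mult of_int_of_nat_eq)
    then have "int p dvd int k" by simp
    then show False using k by simp
  qed
  \<comment> \<open>Cramer's rule for the first coordinate: the coefficient of \<open>a\<close> is
    the determinant of the identity minus the rotation.\<close>
  have alg: "a * ((1 - c)\<^sup>2 + s\<^sup>2) = (1 - c) * (a - (a * c - b * s)) - s * (b - (b * c + a * s))" for a b c s :: real
    by (simp add: power2_eq_square algebra_simps)
  have "I * ((1 - cos \<theta>)\<^sup>2 + (sin \<theta>)\<^sup>2) = (1 - cos \<theta>) * (I - (I * cos \<theta> - J * sin \<theta>)) - sin \<theta> * (J - (J * cos \<theta> + I * sin \<theta>))"
    by (rule alg)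
  also have "\<dots> = 0" using e1 e2 by simp
  finally have "I = 0"
    using \<open>cos \<theta> \<noteq> 1\<close> sum_power2_gt_zero_iff[of "1 - cos \<theta>" "sin \<theta>"] by auto
  then show ?thesis by (simp add: I_def)
qed

lemma poisson_minus: "poisson r (- u) = poisson r u" by (simp add: poisson_def)

text \<open>Only frequencies divisible by \<open>p\<close> contribute to the left side, and the
  Poisson coefficient for \<open>q\<close> at \<open>p * l\<close> is the one for
  \<open>q ^ p\<close> at \<open>l\<close>. In other words, the map \<open>t \<mapsto> p t\<close>
  carries the Poisson kernel for \<open>q\<close> to the one for \<open>q ^ p\<close>.\<close>

lemma LINT_dilate_poisson:
  fixes h :: "real \<Rightarrow> real"
  assumes per: "\<And>t. h (t + 2 * pi) = h t" and cont: "continuous_on UNIV h" and p: "p \<ge> 1" and q: "0 < q" "q < 1"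
  shows "(LINT t|circ. h (real p * t) * poisson q t) = (LINT t|circ. h t * poisson (q ^ p) t)"
proof -
  have hc: "continuous_on UNIV (\<lambda>t. h (real p * t))"
    by (intro continuous_on_compose2[OF cont] continuous_intros) auto
  have qp: "\<bar>q ^ p\<bar> < 1" "\<bar>q\<bar> < 1" using q p by (auto simp: power_less_one_iff)
  have A: "(\<lambda>k. poisson_coeff q k * (LINT t|circ. h (real p * t) * cos (real k * t))) sums (LINT t|circ. h (real p * t) * poisson q t)"
    using LINT_poisson_sums(2)[OF integrable_circ_continuous[OF hc] qp(2), of 0] by (simp add: poisson_minus)
  have B: "(\<lambda>k. poisson_coeff (q ^ p) k * (LINT t|circ. h t * cos (real k * t))) sums (LINT t|circ. h t * poisson (q ^ p) t)"
    using LINT_poisson_sums(2)[OF integrable_circ_continuous[OF cont] qp(1), of 0] by (simp add: poisson_minus)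
  have "strict_mono (\<lambda>l. p * l)" using p by (auto intro: strict_monoI)
  moreover have "poisson_coeff q k * (LINT t|circ. h (real p * t) * cos (real k * t)) = 0" if "k \<notin> range (\<lambda>l. p * l)" for k
  proof -
    have "\<not> p dvd k" using that by (auto simp: dvd_def)
    then show ?thesis using LINT_dilate_cos_eq_0[OF per cont p] by simp
  qed
  ultimately have "(\<lambda>l. poisson_coeff q (p * l) * (LINT t|circ. h (real p * t) * cos (real (p * l) * t))) sums (LINT t|circ. h (real p * t) * poisson q t)"
    using A by (subst sums_mono_reindex[of "\<lambda>l. p * l"]) auto
  moreover have "poisson_coeff q (p * l) = poisson_coeff (q ^ p) l" for l
    using p by (simp add: poisson_coeff_def power_mult)
  moreover have "(LINT t|circ. h (real p * t) * cos (real (p * l) * t)) = (LINT t|circ. h t * cos (real l * t))" for l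
  proof -
    have "(LINT t|circ. h (real p * t) * cos (real l * (real p * t))) = (LINT t|circ. h t * cos (real l * t))"
      by (rule LINT_circ_dilate[of "\<lambda>t. h t * cos (real l * t)", OF _ _ p])
        (use per periodic_cos_nat[of l _ 0] in \<open>auto intro!: continuous_intros cont\<close>)
    then show ?thesis by (simp add: mult_ac)
  qed
  ultimately have "(\<lambda>k. poisson_coeff (q ^ p) k * (LINT t|circ. h t * cos (real k * t))) sums (LINT t|circ. h (real p * t) * poisson q t)"
    by simp
  then show ?thesis using B sums_unique2 by blast
qed

lemma elliptic_integrand_pos:
  assumes "0 < \<rho>" "\<rho> < (1::real)"
  shows "1 - \<rho>\<^sup>2 * (sin \<theta>)\<^sup>2 > 0"
proof -
  have "\<rho>\<^sup>2 * (sin \<theta>)\<^sup>2 \<le> \<rho>\<^sup>2 * 1" using assms by (intro mult_left_mono) (auto simp: abs_square_le_1)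
  also have "\<dots> < 1" using assms by (simp add: power_less_one_iff)
  finally show ?thesis by simp
qed

lemma integral_elliptic_full:
  assumes \<rho>: "0 < \<rho>" "\<rho> < 1"
  shows "integral {0..2*pi} (\<lambda>\<theta>. 1 / sqrt (1 - \<rho>\<^sup>2 * (sin \<theta>)\<^sup>2)) = 4 * elliptic_K \<rho>"
proof -
  define f where "f \<theta> = 1 / sqrt (1 - \<rho>\<^sup>2 * (sin \<theta>)\<^sup>2)" for \<theta>
  have fc: "continuous_on S f" for S
    unfolding f_def[abs_def] using elliptic_integrand_pos[OF \<rho>]
    by (intro continuous_intros) (metis less_irrefl real_sqrt_eq_zero_cancel_iff)
  have fi: "f integrable_on {a..b}" for a b by (rule integrable_continuous_interval[OF fc])
  have per: "f (\<theta> + pi) = f \<theta>" and refl: "f (- \<theta>) = f \<theta>" for \<theta> by (simp_all add: f_def)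
  have "integral {0..2*pi} f = (\<Sum>j<2. integral {real j * (2 * pi) / real 2..real (Suc j) * (2 * pi) / real 2} f)"
    by (rule integral_uniform_partition[OF _ fi, symmetric]) simp
  also have "\<dots> = integral {0..pi} f + integral {pi..pi + pi} f" by (simp add: numeral_2_eq_2)
  also have "integral {pi..pi + pi} f = integral {0..pi} f" by (rule integral_periodic[OF per _ fi]) simp
  also have "integral {0..pi} f = integral {0..pi/2} f + integral {pi/2..pi} f"
    by (rule Henstock_Kurzweil_Integration.integral_combine[symmetric]) (auto intro: fi)
  also have "integral {pi/2..pi} f = integral {-(pi/2)..0} (\<lambda>t. f (t + pi))"
    using integral_shift_real_ivl[of "pi/2" pi pi f] by simp
  also have "\<dots> = integral {-(pi/2)..0} (\<lambda>t. f (- t))" by (simp add: per refl)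
  also have "\<dots> = integral {0..pi/2} f"
    using Henstock_Kurzweil_Integration.integral_reflect_real[of "pi/2" 0 f] by simp
  also have "integral {0..pi/2} f = elliptic_K \<rho>"
    unfolding elliptic_K_def f_def[symmetric]
    by (rule lebesgue_integral_eq_integral[symmetric]) (auto intro: continuous_imp_integrable_real fc)
  finally show ?thesis by (simp add: f_def[symmetric, abs_def])
qed

text \<open>The substitution \<open>t = \<theta> - arcsin (\<rho> sin \<theta>)\<close> replaces the polar angle of a point of the
  unit circle seen from the centre by the angle \<open>\<theta>\<close> at which it is seen from the point \<open>\<rho>\<close>.\<close>

lemma integral_inverse_chord:
  assumes \<rho>: "0 < \<rho>" "\<rho> < 1"
  shows "integral {0..2*pi} (\<lambda>t. 1 / sqrt (1 - 2 * \<rho> * cos t + \<rho>\<^sup>2)) = 4 * elliptic_K \<rho>"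
proof -
  define F where "F t = 1 / sqrt (1 - 2 * \<rho> * cos t + \<rho>\<^sup>2)" for t
  have Fc: "continuous_on S F" for S
    unfolding F_def[abs_def] using poisson_denom_pos[of \<rho>] \<rho>
    by (intro continuous_intros) (metis abs_of_pos less_irrefl real_sqrt_eq_zero_cancel_iff)
  define S where "S \<theta> = sqrt (1 - \<rho>\<^sup>2 * (sin \<theta>)\<^sup>2)" for \<theta>
  have S: "S \<theta> > 0" "(S \<theta>)\<^sup>2 = 1 - \<rho>\<^sup>2 * (sin \<theta>)\<^sup>2" for \<theta>
    using elliptic_integrand_pos[OF \<rho>, of \<theta>] by (simp_all add: S_def)
  define g where "g \<theta> = \<theta> - arcsin (\<rho> * sin \<theta>)" for \<theta>
  have sb: "\<bar>\<rho> * sin \<theta>\<bar> < 1" for \<theta>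
  proof -
    have "\<bar>\<rho> * sin \<theta>\<bar> \<le> \<rho> * 1" unfolding abs_mult using \<rho> by (intro mult_mono) auto
    then show ?thesis using \<rho> by simp
  qed
  have sb': "-1 < \<rho> * sin \<theta>" "\<rho> * sin \<theta> < 1" for \<theta> using sb[of \<theta>] by linarith+
  \<comment> \<open>The difference of the squares is \<open>1 - \<rho> ^ 2\<close>, which is
    positive.\<close>
  have pos: "S \<theta> - \<rho> * cos \<theta> > 0" for \<theta>
  proof (rule ccontr)
    assume "\<not> S \<theta> - \<rho> * cos \<theta> > 0"
    then have "(S \<theta>)\<^sup>2 \<le> (\<rho> * cos \<theta>)\<^sup>2" using S(1)[of \<theta>] by (intro power_mono) auto
    then have "1 \<le> \<rho>\<^sup>2 * (cos \<theta>)\<^sup>2 + \<rho>\<^sup>2 * (sin \<theta>)\<^sup>2" using S(2)[of \<theta>] by (simp add: power_mult_distrib)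
    also have "\<dots> = \<rho>\<^sup>2 * ((sin \<theta>)\<^sup>2 + (cos \<theta>)\<^sup>2)" by (simp only: distrib_left add.commute)
    also have "\<dots> = \<rho>\<^sup>2" by simp
    also have "\<dots> < 1" using \<rho> by (simp add: power_less_one_iff)
    finally show False by simp
  qed
  have cosarc: "cos (arcsin (\<rho> * sin \<theta>)) = S \<theta>" for \<theta>
    using sb'[of \<theta>] by (simp add: cos_arcsin S_def power_mult_distrib)
  have "((\<lambda>\<theta>. (1 - \<rho> * cos \<theta> / S \<theta>) *\<^sub>R F (g \<theta>)) has_integral integral {g 0..g (2 * pi)} F) {0..2*pi}"
  proof (rule has_integral_substitution[OF _ _ _ Fc])
    show "g ` {0..2*pi} \<subseteq> {-pi..3*pi}"
    proof (rule image_subsetI)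
      fix x assume "x \<in> {0..2*pi}"
      moreover have "-(pi/2) \<le> arcsin (\<rho> * sin x)" "arcsin (\<rho> * sin x) \<le> pi/2"
        using arcsin_bounded[of "\<rho> * sin x"] sb'[of x] by auto
      ultimately show "g x \<in> {-pi..3*pi}" unfolding g_def using pi_gt_zero by auto
    qed
    fix x
    have "(arcsin has_real_derivative inverse (sqrt (1 - (\<rho> * sin x)\<^sup>2))) (at (\<rho> * sin x))"
      by (rule DERIV_arcsin) (use sb' in auto)
    moreover have "((\<lambda>x. \<rho> * sin x) has_real_derivative \<rho> * cos x) (at x within {0..2*pi})"
      by (auto intro!: derivative_eq_intros)
    ultimately have "((\<lambda>x. arcsin (\<rho> * sin x)) has_real_derivative inverse (sqrt (1 - (\<rho> * sin x)\<^sup>2)) * (\<rho> * cos x)) (at x within {0..2*pi})"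
      by (rule DERIV_chain2)
    then show "(g has_real_derivative 1 - \<rho> * cos x / S x) (at x within {0..2*pi})"
      unfolding g_def[abs_def] S_def
      by (rule DERIV_diff[OF DERIV_ident, THEN DERIV_cong]) (simp add: power_mult_distrib divide_inverse mult.commute)
  qed (auto simp: g_def)
  moreover have "(1 - \<rho> * cos \<theta> / S \<theta>) *\<^sub>R F (g \<theta>) = 1 / S \<theta>" for \<theta>
  proof -
    define a where "a = arcsin (\<rho> * sin \<theta>)"
    have a: "sin a = \<rho> * sin \<theta>" "cos a = S \<theta>" unfolding a_def using sb'[of \<theta>] cosarc by simp_all
    \<comment> \<open>The chord becomes a perfect square in the new variable, so that
      \<open>F (g \<theta>)\<close> is \<open>1 / (S \<theta> - \<rho> * cos \<theta>)\<close> and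
      cancels against the derivative of \<open>g\<close>.\<close>
    have "1 - 2 * \<rho> * cos (g \<theta>) + \<rho>\<^sup>2 = 1 - 2 * \<rho> * (cos \<theta> * S \<theta> + \<rho> * sin \<theta> * sin \<theta>) + \<rho>\<^sup>2 * ((sin \<theta>)\<^sup>2 + (cos \<theta>)\<^sup>2)"
      by (simp add: g_def a_def[symmetric] cos_diff a mult_ac)
    also have "\<dots> = (1 - \<rho>\<^sup>2 * (sin \<theta>)\<^sup>2) - 2 * \<rho> * cos \<theta> * S \<theta> + \<rho>\<^sup>2 * (cos \<theta>)\<^sup>2"
      unfolding power2_eq_square by (simp only: algebra_simps)
    also have "\<dots> = (S \<theta> - \<rho> * cos \<theta>)\<^sup>2"
      unfolding S(2)[symmetric] by (simp add: power2_diff power_mult_distrib mult_ac)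
    finally have "F (g \<theta>) = 1 / (S \<theta> - \<rho> * cos \<theta>)"
      using pos[of \<theta>] by (simp add: F_def)
    moreover have "1 - \<rho> * cos \<theta> / S \<theta> = (S \<theta> - \<rho> * cos \<theta>) / S \<theta>"
      using S(1)[of \<theta>] by (simp add: diff_divide_distrib)
    ultimately show ?thesis using pos[of \<theta>] by simp
  qed
  moreover have "g 0 = 0" "g (2 * pi) = 2 * pi" by (simp_all add: g_def)
  ultimately have "integral {0..2*pi} (\<lambda>\<theta>. 1 / S \<theta>) = integral {0..2*pi} F" by (simp add: integral_unique)
  then show ?thesis using integral_elliptic_full[OF \<rho>] unfolding S_def F_def[abs_def] by simp
qed

text \<open>The modulus is the distance \<open>h (p t)\<close>, with parameter
  \<open>\<rho> = q ^ p\<close>, times a Poisson kernel for \<open>q\<close> divided by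
  \<open>1 - q ^ 2\<close>. Removing the dilation replaces this kernel by the one for \<rho>, whose
  denominator is \<open>h ^ 2\<close>; what remains is the integral of the inverse chord
  \<open>1 / h\<close>.\<close>

lemma LINT_cmod_vp_mult:
  assumes q: "0 < q" "q < 1" and p: "p \<ge> 1"
  shows "integral {0..2*pi} (\<lambda>t. cmod (vp_mult q p t)) = 4 * ((1 - q ^ (2 * p)) / (1 - q\<^sup>2)) * elliptic_K (q ^ p)"
proof -
  define \<rho> where "\<rho> = q ^ p"
  have \<rho>: "0 < \<rho>" "\<rho> < 1" using q p by (auto simp: \<rho>_def power_less_one_iff)
  have \<rho>2: "q ^ (2 * p) = \<rho>\<^sup>2" by (simp add: \<rho>_def power_mult[symmetric] mult.commute)
  define h where "h t = sqrt (1 - 2 * \<rho> * cos t + \<rho>\<^sup>2)" for t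
  have hp: "h t > 0" for t using poisson_denom_pos[of \<rho> t] \<rho> by (simp add: h_def)
  have hsq: "h t * h t = 1 - 2 * \<rho> * cos t + \<rho>\<^sup>2" for t
    using poisson_denom_pos[of \<rho> t] \<rho> by (simp add: h_def)
  have hc: "continuous_on UNIV h" unfolding h_def[abs_def] by (intro continuous_intros)
  have hper: "h (t + 2 * pi) = h t" for t by (simp add: h_def)
  have q1: "1 - q\<^sup>2 \<noteq> 0" using q by (simp add: power2_eq_1_iff)
  have Zc: "continuous_on UNIV (\<lambda>t. cmod (vp_mult q p t))" using vp_mult_cont[OF q p] by (rule continuous_on_norm)
  have "integral {0..2*pi} (\<lambda>t. cmod (vp_mult q p t)) = (LINT t|circ. cmod (vp_mult q p t))"
    by (rule LINT_circ_continuous[OF Zc, symmetric])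
  also have "\<dots> = (LINT t|circ. h (real p * t) * poisson q t / (1 - q\<^sup>2))"
    using q1 by (simp add: cmod_vp_mult[OF q p] h_def \<rho>2 poisson_def \<rho>_def)
  also have "\<dots> = (LINT t|circ. h t * poisson \<rho> t) / (1 - q\<^sup>2)"
    using LINT_dilate_poisson[OF hper hc p q] by (simp add: \<rho>_def)
  also have "(\<lambda>t. h t * poisson \<rho> t) = (\<lambda>t. (1 - \<rho>\<^sup>2) * (1 / h t))"
  proof
    show "h t * poisson \<rho> t = (1 - \<rho>\<^sup>2) * (1 / h t)" for t
      unfolding poisson_def hsq[symmetric] using hp[of t] by simp
  qed
  also have "(LINT t|circ. (1 - \<rho>\<^sup>2) * (1 / h t)) = (1 - \<rho>\<^sup>2) * (LINT t|circ. 1 / h t)"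
    by (rule integral_mult_right_zero)
  also have "(LINT t|circ. 1 / h t) = integral {0..2*pi} (\<lambda>t. 1 / h t)"
    using hp by (intro LINT_circ_continuous continuous_intros hc) (metis less_irrefl)
  also have "\<dots> = 4 * elliptic_K \<rho>" unfolding h_def by (rule integral_inverse_chord[OF \<rho>])
  finally show ?thesis by (simp add: \<rho>2 \<rho>_def)
qed

text \<open>For \<open>p = 1\<close> the squared modulus is a Poisson kernel divided by
  \<open>1 - q ^ 2\<close>. In the mean the square thus costs only one power of
  \<open>1 / (1 - q)\<close>, whereas its maximum costs two.\<close>

lemma LINT_cmod_vp_mult_1_square:
  assumes q: "0 < q" "q < 1"
  shows "(LINT t|circ. (cmod (vp_mult q 1 (x - t)))\<^sup>2) = 2 * pi / (1 - q\<^sup>2)"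
proof -
  have q1: "1 - q\<^sup>2 \<noteq> 0" using q by (simp add: power2_eq_1_iff)
  have "(cmod (vp_mult q 1 u))\<^sup>2 = poisson q u / (1 - q\<^sup>2)" for u
  proof -
    have "vp_mult q 1 u = 1 / (1 - of_real q * cis u)"
      using one_minus_z(2)[OF q le_refl, of u] by (simp add: vp_mult_def power2_eq_square)
    then have "(cmod (vp_mult q 1 u))\<^sup>2 = 1 / (1 - 2 * q * cos u + q\<^sup>2)"
      unfolding poisson_denom by (simp add: norm_divide power_divide)
    then show ?thesis using q1 by (simp add: poisson_def)
  qed
  then show ?thesis using LINT_poisson[of q x] q by simp
qed

section \<open>The limiting case of integrable derivatives\<close>

lemma AE_circ_continuous_le:
  fixes f :: "real \<Rightarrow> real"
  assumes cont: "continuous_on UNIV f" and per: "\<And>t. f (t + 2 * pi) = f t" and ae: "AE t in circ. f t \<le> c"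
  shows "f t \<le> c"
proof -
  define g where "g t = max (f t - c) 0" for t
  have gc: "continuous_on S g" for S unfolding g_def[abs_def]
    by (intro continuous_intros continuous_on_subset[OF cont]) auto
  have "AE t in circ. g t = 0" using ae by eventually_elim (simp add: g_def)
  then have "integral\<^sup>L circ g = 0" by (rule integral_eq_zero_AE)
  then have "integral {0..2*pi} g = 0" using LINT_circ_continuous[OF gc] by simp
  then have z: "g u = 0" if "u \<in> {0..2*pi}" for u
    using integral_eq_0_iff[OF gc, of 0 "2 * pi"] that by (auto simp: g_def)
  define k where "k = - \<lfloor>t / (2 * pi)\<rfloor>"
  have "of_int (- k) \<le> t / (2 * pi)" "t / (2 * pi) < of_int (- k) + 1" unfolding k_def minus_minus by linarith+
  then have "t + of_int k * (2 * pi) \<in> {0..2*pi}" by (simp add: field_simps)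
  from z[OF this] have "f (t + of_int k * (2 * pi)) \<le> c" by (simp add: g_def max_def split: if_splits)
  then show ?thesis using periodic_int_multiple[of f, OF per] by simp
qed

lemma Ls_norm_infinity_continuous:
  assumes cont: "continuous_on UNIV f" and per: "\<And>t. f (t + 2 * pi) = f t" and max: "\<And>t. \<bar>f t\<bar> \<le> \<bar>f t0\<bar>"
  shows "Ls_norm \<infinity> f = \<bar>f t0\<bar>"
proof -
  define e where "e = esssup circ (\<lambda>t. ennreal \<bar>f t\<bar>)"
  have meas: "f \<in> borel_measurable circ" using integrable_circ_continuous[OF cont] by auto
  have up: "e \<le> ennreal \<bar>f t0\<bar>" unfolding e_def
    by (rule esssup_I) (use meas max in \<open>auto intro!: ennreal_leI measurable_compose[OF _ measurable_ennreal] borel_measurable_abs\<close>)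
  then have fin: "e = ennreal (enn2real e)" using le_less_trans[OF up] by (simp add: ennreal_enn2real)
  have "AE t in circ. ennreal \<bar>f t\<bar> \<le> e" unfolding e_def by (rule esssup_AE)
  then have "AE t in circ. \<bar>f t\<bar> \<le> enn2real e"
    by eventually_elim (subst (asm) fin, simp)
  then have "\<bar>f t0\<bar> \<le> enn2real e"
    by (intro AE_circ_continuous_le[of "\<lambda>t. \<bar>f t\<bar>"]) (auto intro: continuous_intros cont simp: per)
  moreover have "enn2real e \<le> \<bar>f t0\<bar>" using enn2real_mono[OF up] by simp
  ultimately show ?thesis by (simp add: Ls_norm_def e_def)
qed

text \<open>The positive part of \<open>cos t - cos \<eta>\<close> is periodic by construction and
  lives within \<eta> of the multiples of \<open>2 * pi\<close>. The integral is normalised to 1/2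
  so that a difference of two bumps has L1 norm at most 1.\<close>

lemma exists_bump:
  assumes "0 < \<eta>" "\<eta> < pi"
  obtains b :: "real \<Rightarrow> real" where "continuous_on UNIV b" "\<And>t. b (t + 2 * pi) = b t" "\<And>t. b t \<ge> 0"
    "(LINT t|circ. b t) = 1/2" "\<And>t. b t > 0 \<Longrightarrow> \<exists>k::int. \<bar>t + of_int k * (2 * pi)\<bar> < \<eta>"
proof -
  define f where "f t = max 0 (cos t - cos \<eta>)" for t
  have fc: "continuous_on S f" for S unfolding f_def[abs_def] by (intro continuous_intros)
  have f0: "f 0 > 0" using cos_monotone_0_pi[of 0 \<eta>] assms by (simp add: f_def)
  define c where "c = (LINT t|circ. f t)"
  have "c = integral {0..2*pi} f" unfolding c_def by (rule LINT_circ_continuous[OF fc])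
  moreover have "integral {0..2*pi} f \<noteq> 0"
  proof
    assume "integral {0..2*pi} f = 0"
    then have "\<forall>x\<in>{0..2*pi}. f x = 0"
      using integral_eq_0_iff[OF fc, of 0 "2 * pi"] by (simp add: f_def)
    then have "f 0 = 0" by simp
    with f0 show False by simp
  qed
  moreover have "c \<ge> 0" unfolding c_def by (rule integral_nonneg_AE) (simp add: f_def)
  ultimately have c: "c > 0" by simp
  define b where "b t = f t / (2 * c)" for t
  show ?thesis
  proof (rule that[of b])
    show "continuous_on UNIV b" unfolding b_def[abs_def] using c by (intro continuous_intros fc) auto
    show "b (t + 2 * pi) = b t" for t by (simp add: b_def f_def)
    show "b t \<ge> 0" for t using c by (simp add: b_def f_def)
    show "(LINT t|circ. b t) = 1/2" using c by (simp add: b_def c_def[symmetric])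
    fix t assume "b t > 0"
    then have ct: "cos t > cos \<eta>" using c by (simp add: b_def f_def zero_less_divide_iff less_max_iff_disj)
    obtain k :: int where k: "\<bar>t + of_int k * (2 * pi)\<bar> \<le> pi" by (rule real_mod_2pi)
    have "\<bar>t + of_int k * (2 * pi)\<bar> < \<eta>"
    proof (rule ccontr)
      assume "\<not> \<bar>t + of_int k * (2 * pi)\<bar> < \<eta>"
      then have "cos \<bar>t + of_int k * (2 * pi)\<bar> \<le> cos \<eta>" using assms k by (intro cos_monotone_0_pi_le) auto
      then show False using ct by (simp add: cos_periodic_int)
    qed
    then show "\<exists>k::int. \<bar>t + of_int k * (2 * pi)\<bar> < \<eta>" by blast
  qed
qed

context frozen_phase
begin

lemma wave_cont: "continuous_on UNIV wave"
  unfolding wave_def[abs_def] by (intro continuous_intros cont)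

text \<open>Half the difference of point masses at \<open>t1\<close> and \<open>t2\<close> would
  give \<open>(wave t1 - wave t2) / 2\<close> with mean zero. Bumps so narrow that the wave varies
  by less than \<epsilon> on each of them lose at most \<epsilon>.\<close>

lemma bump_pairing:
  assumes "\<epsilon> > 0"
  obtains \<phi> where "continuous_on UNIV \<phi>" "\<And>t. \<phi> (t + 2 * pi) = \<phi> t" "(LINT t|circ. \<phi> t) = 0"
    "(LINT t|circ. \<bar>\<phi> t\<bar>) \<le> 1" "(LINT t|circ. \<phi> t * wave t) \<ge> (wave t1 - wave t2) / 2 - \<epsilon>"
proof -
  have near: "\<exists>d>0. \<forall>t. \<bar>t - t0\<bar> < d \<longrightarrow> \<bar>wave t - wave t0\<bar> < \<epsilon>" for t0
    using wave_cont[unfolded continuous_on_iff dist_real_def, rule_format, OF UNIV_I assms, of t0] by simp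
  obtain d1 where d1: "d1 > 0" "\<And>t. \<bar>t - t1\<bar> < d1 \<Longrightarrow> \<bar>wave t - wave t1\<bar> < \<epsilon>" using near[of t1] by blast
  obtain d2 where d2: "d2 > 0" "\<And>t. \<bar>t - t2\<bar> < d2 \<Longrightarrow> \<bar>wave t - wave t2\<bar> < \<epsilon>" using near[of t2] by blast
  define \<eta> where "\<eta> = min (min d1 d2) 1"
  have \<eta>: "0 < \<eta>" "\<eta> < pi" "\<eta> \<le> d1" "\<eta> \<le> d2" using d1 d2 pi_gt3 by (auto simp: \<eta>_def)
  obtain b :: "real \<Rightarrow> real" where b: "continuous_on UNIV b" "\<And>t. b (t + 2 * pi) = b t" "\<And>t. b t \<ge> 0"
    "(LINT t|circ. b t) = 1/2" "\<And>t. b t > 0 \<Longrightarrow> \<exists>k::int. \<bar>t + of_int k * (2 * pi)\<bar> < \<eta>"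
    by (rule exists_bump[OF \<eta>(1,2)], rule that; assumption)
  have bc: "continuous_on UNIV (\<lambda>t. b (t - c))" for c
    by (intro continuous_on_compose2[OF b(1)] continuous_intros) auto
  have bi: "integrable circ (\<lambda>t. b (t - c))" for c by (rule integrable_circ_continuous[OF bc])
  have bL: "(LINT t|circ. b (t - c)) = 1/2" for c
    using LINT_circ_shift[of b "- c", OF b(2,1)] b(4) by simp
  have bwi: "integrable circ (\<lambda>t. b (t - c) * wave t)" for c
    by (intro integrable_circ_continuous continuous_intros bc wave_cont)
  have close: "b (t - c) * \<bar>wave t - wave c\<bar> \<le> b (t - c) * \<epsilon>" if "\<And>t. \<bar>t - c\<bar> < \<eta> \<Longrightarrow> \<bar>wave t - wave c\<bar> < \<epsilon>" for t c
  proof (cases "b (t - c) > 0")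
    case True
    then obtain k :: int where k: "\<bar>t - c + of_int k * (2 * pi)\<bar> < \<eta>" using b(5) by blast
    then have "\<bar>wave (t + of_int k * (2 * pi)) - wave c\<bar> < \<epsilon>" by (intro that) (simp add: algebra_simps)
    then have "\<bar>wave t - wave c\<bar> < \<epsilon>" using periodic_int_multiple[of wave, OF wave_per] by simp
    then show ?thesis using True by (intro mult_left_mono) auto
  next
    case False
    then have "b (t - c) = 0" using b(3)[of "t - c"] by simp
    then show ?thesis by simp
  qed
  define \<phi> where "\<phi> t = b (t - t1) - b (t - t2)" for t
  show ?thesis
  proof (rule that[of \<phi>])
    show "continuous_on UNIV \<phi>" unfolding \<phi>_def[abs_def] by (intro continuous_intros bc)
    show "\<phi> (t + 2 * pi) = \<phi> t" for t
      using b(2)[of "t - t1"] b(2)[of "t - t2"] unfolding \<phi>_def by (simp only: add_diff_eq diff_add_eq)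
    show "(LINT t|circ. \<phi> t) = 0"
      unfolding \<phi>_def by (subst Bochner_Integration.integral_diff[OF bi bi]) (simp only: bL diff_self)
    have "(LINT t|circ. \<bar>\<phi> t\<bar>) \<le> (LINT t|circ. b (t - t1) + b (t - t2))"
    proof (rule integral_mono)
      show "\<bar>\<phi> t\<bar> \<le> b (t - t1) + b (t - t2)" for t
        using abs_triangle_ineq4[of "b (t - t1)" "b (t - t2)"] b(3)[of "t - t1"] b(3)[of "t - t2"] by (simp add: \<phi>_def)
      show "integrable circ (\<lambda>t. \<bar>\<phi> t\<bar>)" "integrable circ (\<lambda>t. b (t - t1) + b (t - t2))"
        unfolding \<phi>_def using bi by simp_all
    qed
    also have "\<dots> = 1" unfolding Bochner_Integration.integral_add[OF bi bi] bL by simp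
    finally show "(LINT t|circ. \<bar>\<phi> t\<bar>) \<le> 1" .
    have 1: "(LINT t|circ. b (t - t1) * wave t) \<ge> (LINT t|circ. b (t - t1) * (wave t1 - \<epsilon>))"
    proof (rule integral_mono)
      fix t
      have "b (t - t1) * (wave t1 - wave t) \<le> b (t - t1) * \<bar>wave t - wave t1\<bar>"
        using b(3) by (intro mult_left_mono) auto
      also have "\<dots> \<le> b (t - t1) * \<epsilon>" using d1 \<eta> by (intro close) auto
      finally show "b (t - t1) * (wave t1 - \<epsilon>) \<le> b (t - t1) * wave t" by (simp add: algebra_simps)
    qed (use bi bwi in auto)
    have 2: "(LINT t|circ. b (t - t2) * wave t) \<le> (LINT t|circ. b (t - t2) * (wave t2 + \<epsilon>))"
    proof (rule integral_mono)
      fix t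
      have "b (t - t2) * (wave t - wave t2) \<le> b (t - t2) * \<bar>wave t - wave t2\<bar>"
        using b(3) by (intro mult_left_mono) auto
      also have "\<dots> \<le> b (t - t2) * \<epsilon>" using d2 \<eta> by (intro close) auto
      finally show "b (t - t2) * wave t \<le> b (t - t2) * (wave t2 + \<epsilon>)" by (simp add: algebra_simps)
    qed (use bi bwi in auto)
    have "(LINT t|circ. \<phi> t * wave t) = (LINT t|circ. b (t - t1) * wave t) - (LINT t|circ. b (t - t2) * wave t)"
      using bwi by (simp add: \<phi>_def left_diff_distrib)
    also have "\<dots> \<ge> (wave t1 - \<epsilon>) / 2 - (wave t2 + \<epsilon>) / 2"
    proof -
      have half: "(LINT t|circ. b (t - c) * w) = 1 / 2 * w" for c w
        unfolding integral_mult_left_zero bL ..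
      show ?thesis using diff_mono[OF 1 2] unfolding half by simp
    qed
    finally show "(LINT t|circ. \<phi> t * wave t) \<ge> (wave t1 - wave t2) / 2 - \<epsilon>"
      by (simp add: diff_divide_distrib add_divide_distrib)
  qed
qed

text \<open>With \<open>Y\<close> frozen at \<open>t0\<close> the wave is a pure cosine with
  amplitude \<open>cmod (Y t0)\<close>. It has a maximum at \<open>t1\<close>, at most one period
  before \<open>t0\<close>, and a minimum half a period after \<open>t1\<close>; hence the distances
  \<open>2 * pi / m\<close> and \<open>3 * pi / m\<close>.\<close>

lemma wave_peaks:
  assumes lip: "\<And>x y. cmod (Y x - Y y) \<le> D * \<bar>x - y\<bar>"
  obtains t1 t2 where "wave t1 \<ge> cmod (Y t0) - D * (2 * pi / m)" "wave t2 \<le> - cmod (Y t0) + D * (3 * pi / m)"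
proof -
  have D: "D \<ge> 0" using order_trans[OF norm_ge_zero lip[of 1 0]] by simp
  define \<alpha> where "\<alpha> = Arg (Y t0)"
  have Y0: "Y t0 = of_real (cmod (Y t0)) * cis \<alpha>"
    unfolding \<alpha>_def using rcis_cmod_Arg[of "Y t0"] by (simp add: rcis_def)
  define k where "k = \<lfloor>(real m * t0 + \<alpha>) / (2 * pi)\<rfloor>"
  define t1 where "t1 = (2 * pi * of_int k - \<alpha>) / m"
  define t2 where "t2 = t1 + pi / m"
  have "of_int k \<le> (real m * t0 + \<alpha>) / (2 * pi)" "(real m * t0 + \<alpha>) / (2 * pi) < of_int k + 1"
    unfolding k_def by linarith+
  then have "t1 \<le> t0" "t0 \<le> t1 + 2 * pi / m" using m0 by (simp_all add: t1_def field_simps)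
  then have d1: "\<bar>t1 - t0\<bar> \<le> 2 * pi / m" by linarith
  have d2: "\<bar>t2 - t0\<bar> \<le> 3 * pi / m"
  proof -
    have "\<bar>t2 - t0\<bar> \<le> \<bar>t1 - t0\<bar> + pi / m" 
      unfolding t2_def using m0 abs_triangle_ineq[of "t1 - t0" "pi / m"] by (simp add: algebra_simps)
    also have "\<dots> \<le> 2 * pi / m + pi / m" using d1 by simp
    also have "\<dots> = 3 * pi / m" by simp
    finally show ?thesis .
  qed
  have w: "\<bar>wave t - Re (Y t0 * cis (real m * t))\<bar> \<le> D * \<bar>t - t0\<bar>" for t
  proof -
    have "\<bar>wave t - Re (Y t0 * cis (real m * t))\<bar> = \<bar>Re ((Y t - Y t0) * cis (real m * t))\<bar>"
      by (simp add: wave_def algebra_simps)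
    also have "\<dots> \<le> cmod (Y t - Y t0)"
      using abs_Re_le_cmod[of "(Y t - Y t0) * cis (real m * t)"] by (simp add: norm_mult)
    finally show ?thesis using lip[of t t0] by linarith
  qed
  have e: "Y t0 * cis (real m * t) = of_real (cmod (Y t0)) * cis (real m * t + \<alpha>)" for t
    by (subst Y0) (simp add: mult.assoc cis_mult add.commute)
  have c1: "real m * t1 + \<alpha> = 0 + of_int k * (2 * pi)" and c2: "real m * t2 + \<alpha> = pi + of_int k * (2 * pi)"
    using m0 by (simp_all add: t1_def t2_def field_simps)
  have v1: "Re (Y t0 * cis (real m * t1)) = cmod (Y t0)"
    unfolding e using cos_periodic_int[of 0 k] c1 by simp
  have v2: "Re (Y t0 * cis (real m * t2)) = - cmod (Y t0)"
    unfolding e using cos_periodic_int[of pi k] c2 by simp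
  show ?thesis
  proof (rule that)
    show "wave t1 \<ge> cmod (Y t0) - D * (2 * pi / m)"
      using w[of t1] v1 mult_left_mono[OF d1 D] by linarith
    show "wave t2 \<le> - cmod (Y t0) + D * (3 * pi / m)"
      using w[of t2] v2 mult_left_mono[OF d2 D] by linarith
  qed
qed

text \<open>The errors at the two peaks add up to \<open>5 * pi * D / m\<close> and enter the
  pairing halved; \<open>5 * pi / 2\<close> is below 8.\<close>

lemma wave_pairing_extremal_L1:
  assumes lip: "\<And>x y. cmod (Y x - Y y) \<le> D * \<bar>x - y\<bar>" and \<epsilon>: "\<epsilon> > 0"
  obtains \<phi> where "continuous_on UNIV \<phi>" "\<And>t. \<phi> (t + 2 * pi) = \<phi> t" "(LINT t|circ. \<phi> t) = 0"
    "(LINT t|circ. \<bar>\<phi> t\<bar>) \<le> 1" "(LINT t|circ. \<phi> t * wave t) \<ge> cmod (Y t0) - 8 * D / m - \<epsilon>"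
proof -
  have D: "D \<ge> 0" using order_trans[OF norm_ge_zero lip[of 1 0]] by simp
  obtain t1 t2 where t: "wave t1 \<ge> cmod (Y t0) - D * (2 * pi / m)" "wave t2 \<le> - cmod (Y t0) + D * (3 * pi / m)"
    by (rule wave_peaks[OF lip])
  obtain \<phi> where \<phi>: "continuous_on UNIV \<phi>" "\<And>t. \<phi> (t + 2 * pi) = \<phi> t" "(LINT t|circ. \<phi> t) = 0"
    "(LINT t|circ. \<bar>\<phi> t\<bar>) \<le> 1" "(LINT t|circ. \<phi> t * wave t) \<ge> (wave t1 - wave t2) / 2 - \<epsilon>"
    by (rule bump_pairing[OF \<epsilon>, of t1 t2], rule that; assumption)
  have "5 * pi * (D / m) \<le> 16 * (D / m)" using D pi_approx by (intro mult_right_mono) auto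
  moreover have "D * (2 * pi / m) + D * (3 * pi / m) = 5 * pi * (D / m)" by (simp add: field_simps)
  moreover have "16 * (D / m) = 2 * (8 * D / m)" by simp
  ultimately have le: "D * (2 * pi / m) + D * (3 * pi / m) \<le> 2 * (8 * D / m)" by linarith
  have mean: "c - z \<le> (a - b) / 2" if "c - x \<le> a" "b \<le> - c + y" "x + y \<le> 2 * z" for a b c x y z :: real
  proof -
    have "(c - x) - (- c + y) \<le> a - b" using that(1,2) by (rule diff_mono)
    then have "2 * (c - z) \<le> a - b" using that(3) by simp
    then show ?thesis by simp
  qed
  have "(wave t1 - wave t2) / 2 \<ge> cmod (Y t0) - 8 * D / m" by (rule mean[OF t le])
  then show ?thesis using \<phi>(5) by (intro that[of \<phi>] \<phi>(1-4)) linarith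
qed

text \<open>For \<open>p = 1\<close> and \<open>s' = 1\<close> the Lipschitz bound on the amplitude loses a factor \<open>1 / (1 - q)\<close>; the
  quadratic bound, whose right-hand side integrates to \<open>2 \<pi> / (1 - q\<^sup>2)\<close>, does not.\<close>

lemma err_1_le_quadratic:
  assumes quad: "\<And>x y. cmod (Y x - Y y) \<le> \<bar>x - y\<bar> * cmod (Y x) * cmod (Y y)"
    and B: "\<And>t. cmod (Y t) \<le> B" and mB: "4 * pi * B \<le> m"
    and S: "(LINT t|circ. (cmod (Y t))\<^sup>2) \<le> S"
  shows "err 1 \<le> 4 * pi / m * S"
proof -
  have b: "cmod (Y t - step t) \<le> 4 * pi / m * (cmod (Y t))\<^sup>2" for t
  proof -
    define y s d where "y = cmod (Y t)" and "s = cmod (step t)" and "d = 2 * pi / m"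
    have ys: "y \<ge> 0" "s \<ge> 0" "d \<ge> 0" "y \<le> B" using B by (auto simp: y_def s_def d_def)
    have a: "cmod (Y t - step t) \<le> d * y * s"
    proof -
      have "cmod (Y t - step t) \<le> \<bar>t - 2 * pi * of_int \<lfloor>real m * t / (2 * pi)\<rfloor> / real m\<bar> * y * s"
        using quad[of t "2 * pi * of_int \<lfloor>real m * t / (2 * pi)\<rfloor> / real m"] by (simp add: step_def y_def s_def)
      also have "\<dots> \<le> d * y * s" unfolding d_def using step_dist[of t] ys by (intro mult_right_mono) auto
      finally show ?thesis .
    qed
    \<comment> \<open>For \<open>m\<close> this large, \<open>Y\<close> and its frozen value differ
      by at most half of the latter. So \<open>s \<le> 2 * y\<close>, and the product of both moduli
      is dominated by the integrable square of one of them.\<close>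
    have "d * y \<le> d * B" using ys by (intro mult_left_mono) auto
    also have "\<dots> \<le> 1/2" using mB m0 by (simp add: d_def field_simps)
    finally have "d * y * s \<le> 1/2 * s" using ys by (intro mult_right_mono) auto
    moreover have "s \<le> y + cmod (Y t - step t)"
      using norm_triangle_ineq2[of "step t" "Y t"] by (simp add: y_def s_def norm_minus_commute)
    ultimately have "s \<le> 2 * y" using a by linarith
    then have "d * y * s \<le> d * y * (2 * y)" using ys by (intro mult_left_mono) auto
    then have "cmod (Y t - step t) \<le> d * y * (2 * y)" using a by linarith
    also have "d * y * (2 * y) = 4 * pi / m * y\<^sup>2" by (simp add: d_def power2_eq_square)
    finally show ?thesis by (simp add: y_def)
  qed
  have i: "integrable circ (\<lambda>t. (cmod (Y t))\<^sup>2)"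
    by (intro integrable_circ_continuous continuous_intros cont)
  have "err 1 = (LINT t|circ. cmod (Y t - step t))" by (simp add: err_def Lr_norm_def)
  also have "\<dots> \<le> (LINT t|circ. 4 * pi / m * (cmod (Y t))\<^sup>2)"
    by (intro integral_mono bdd_borel_integrable[OF bdd_diff] integrable_mult_right i b)
  also have "\<dots> = 4 * pi / m * (LINT t|circ. (cmod (Y t))\<^sup>2)" by (rule integral_mult_right_zero)
  also have "\<dots> \<le> 4 * pi / m * S" using S by (intro mult_left_mono) auto
  finally show ?thesis .
qed

end

section \<open>The deviation kernel as a wave\<close>

text \<open>The lower and upper bounds make \<open>V\<close> finite, and the bounded quantity
  \<open>r\<close> is obtained by solving the asserted equation; this divides by the error weight
  \<open>e\<close>, which must be positive.\<close>

lemma ereal_sandwich: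
  fixes Q X M e K :: real
  assumes Q: "Q > 0" and e: "e > 0" and M: "M > 0" and lo: "ereal (Q * (X - K * e / M)) \<le> V" and up: "V \<le> ereal (Q * (X + K * e / M))"
  shows "\<exists>r. \<bar>r\<bar> \<le> K \<and> V = ereal (Q * (X + r / M * e))"
proof -
  obtain v where v: "V = ereal v" using lo up by (cases V) auto
  define r where "r = (v / Q - X) * M / e"
  have 1: "Q * (X - K * e / M) \<le> v" "v \<le> Q * (X + K * e / M)" using lo up by (auto simp: v)
  have "X - K * e / M \<le> v / Q" "v / Q \<le> X + K * e / M"
    using 1 Q by (simp_all add: pos_le_divide_eq pos_divide_le_eq mult.commute)
  then have "\<bar>v / Q - X\<bar> \<le> K * e / M" by (simp add: abs_le_iff)
  then have "\<bar>v / Q - X\<bar> * M \<le> K * e" using M by (simp add: pos_le_divide_eq)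
  then have "\<bar>r\<bar> \<le> K" using M e by (simp add: r_def abs_mult abs_divide pos_divide_le_eq)
  moreover have "v = Q * (X + r / M * e)" using Q M e by (simp add: r_def)
  ultimately show ?thesis using v by blast
qed

definition kernel_wave :: "real \<Rightarrow> real \<Rightarrow> nat \<Rightarrow> nat \<Rightarrow> real \<Rightarrow> real \<Rightarrow> real" where
  "kernel_wave q \<beta> p m x t = Re (cis (real m * (x - t) - \<beta> * pi / 2) * vp_mult q p (x - t))"

text \<open>The kernel is evaluated at \<open>x - t\<close>, which reverses the direction of the
  wave. Complex conjugation restores the positive frequency \<open>m t\<close>, and the constants
  from \<beta> and \<open>x\<close> go into a unimodular factor.\<close>

definition kernel_amp :: "real \<Rightarrow> real \<Rightarrow> nat \<Rightarrow> nat \<Rightarrow> real \<Rightarrow> real \<Rightarrow> complex" where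
  "kernel_amp q \<beta> p m x t = cis (\<beta> * pi / 2 - real m * x) * cnj (vp_mult q p (x - t))"

lemma cmod_kernel_amp: "cmod (kernel_amp q \<beta> p m x t) = cmod (vp_mult q p (x - t))"
  by (simp add: kernel_amp_def norm_mult)

definition amp_bound :: "real \<Rightarrow> nat \<Rightarrow> real" where
  "amp_bound q p = (if p = 1 then 1 / (1 - q) else 2 / (1 - q)\<^sup>2)"

definition rem_bound :: "real \<Rightarrow> nat \<Rightarrow> real" where
  "rem_bound q p = q / (1 - q)\<^sup>2 * min (real p) (1 / (1 - q))"

lemma kernel_wave_conj:
  "kernel_wave q \<beta> p m x t = Re (kernel_amp q \<beta> p m x t * cis (real m * t))"
proof -
  have "cnj (cis (real m * (x - t) - \<beta> * pi / 2) * vp_mult q p (x - t)) =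
      cis (\<beta> * pi / 2 - real m * x) * cis (real m * t) * cnj (vp_mult q p (x - t))"
    by (simp add: cis_cnj cis_mult) (simp add: algebra_simps)
  then show ?thesis unfolding kernel_wave_def kernel_amp_def
    by (metis complex_cnj(1) cnj.simps(1) mult.assoc mult.commute)
qed

context
  fixes q :: real and p m :: nat and \<beta> :: real
  assumes q: "0 < q" "q < 1" and p: "p \<ge> 1" and m: "m \<ge> 1"
begin

lemma rem_bound_nonneg: "rem_bound q p \<ge> 0" using q by (simp add: rem_bound_def)

lemma kernel_wave_cont: "continuous_on UNIV (kernel_wave q \<beta> p m x)"
  unfolding kernel_wave_def[abs_def]
  by (intro continuous_intros continuous_on_compose2[OF vp_mult_cont[OF q p]]) auto

lemma kernel_wave_bound: "\<bar>kernel_wave q \<beta> p m x t\<bar> \<le> cmod (vp_mult q p (x - t))"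
  unfolding kernel_wave_def
  using abs_Re_le_cmod[of "cis (real m * (x - t) - \<beta> * pi / 2) * vp_mult q p (x - t)"] by (simp add: norm_mult)

lemma pairing_split:
  assumes \<phi>: "integrable circ \<phi>"
  shows "\<bar>(LINT t|circ. \<phi> t * vp_kernel q \<beta> m p (x - t)) -
      q ^ m / (real p * real m) * (LINT t|circ. \<phi> t * kernel_wave q \<beta> p m x t)\<bar>
    \<le> q ^ m / (real p * real m) * (2 * rem_bound q p / m) * (LINT t|circ. \<bar>\<phi> t\<bar>)"
proof -
  define Q where "Q = q ^ m / (real p * real m)"
  define \<rho> where "\<rho> = Q * (2 * rem_bound q p / m)"
  have Q: "Q \<ge> 0" using q by (simp add: Q_def)
  have kc: "continuous_on UNIV (\<lambda>t. vp_kernel q \<beta> m p (x - t))"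
    by (intro continuous_on_compose2[OF continuous_vp_kernel[OF q]] continuous_intros) auto
  define R where "R t = vp_kernel q \<beta> m p (x - t) - Q * kernel_wave q \<beta> p m x t" for t
  have Rc: "continuous_on UNIV R" unfolding R_def[abs_def] by (intro continuous_intros kc kernel_wave_cont)
  have Rb: "\<bar>R t\<bar> \<le> \<rho>" for t
    using vp_kernel_approx[OF q p m, of \<beta> "x - t"] unfolding R_def kernel_wave_def Q_def \<rho>_def rem_bound_def by simp
  have wi: "integrable circ (\<lambda>t. \<phi> t * kernel_wave q \<beta> p m x t)"
    by (rule integrable_mult_bounded_continuous[OF \<phi> kernel_wave_cont, of _ "amp_bound q p"])
      (rule order_trans[OF kernel_wave_bound vp_mult_bound[OF q p, folded amp_bound_def]])
  have Ri: "integrable circ (\<lambda>t. \<phi> t * R t)"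
    by (rule integrable_mult_bounded_continuous[OF \<phi> Rc Rb])
  have "(LINT t|circ. \<phi> t * vp_kernel q \<beta> m p (x - t)) = (LINT t|circ. Q * (\<phi> t * kernel_wave q \<beta> p m x t) + \<phi> t * R t)"
    by (rule arg_cong[where f = "integral\<^sup>L circ"]) (simp add: R_def algebra_simps)
  also have "\<dots> = Q * (LINT t|circ. \<phi> t * kernel_wave q \<beta> p m x t) + (LINT t|circ. \<phi> t * R t)"
    by (subst Bochner_Integration.integral_add[OF integrable_mult_right[OF wi] Ri]) simp
  finally have e: "(LINT t|circ. \<phi> t * vp_kernel q \<beta> m p (x - t)) - Q * (LINT t|circ. \<phi> t * kernel_wave q \<beta> p m x t) = (LINT t|circ. \<phi> t * R t)"
    by simp
  have "\<bar>LINT t|circ. \<phi> t * R t\<bar> \<le> (LINT t|circ. \<rho> * \<bar>\<phi> t\<bar>)"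
  proof (rule integral_abs_bound[THEN order_trans], rule integral_mono)
    show "\<bar>\<phi> t * R t\<bar> \<le> \<rho> * \<bar>\<phi> t\<bar>" for t
      unfolding abs_mult using Rb[of t] by (subst mult.commute) (intro mult_right_mono, auto)
  qed (use Ri \<phi> in auto)
  also have "\<dots> = \<rho> * (LINT t|circ. \<bar>\<phi> t\<bar>)" by (rule integral_mult_right_zero)
  finally show ?thesis unfolding e[unfolded Q_def] \<rho>_def Q_def .
qed

lemma frozen_phase_kernel: "frozen_phase (kernel_amp q \<beta> p m x) m"
proof
  show "kernel_amp q \<beta> p m x (t + 2 * pi) = kernel_amp q \<beta> p m x t" for t
    using vp_mult_per[OF q p, of "x - (t + 2 * pi)"] by (simp add: kernel_amp_def)
  show "continuous_on UNIV (kernel_amp q \<beta> p m x)"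
    unfolding kernel_amp_def[abs_def]
    by (intro continuous_intros continuous_on_compose2[OF vp_mult_cont[OF q p]]) auto
qed (rule m)

lemma frozen_wave_kernel:
  "frozen_phase.wave (kernel_amp q \<beta> p m x) m = kernel_wave q \<beta> p m x"
  by (rule ext) (simp add: frozen_phase.wave_def[OF frozen_phase_kernel] kernel_wave_conj)

lemma kernel_amp_diff:
  "cmod (kernel_amp q \<beta> p m x s - kernel_amp q \<beta> p m x t)
   = cmod (vp_mult q p (x - s) - vp_mult q p (x - t))"
  by (simp add: kernel_amp_def norm_mult flip: right_diff_distrib complex_cnj_diff)

lemma kernel_lipschitz:
  "cmod (kernel_amp q \<beta> p m x s - kernel_amp q \<beta> p m x t)
   \<le> 3 / (1 - q) * amp_bound q p * \<bar>s - t\<bar>"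
  unfolding kernel_amp_diff using vp_mult_lipschitz[OF q p, of "x - s" "x - t"]
  by (simp add: amp_bound_def abs_minus_commute)

lemma Lr_norm_kernel_amp:
  assumes r: "r > 0"
  shows "Lr_norm r (\<lambda>t. cmod (kernel_amp q \<beta> p m x t)) = Lr_norm r (\<lambda>t. cmod (vp_mult q p t))"
proof -
  have "continuous_on UNIV (\<lambda>t. \<bar>cmod (vp_mult q p t)\<bar> powr r)"
    using r by (intro continuous_on_powr' continuous_intros vp_mult_cont[OF q p]) auto
  from LINT_circ_reflect[of "\<lambda>t. \<bar>cmod (vp_mult q p t)\<bar> powr r", OF _ this, of x]
  show ?thesis by (simp add: Lr_norm_def cmod_kernel_amp vp_mult_per[OF q p])
qed

text \<open>This product of the rate of change and the maximum of the amplitude governs both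
  freezing schemes. The 6 is \<open>3 * 2\<close>, from the case \<open>p > 1\<close>.\<close>

lemma amp_rate_le:
  "3 / (1 - q) * amp_bound q p \<le> 6 / (1 - q) ^ gamma_exp p"
proof (cases "p = 1")
  case True
  have "3 / (1 - q) * amp_bound q p = 3 / (1 - q) ^ 2" using True by (simp add: amp_bound_def power2_eq_square)
  also have "\<dots> \<le> 6 / (1 - q) ^ 2" using q by (intro divide_right_mono) auto
  finally show ?thesis using True by (simp add: gamma_exp_def)
next
  case False
  then show ?thesis by (simp add: amp_bound_def gamma_exp_def power2_eq_square power3_eq_cube mult.assoc)
qed

text \<open>On functions bounded by \<open>\<omega> pi\<close> the kernel remainder produces
  \<open>rem_bound q p * \<omega> pi\<close>. This inequality absorbs it into the first error term
  for \<open>H_class \<omega>\<close>.\<close>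

lemma rem_bound_le: "rem_bound q p \<le> 1 / (1 - q) ^ gamma_exp p"
proof (cases "p = 1")
  case True
  have "q / (1 - q)\<^sup>2 * min (real p) (1 / (1 - q)) \<le> 1 / (1 - q)\<^sup>2 * 1"
    using q True by (intro mult_mono divide_right_mono) auto
  then show ?thesis using True by (simp add: rem_bound_def gamma_exp_def)
next
  case False
  have "q / (1 - q)\<^sup>2 * min (real p) (1 / (1 - q)) \<le> 1 / (1 - q)\<^sup>2 * (1 / (1 - q))"
    using q by (intro mult_mono divide_right_mono) auto
  then show ?thesis using False by (simp add: rem_bound_def gamma_exp_def power2_eq_square power3_eq_cube)
qed

text \<open>In general the Lipschitz estimate yields \<open>48 * 6 = 288\<close>. For
  \<open>p = 1\<close> and \<open>r = 1\<close> the amplitude is \<open>1 / (1 - z)\<close>, and a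
  difference of two of its values is the difference of the points \<open>z\<close> times the product
  of the two values; the quadratic estimate then saves one power of
  \<open>1 / (1 - q)\<close>.\<close>

lemma frozen_err_le:
  assumes r: "r \<ge> 1" and m13: "13 / (1 - q) \<le> m" and \<sigma>: "\<sigma> = (if p = 1 then (if r = 1 then 1 else 2) else 3)"
  shows "frozen_phase.err (kernel_amp q \<beta> p m x) m r \<le> 288 / (1 - q) ^ \<sigma> / m"
proof -
  interpret frozen_phase "kernel_amp q \<beta> p m x" m
    by (rule frozen_phase_kernel)
  show ?thesis
  proof (cases "p = 1 \<and> r = 1")
    case False
    have "err r \<le> 48 * (3 / (1 - q) * amp_bound q p) / m"
      by (rule err_le_lipschitz[OF r kernel_lipschitz])
    also have "\<dots> \<le> 48 * (6 / (1 - q) ^ gamma_exp p) / m"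
      using amp_rate_le by (intro divide_right_mono mult_left_mono) auto
    also have "gamma_exp p = \<sigma>" using False by (auto simp: gamma_exp_def \<sigma>)
    finally show ?thesis by simp
  next
    case True
    then have p1: "p = 1" and r1: "r = 1" by auto
    have "err 1 \<le> 4 * pi / m * (2 * pi / (1 - q\<^sup>2))"
    proof (rule err_1_le_quadratic[where B = "1 / (1 - q)"])
      fix s t
      have Z: "vp_mult q p u = 1 / (1 - of_real q * cis u)" for u
        using one_minus_z(2)[OF q p, of u] by (simp add: vp_mult_def power2_eq_square p1)
      have "vp_mult q p (x - s) - vp_mult q p (x - t) =
          of_real q * (cis (x - s) - cis (x - t)) * (vp_mult q p (x - s) * vp_mult q p (x - t))"
        unfolding Z using one_minus_z(2)[OF q p, of "x - s"] one_minus_z(2)[OF q p, of "x - t"] by (simp add: field_simps)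
      then have "cmod (vp_mult q p (x - s) - vp_mult q p (x - t)) = q * cmod (cis (x - s) - cis (x - t)) * (cmod (vp_mult q p (x - s)) * cmod (vp_mult q p (x - t)))"
        using q by (simp add: norm_mult)
      also have "\<dots> \<le> 1 * \<bar>s - t\<bar> * (cmod (vp_mult q p (x - s)) * cmod (vp_mult q p (x - t)))"
      proof (intro mult_right_mono mult_mono)
        have "cmod (cis (x - s) - cis (x - t)) \<le> 1 * norm ((x - s) - (x - t))"
        proof (rule differentiable_bound[of UNIV cis "\<lambda>u h. h *\<^sub>R (\<i> * cis u)"])
          fix u
          have "((\<lambda>u. exp (\<i> * of_real u)) has_vector_derivative (exp (\<i> * of_real u) * \<i>)) (at u within UNIV)"
            by (auto intro!: derivative_eq_intros has_vector_derivative_real_field simp: mult_ac)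
          then have "(cis has_vector_derivative \<i> * cis u) (at u within UNIV)"
            by (simp add: cis_conv_exp[abs_def] mult.commute)
          then show "(cis has_derivative (\<lambda>h. h *\<^sub>R (\<i> * cis u))) (at u within UNIV)"
            by (simp add: has_vector_derivative_def)
          show "onorm (\<lambda>h. h *\<^sub>R (\<i> * cis u)) \<le> 1"
            by (rule onorm_le) (simp add: norm_mult)
        qed auto
        then show "cmod (cis (x - s) - cis (x - t)) \<le> \<bar>s - t\<bar>" by (simp add: abs_minus_commute)
      qed (use q in auto)
      finally show "cmod (kernel_amp q \<beta> p m x s - kernel_amp q \<beta> p m x t)
          \<le> \<bar>s - t\<bar> * cmod (kernel_amp q \<beta> p m x s) * cmod (kernel_amp q \<beta> p m x t)"
        unfolding kernel_amp_diff cmod_kernel_amp by (simp add: mult.assoc)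
    next
      fix t
      show "cmod (kernel_amp q \<beta> p m x t) \<le> 1 / (1 - q)"
        using vp_mult_bound[OF q p, of "x - t"] by (simp add: cmod_kernel_amp p1)
    next
      have "4 * pi * (1 / (1 - q)) \<le> 13 * (1 / (1 - q))" using q pi_approx by (intro mult_right_mono) auto
      also have "\<dots> \<le> m" using m13 by simp
      finally show "4 * pi * (1 / (1 - q)) \<le> m" .
    next
      show "(LINT t|circ. (cmod (kernel_amp q \<beta> p m x t))\<^sup>2) \<le> 2 * pi / (1 - q\<^sup>2)"
        using LINT_cmod_vp_mult_1_square[OF q, of x] by (simp add: cmod_kernel_amp p1)
    qed
    also have "\<dots> = (8 * pi\<^sup>2) * (1 / (1 - q\<^sup>2)) / m" by (simp add: power2_eq_square)
    also have "\<dots> \<le> 288 * (1 / (1 - q)) / m"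
    proof (intro divide_right_mono mult_mono)
      have "pi\<^sup>2 \<le> 3.2\<^sup>2" using pi_approx by (intro power_mono) auto
      then show "8 * pi\<^sup>2 \<le> 288" by (simp add: power2_eq_square)
      have "q\<^sup>2 \<le> q" using q by (simp add: power2_eq_square mult_left_le_one_le)
      then show "1 / (1 - q\<^sup>2) \<le> 1 / (1 - q)" using q by (intro divide_left_mono mult_pos_pos) (auto simp: power_less_one_iff)
      show "0 \<le> 1 / (1 - q\<^sup>2)" using q by (simp add: power_le_one)
    qed auto
    finally show ?thesis using p1 r1 by (simp add: \<sigma>)
  qed
qed

text \<open>The logarithm of \<open>kernel_amp\<close> is the conjugate of \<open>vp_log\<close>
  plus an imaginary constant for the unimodular factor. The hypothesis
  \<open>6 / (1 - q) \<le> m\<close> is the condition \<open>\<Lambda> \<le> m / 2\<close> for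
  \<open>\<Lambda> = 3 / (1 - q)\<close>.\<close>

lemma slow_phase_kernel:
  assumes m6: "6 / (1 - q) \<le> m"
  shows "slow_phase (\<lambda>t. cnj (vp_log q p (x - t)) + \<i> * of_real (\<beta> * pi / 2 - real m * x)) (\<lambda>t. - cnj (vp_log' q p (x - t))) m
     (3 / (1 - q)) (amp_bound q p)"
proof
  fix t
  show "cnj (vp_log q p (x - (t + 2 * pi))) + \<i> * of_real (\<beta> * pi / 2 - real m * x) = cnj (vp_log q p (x - t)) + \<i> * of_real (\<beta> * pi / 2 - real m * x)"
    using vp_log_per[OF q p, of "x - (t + 2 * pi)"] by simp
  have "((\<lambda>t. x - t) has_vector_derivative -1) (at t)"
    by (auto intro!: derivative_eq_intros)
  from vector_diff_chain_at[OF this vp_log_deriv[OF q p]]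
  have "((\<lambda>t. vp_log q p (x - t)) has_vector_derivative - vp_log' q p (x - t)) (at t)"
    by (simp add: o_def)
  from bounded_linear.has_vector_derivative[OF bounded_linear_cnj this]
  have "((\<lambda>t. cnj (vp_log q p (x - t))) has_vector_derivative - cnj (vp_log' q p (x - t))) (at t)" by simp
  then show "((\<lambda>t. cnj (vp_log q p (x - t)) + \<i> * of_real (\<beta> * pi / 2 - real m * x)) has_vector_derivative - cnj (vp_log' q p (x - t))) (at t)"
    using has_vector_derivative_add[OF _ has_vector_derivative_const] by fastforce
  show "cmod (- cnj (vp_log' q p (x - t))) \<le> 3 / (1 - q)" using vp_log'_bound[OF q p] by simp
  show "cmod (exp (cnj (vp_log q p (x - t)) + \<i> * of_real (\<beta> * pi / 2 - real m * x))) \<le> amp_bound q p"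
    using vp_mult_bound[OF q p, of "x - t"]
    by (simp add: exp_add norm_mult exp_cnj[symmetric] exp_vp_log[OF q p] amp_bound_def flip: of_real_mult of_real_diff)
next
  show "continuous_on UNIV (\<lambda>t. - cnj (vp_log' q p (x - t)))"
    by (intro continuous_intros continuous_on_compose2[OF vp_log'_cont[OF q p]]) auto
  show "3 / (1 - q) \<le> real m / 2" using m6 by simp
qed (rule m)

end

section \<open>Asymptotic equalities\<close>

lemma fourier_a_0: "fourier_a \<phi> 0 = (LINT t|circ. \<phi> t) / pi"
  by (simp add: fourier_a_def)

lemma C_class_iff:
  "f \<in> C_class \<psi> \<beta> N \<longleftrightarrow> f \<in> C_per \<and> f \<in> Ls 1 \<and> (\<exists>\<phi>\<in>N. is_psi_beta_derivative \<psi> \<beta> f \<phi>)"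
  by (auto simp: C_class_def L_class_def)

text \<open>By the convolution formula it is enough to bound all pairings of the kernel with
  mean-zero members of \<open>N\<close> and to exhibit one good pairing at \<open>x = 0\<close>,
  since every integrable mean-zero function is the derivative of some \<open>f\<close>.
  \<open>N\<close> is abstract so that all classes share this reduction.\<close>

lemma VP_error_sandwich:
  fixes q \<beta> X e K :: real
  assumes q: "0 < q" "q < 1" and p: "1 \<le> p" "p \<le> n" and e: "e > 0"
  defines "m \<equiv> n - p + 1"
  defines "Q \<equiv> q ^ m / (real p * real m)"
  assumes up: "\<And>\<phi> x. \<phi> \<in> N \<Longrightarrow> \<phi> \<in> Ls 1 \<Longrightarrow> (LINT t|circ. \<phi> t) = 0 \<Longrightarrow>
      \<bar>LINT t|circ. \<phi> t * vp_kernel q \<beta> m p (x - t)\<bar> / pi \<le> Q * (X + K * e / m)"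
    and lo: "\<phi>0 \<in> N" "\<phi>0 \<in> Ls 1" "(LINT t|circ. \<phi>0 t) = 0"
      "(LINT t|circ. \<phi>0 t * vp_kernel q \<beta> m p (0 - t)) / pi \<ge> Q * (X - K * e / m)"
  shows "\<exists>r. \<bar>r\<bar> \<le> K \<and> VP_error (C_class (neumann_psi q) \<beta> N) n p = ereal (Q * (X + r / m * e))"
proof (rule ereal_sandwich[OF _ e])
  show "Q > 0" "real m > 0" using q p by (simp_all add: Q_def m_def)
  have err: "\<bar>f x - vallee_poussin n p f x\<bar> \<le> Q * (X + K * e / m)" if fC: "f \<in> C_class (neumann_psi q) \<beta> N" for f x
  proof -
    obtain \<phi> where f: "f \<in> C_per" and \<phi>: "\<phi> \<in> N" "is_psi_beta_derivative (neumann_psi q) \<beta> f \<phi>"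
      using fC unfolding C_class_iff by blast
    have "\<phi> \<in> Ls 1" "(LINT t|circ. \<phi> t) = 0" using \<phi>(2) by (auto simp: is_psi_beta_derivative_def fourier_a_0)
    from up[OF \<phi>(1) this, of x] show ?thesis
      using vp_error_eq_LINT(2)[OF q p f \<phi>(2), of x] by (simp add: m_def abs_divide)
  qed
  show "VP_error (C_class (neumann_psi q) \<beta> N) n p \<le> ereal (Q * (X + K * e / m))"
    unfolding VP_error_def by (rule SUP_least) (simp add: C_norm_bounded_le err)
  obtain f where f: "f \<in> C_per" "f \<in> Ls 1" "is_psi_beta_derivative (neumann_psi q) \<beta> f \<phi>0"
    using exists_psi_beta_integral[OF q lo(2,3)] by metis
  have fc: "f \<in> C_class (neumann_psi q) \<beta> N" using f lo(1) by (auto simp: C_class_iff)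
  have "Q * (X - K * e / m) \<le> f 0 - vallee_poussin n p f 0"
    using lo(4) vp_error_eq_LINT(2)[OF q p f(1,3), of 0] by (simp add: m_def)
  also have "\<dots> \<le> \<bar>f 0 - vallee_poussin n p f 0\<bar>" by simp
  \<comment> \<open>The value at 0 is below the supremum norm because the upper estimate, already
    proved for the whole class, makes the deviation bounded.\<close>
  also have "\<dots> \<le> C_norm (\<lambda>x. f x - vallee_poussin n p f x)"
    by (rule le_C_norm[of "\<lambda>x. f x - vallee_poussin n p f x", OF err[OF fc]])
  finally have "ereal (Q * (X - K * e / m)) \<le> ereal (C_norm (\<lambda>x. f x - vallee_poussin n p f x))" by simp
  also have "\<dots> \<le> VP_error (C_class (neumann_psi q) \<beta> N) n p"
    unfolding VP_error_def by (rule SUP_upper[OF fc])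
  finally show "ereal (Q * (X - K * e / m)) \<le> VP_error (C_class (neumann_psi q) \<beta> N) n p" .
qed

section \<open>The classes \<open>U0 s\<close> as dual balls, and the main term\<close>

lemma Ls_norm_eq_Nr: "s \<noteq> \<infinity> \<Longrightarrow> Ls_norm s f = Lr_norm (enn2real s) f"
  by (simp add: Ls_norm_def Lr_norm_def)

lemma U0_infinity_iff:
  "\<phi> \<in> U0 \<infinity> \<longleftrightarrow> periodic2pi \<phi> \<and> \<phi> \<in> borel_measurable lebesgue \<and> dual_ball 1 \<phi> \<and> (LINT t|circ. \<phi> t) = 0"
proof -
  have "(esssup circ (\<lambda>t. ennreal \<bar>\<phi> t\<bar>) < \<infinity> \<and> Ls_norm \<infinity> \<phi> \<le> 1) \<longleftrightarrow> dual_ball 1 \<phi>"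
    if "\<phi> \<in> borel_measurable lebesgue"
  proof -
    define e where "e = esssup circ (\<lambda>t. ennreal \<bar>\<phi> t\<bar>)"
    have meas: "\<phi> \<in> borel_measurable circ" by (rule borel_measurable_circ[OF that])
    have meas': "(\<lambda>t. ennreal \<bar>\<phi> t\<bar>) \<in> borel_measurable circ" using meas by measurable
    have "AE t in circ. \<bar>\<phi> t\<bar> \<le> 1" if "e < \<infinity>" "enn2real e \<le> 1"
    proof -
      have "e = ennreal (enn2real e)" using that(1) by simp
      also have "\<dots> \<le> ennreal 1" using that(2) by (rule ennreal_leI)
      finally have "e \<le> ennreal 1" .
      have ae: "AE t in circ. ennreal \<bar>\<phi> t\<bar> \<le> e" unfolding e_def by (rule esssup_AE)
      have "\<bar>\<phi> t\<bar> \<le> 1" if "ennreal \<bar>\<phi> t\<bar> \<le> e" for t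
        using order_trans[OF that \<open>e \<le> ennreal 1\<close>] by (subst (asm) ennreal_le_iff) simp_all
      then show ?thesis using ae by (rule eventually_mono[rotated])
    qed
    moreover have "e < \<infinity> \<and> enn2real e \<le> 1" if "AE t in circ. \<bar>\<phi> t\<bar> \<le> 1"
    proof -
      have "AE t in circ. ennreal \<bar>\<phi> t\<bar> \<le> ennreal 1"
        using that by (rule eventually_mono) (rule ennreal_leI)
      then have e: "e \<le> ennreal 1" unfolding e_def by (rule esssup_I[OF meas'])
      have "e < \<infinity>" by (rule le_less_trans[OF e]) simp
      moreover have "enn2real e \<le> enn2real (ennreal 1)" by (rule enn2real_mono[OF e]) simp
      ultimately show ?thesis by simp
    qed
    ultimately show ?thesis using meas unfolding dual_ball_def Ls_norm_def e_def[symmetric] by auto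
  qed
  then show ?thesis unfolding U0_def Ls_def by auto
qed

lemma U0_finite_iff:
  assumes a: "a > 1"
  shows "\<phi> \<in> U0 (ennreal a) \<longleftrightarrow> periodic2pi \<phi> \<and> \<phi> \<in> borel_measurable lebesgue \<and> dual_ball (a / (a - 1)) \<phi> \<and> (LINT t|circ. \<phi> t) = 0"
proof -
  have "(c + 1) / c - 1 = 1 / c" if "c \<noteq> 0" for c :: real using that by (simp add: add_divide_distrib)
  from this[of "a - 1"] have d: "a / (a - 1) - 1 = 1 / (a - 1)" using a by simp
  have r: "a / (a - 1) \<noteq> 1" "(a / (a - 1)) / (a / (a - 1) - 1) = a"
  proof -
    show "a / (a - 1) \<noteq> 1" using a by (simp add: divide_eq_1_iff)
    show "(a / (a - 1)) / (a / (a - 1) - 1) = a" unfolding d using a by simp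
  qed
  define I where "I = (LINT t|circ. \<bar>\<phi> t\<bar> powr a)"
  have I: "I \<ge> 0" unfolding I_def by (rule integral_nonneg_AE) simp
  have pw: "I powr (1 / a) \<le> 1 \<longleftrightarrow> I \<le> 1"
  proof
    assume "I powr (1 / a) \<le> 1"
    then have "(I powr (1 / a)) powr a \<le> 1 powr a" using a by (intro powr_mono2) simp_all
    moreover have "(I powr (1 / a)) powr a = I" using a I by (simp add: powr_powr)
    ultimately show "I \<le> 1" by simp
  next
    assume "I \<le> 1"
    then have "I powr (1 / a) \<le> 1 powr (1 / a)" using a I by (intro powr_mono2) simp_all
    then show "I powr (1 / a) \<le> 1" by simp
  qed
  have ea: "enn2real (ennreal a) = a" "ennreal a \<noteq> \<infinity>" using a by simp_all
  have 1: "Ls_norm (ennreal a) \<phi> = I powr (1 / a)" unfolding Ls_norm_def I_def ea(1) using ea(2) by simp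
  have 2: "\<phi> \<in> Ls (ennreal a) \<longleftrightarrow> periodic2pi \<phi> \<and> \<phi> \<in> borel_measurable lebesgue \<and> integrable circ (\<lambda>t. \<bar>\<phi> t\<bar> powr a)"
    unfolding Ls_def ea(1) using ea(2) by simp
  have 3: "dual_ball (a / (a - 1)) \<phi> \<longleftrightarrow> \<phi> \<in> borel_measurable circ \<and> integrable circ (\<lambda>t. \<bar>\<phi> t\<bar> powr a) \<and> I \<le> 1"
    unfolding dual_ball_def r(2) I_def using r(1) by simp
  have 4: "\<phi> \<in> borel_measurable lebesgue \<Longrightarrow> \<phi> \<in> borel_measurable circ" by (rule borel_measurable_circ)
  show ?thesis
    unfolding U0_def mem_Collect_eq 1 2 3 pw using 4 by (metis (no_types))
qed

lemma U0_1_iff: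
  "\<phi> \<in> U0 1 \<longleftrightarrow> \<phi> \<in> Ls 1 \<and> (LINT t|circ. \<bar>\<phi> t\<bar>) \<le> 1 \<and> (LINT t|circ. \<phi> t) = 0"
proof -
  have "Ls_norm 1 \<phi> = (LINT t|circ. \<bar>\<phi> t\<bar>)"
    by (simp add: Ls_norm_def)
  then show ?thesis by (auto simp: U0_def)
qed

lemma conj_exponent_dual_ball:
  assumes s: "1 < s"
  obtains r where "r \<ge> 1" "conj_exponent s = ennreal r"
    "\<And>\<phi>. \<phi> \<in> U0 s \<longleftrightarrow> periodic2pi \<phi> \<and> \<phi> \<in> borel_measurable lebesgue \<and> dual_ball r \<phi> \<and> (LINT t|circ. \<phi> t) = 0"
proof (cases s)
  case (real a)
  then have a: "a > 1" using s by (metis ennreal_1 ennreal_less_iff zero_le_one)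
  have "conj_exponent s = ennreal (a / (a - 1))"
  proof -
    have "s - 1 = ennreal (a - 1)" using real(2) ennreal_minus[of 1 a] by simp
    then have "s / (s - 1) = ennreal (a / (a - 1))" using real(2) a by (simp add: divide_ennreal)
    then show ?thesis using s real(2) by (simp add: conj_exponent_def)
  qed
  moreover have "a / (a - 1) \<ge> 1" using a by simp
  ultimately show ?thesis using that[of "a / (a - 1)"] U0_finite_iff[OF a] real(2) by simp
next
  case top
  then have "conj_exponent s = ennreal 1" by (simp add: conj_exponent_def)
  then show ?thesis using that[of 1] U0_infinity_iff top by simp
qed

lemma dual_ball_L1_le:
  assumes r: "r \<ge> 1" and \<phi>: "dual_ball r \<phi>"
  shows "(LINT t|circ. \<bar>\<phi> t\<bar>) \<le> 2 * pi"
proof -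
  have d: "dual_ball r (\<lambda>t. \<bar>\<phi> t\<bar>)" using \<phi> by (auto simp: dual_ball_def)
  have "bdd_borel (\<lambda>_. 1)" by (rule bdd_borelI[of _ 1]) auto
  from Hoelder_dual_ball[OF r d this] have "(LINT t|circ. \<bar>\<phi> t\<bar>) \<le> Lr_norm r (\<lambda>_. 1)" by simp
  also have "\<dots> = (2 * pi) powr (1 / r)" using r Lr_norm_const[of r 1] by simp
  also have "\<dots> \<le> (2 * pi) powr 1" using r pi_gt3 by (intro powr_mono) auto
  finally show ?thesis by simp
qed

text \<open>Of \<open>(2 * pi) powr (- 1 / r)\<close>, the power of 2 belongs to \<open>K_qp\<close>
  and the power of \<open>pi\<close> to the stated denominator; the remaining factor
  \<open>pi\<close> there comes from the convolution formula.\<close>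

lemma main_term_finite:
  assumes q: "0 < q" "q < 1" and p: "p \<ge> 1" and r: "r \<ge> 1"
  shows "Ls_norm (ennreal r) cos / pi powr (1 + enn2real (1 / ennreal r)) * K_qp q p (ennreal r) =
    ((2 * pi) powr (- 1 / r) * Lr_norm r cos * Lr_norm r (\<lambda>t. cmod (vp_mult q p t))) / pi"
proof -
  have e: "enn2real (1 / ennreal r) = 1 / r"
  proof -
    have "1 / ennreal r = ennreal (1 / r)" using r divide_ennreal[of 1 r] by simp
    then show ?thesis using r by simp
  qed
  have "K_qp q p (ennreal r) = 2 powr (- (1 / r)) * Lr_norm r (\<lambda>t. cmod (vp_mult q p t))"
    unfolding K_qp_def e using r by (simp add: Ls_norm_eq_Nr cmod_vp_mult[OF q p])
  moreover have "Ls_norm (ennreal r) cos = Lr_norm r cos" using r by (simp add: Ls_norm_eq_Nr)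
  moreover have "(2 * pi) powr (- 1 / r) = 2 powr (- (1 / r)) * pi powr (- (1 / r))"
    by (simp add: powr_mult)
  moreover have "pi powr (1 + 1 / r) = pi / pi powr (- (1 / r))"
    by (simp add: powr_add powr_minus divide_inverse)
  ultimately show ?thesis unfolding e by simp
qed

lemma dual_ball_Ls_1:
  "r \<ge> 1 \<Longrightarrow> dual_ball r \<phi> \<Longrightarrow> periodic2pi \<phi> \<Longrightarrow> \<phi> \<in> borel_measurable lebesgue \<Longrightarrow> \<phi> \<in> Ls 1"
  by (simp add: Ls_1_iff dual_ball_integrable)

section \<open>Two-sided estimates of the deviation for the individual classes\<close>

context
  fixes q \<beta> :: real and p n m :: nat and Q :: real
  assumes q: "0 < q" "q < 1" and p: "1 \<le> p" "p \<le> n" and m13: "13 / (1 - q) \<le> n - p + 1"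
  defines "m \<equiv> n - p + 1"
  defines "Q \<equiv> q ^ m / (real p * real m)"
begin

lemma m1: "m \<ge> 1" by (simp add: m_def)
lemma m0: "real m > 0" by (simp add: m_def)
lemma m13': "13 / (1 - q) \<le> real m" using m13 p by (simp add: m_def of_nat_diff)
lemma Q0: "Q \<ge> 0" using q by (simp add: Q_def)

text \<open>Passing from the wave to the kernel costs the uniform kernel error times the L1 norm of
  \<open>\<phi>\<close>. The hypothesis \<open>le\<close> collects the numerical comparison that
  each class has to supply.\<close>

lemma pairing_le:
  assumes \<phi>: "integrable circ \<phi>" and W: "\<bar>LINT t|circ. \<phi> t * kernel_wave q \<beta> p m x t\<bar> \<le> W"
    and I: "(LINT t|circ. \<bar>\<phi> t\<bar>) \<le> I"
    and le: "W + 2 * rem_bound q p / m * I \<le> pi * Y"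
  shows "\<bar>LINT t|circ. \<phi> t * vp_kernel q \<beta> m p (x - t)\<bar> / pi \<le> Q * Y"
proof -
  define S where "S = (LINT t|circ. \<phi> t * kernel_wave q \<beta> p m x t)"
  have "\<bar>LINT t|circ. \<phi> t * vp_kernel q \<beta> m p (x - t)\<bar> \<le> Q * \<bar>S\<bar> + Q * (2 * rem_bound q p / m) * (LINT t|circ. \<bar>\<phi> t\<bar>)"
    using pairing_split[OF q p(1) m1 \<phi>, of \<beta> x] Q0 abs_mult[of Q S] unfolding Q_def[symmetric] S_def[symmetric]
    by linarith
  also have "\<dots> \<le> Q * W + Q * (2 * rem_bound q p / m) * I"
    using W I Q0 rem_bound_nonneg[OF q p(1) m1] by (intro add_mono mult_left_mono) (auto simp: S_def)
  also have "\<dots> = Q * (W + 2 * rem_bound q p / m * I)" by (simp add: distrib_left)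
  also have "\<dots> \<le> Q * (pi * Y)" using le Q0 by (intro mult_left_mono) auto
  finally show ?thesis by (simp add: pos_divide_le_eq mult_ac)
qed

lemma pairing_ge:
  assumes \<phi>: "integrable circ \<phi>" and W: "W \<le> (LINT t|circ. \<phi> t * kernel_wave q \<beta> p m x t)"
    and I: "(LINT t|circ. \<bar>\<phi> t\<bar>) \<le> I"
    and le: "pi * Y \<le> W - 2 * rem_bound q p / m * I"
  shows "Q * Y \<le> (LINT t|circ. \<phi> t * vp_kernel q \<beta> m p (x - t)) / pi"
proof -
  define S where "S = (LINT t|circ. \<phi> t * kernel_wave q \<beta> p m x t)"
  have "Q * (pi * Y) \<le> Q * (W - 2 * rem_bound q p / m * I)" using le Q0 by (intro mult_left_mono) auto
  also have "\<dots> = Q * W - Q * (2 * rem_bound q p / m) * I" by (simp add: right_diff_distrib)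
  also have "\<dots> \<le> Q * S - Q * (2 * rem_bound q p / m) * (LINT t|circ. \<bar>\<phi> t\<bar>)"
    using W I Q0 rem_bound_nonneg[OF q p(1) m1] by (intro diff_mono mult_left_mono) (auto simp: S_def)
  also have "\<dots> \<le> (LINT t|circ. \<phi> t * vp_kernel q \<beta> m p (x - t))"
    using pairing_split[OF q p(1) m1 \<phi>, of \<beta> x] unfolding Q_def[symmetric] S_def[symmetric]
    by linarith
  finally show ?thesis by (simp add: pos_le_divide_eq mult_ac)
qed

lemma VP_error_dual_ball:
  assumes r: "r \<ge> 1" and \<sigma>: "\<sigma> = (if p = 1 then (if r = 1 then 1 else 2) else 3)"
    and N: "\<And>\<phi>. \<phi> \<in> N \<longleftrightarrow> periodic2pi \<phi> \<and> \<phi> \<in> borel_measurable lebesgue \<and> dual_ball r \<phi> \<and> (LINT t|circ. \<phi> t) = 0"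
  shows "\<exists>\<rho>. \<bar>\<rho>\<bar> \<le> 200 \<and> VP_error (C_class (neumann_psi q) \<beta> N) n p =
    ereal (Q * ((2 * pi) powr (- 1 / r) * Lr_norm r cos * Lr_norm r (\<lambda>t. cmod (vp_mult q p t)) / pi +
      \<rho> / m * (1 / (1 - q) ^ \<sigma> + rem_bound q p)))"
proof -
  define S where "S = 1 / (1 - q) ^ \<sigma>"
  define R where "R = rem_bound q p"
  define A where "A = (2 * pi) powr (- 1 / r) * Lr_norm r cos * Lr_norm r (\<lambda>t. cmod (vp_mult q p t))"
  have S: "S > 0" using q by (simp add: S_def)
  have R: "R \<ge> 0" unfolding R_def by (rule rem_bound_nonneg[OF q p(1) m1])
  define \<epsilon> where "\<epsilon> x = frozen_phase.err (kernel_amp q \<beta> p m x) m r" for x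
  have \<epsilon>: "\<epsilon> x \<le> 288 * S / m" for x
    using frozen_err_le[OF q p(1) m1 r m13' \<sigma>, of \<beta> x] by (simp add: \<epsilon>_def S_def)
  have Aeq: "(2 * pi) powr (- 1 / r) * Lr_norm r cos * Lr_norm r (\<lambda>t. cmod (kernel_amp q \<beta> p m x t)) = A" for x
    unfolding A_def using r Lr_norm_kernel_amp[OF q p(1) m1, of r \<beta> x] by simp
  \<comment> \<open>576 is twice the 288 of the freezing error and lies below
    \<open>200 * pi\<close>; the \<open>2 * pi\<close> next to \<open>R\<close> bounds the L1 norm
    of members of the dual ball.\<close>
  have num: "576 * S / m + 2 * R / m * (2 * pi) \<le> pi * (200 * (S + R) / m)"
  proof -
    have "576 * S + 4 * pi * R \<le> 200 * pi * S + 200 * pi * R"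
      using S R pi_gt3 by (intro add_mono mult_right_mono) auto
    then have "(576 * S + 4 * pi * R) / m \<le> (200 * pi * S + 200 * pi * R) / m"
      using m0 by (intro divide_right_mono) auto
    then show ?thesis by (simp add: add_divide_distrib distrib_left mult_ac)
  qed
  have "\<exists>\<rho>. \<bar>\<rho>\<bar> \<le> 200 \<and> VP_error (C_class (neumann_psi q) \<beta> N) n p = ereal (q ^ (n - p + 1) / (real p * real (n - p + 1)) * (A / pi + \<rho> / real (n - p + 1) * (S + R)))"
  proof -
    obtain \<psi> where \<psi>: "bdd_borel \<psi>" "\<And>t. \<psi> (t + 2 * pi) = \<psi> t" "(LINT t|circ. \<psi> t) = 0" "dual_ball r \<psi>"
      "(LINT t|circ. \<psi> t * kernel_wave q \<beta> p m 0 t) \<ge> A - 2 * \<epsilon> 0"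
    proof (rule frozen_phase.wave_pairing_extremal[OF frozen_phase_kernel[OF q p(1) m1, of \<beta> 0] r])
      fix \<psi>
      assume a: "bdd_borel \<psi>" "\<And>t. \<psi> (t + 2 * pi) = \<psi> t" "(LINT t|circ. \<psi> t) = 0" "dual_ball r \<psi>"
      assume "(2 * pi) powr (- 1 / r) * Lr_norm r cos * Lr_norm r (\<lambda>t. cmod (kernel_amp q \<beta> p m 0 t))
          - 2 * frozen_phase.err (kernel_amp q \<beta> p m 0) m r
        \<le> (LINT t|circ. \<psi> t * frozen_phase.wave (kernel_amp q \<beta> p m 0) m t)"
      then show ?thesis
        unfolding frozen_wave_kernel[OF q p(1) m1] Aeq \<epsilon>_def[symmetric] by (rule that[OF a])
    qed
    have \<psi>m: "\<psi> \<in> borel_measurable lebesgue" "periodic2pi \<psi>"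
      using \<psi>(1,2) by (auto simp: bdd_borel_def measurable_completion periodic2pi_def)
    show ?thesis
    proof (rule VP_error_sandwich[OF q p, of _ N \<beta> _ _ \<psi>])
      show "0 < S + R" using S R by simp
      fix \<phi> x assume "\<phi> \<in> N"
      then have \<phi>: "dual_ball r \<phi>" by (simp add: N)
      have "\<bar>LINT t|circ. \<phi> t * kernel_wave q \<beta> p m x t\<bar> \<le> A + 2 * \<epsilon> x"
        using frozen_phase.wave_pairing_le[OF frozen_phase_kernel[OF q p(1) m1] r \<phi>, of \<beta> x]
        unfolding frozen_wave_kernel[OF q p(1) m1] Aeq \<epsilon>_def .
      then have "\<bar>LINT t|circ. \<phi> t * kernel_wave q \<beta> p m x t\<bar> \<le> A + 576 * S / m" using \<epsilon>[of x] by simp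
      then show "\<bar>LINT t|circ. \<phi> t * vp_kernel q \<beta> (n - p + 1) p (x - t)\<bar> / pi
          \<le> q ^ (n - p + 1) / (real p * real (n - p + 1)) * (A / pi + 200 * (S + R) / real (n - p + 1))"
        unfolding m_def[symmetric] Q_def[symmetric]
        by (rule pairing_le[OF dual_ball_integrable[OF r \<phi>] _ dual_ball_L1_le[OF r \<phi>]])
          (use num in \<open>simp add: R_def distrib_left\<close>)
    next
      show "\<psi> \<in> N" using \<psi> \<psi>m by (simp add: N)
      show "\<psi> \<in> Ls 1" by (rule dual_ball_Ls_1[OF r \<psi>(4) \<psi>m(2,1)])
      show "(LINT t|circ. \<psi> t) = 0" by (rule \<psi>(3))
      have "A - 576 * S / m \<le> (LINT t|circ. \<psi> t * kernel_wave q \<beta> p m 0 t)" using \<psi>(5) \<epsilon>[of 0] by simp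
      then show "q ^ (n - p + 1) / (real p * real (n - p + 1)) * (A / pi - 200 * (S + R) / real (n - p + 1))
          \<le> (LINT t|circ. \<psi> t * vp_kernel q \<beta> (n - p + 1) p (0 - t)) / pi"
        unfolding m_def[symmetric] Q_def[symmetric]
        by (rule pairing_ge[OF dual_ball_integrable[OF r \<psi>(4)] _ dual_ball_L1_le[OF r \<psi>(4)]])
          (use num in \<open>simp add: R_def right_diff_distrib\<close>)
    qed
  qed
  then show ?thesis by (simp add: Q_def m_def A_def S_def R_def)
qed

lemma vp_mult_max: obtains t0 where "\<And>t. cmod (vp_mult q p t) \<le> cmod (vp_mult q p t0)"
proof -
  have c: "continuous_on UNIV (\<lambda>t. cmod (vp_mult q p t))" by (intro continuous_intros vp_mult_cont[OF q p(1)])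
  obtain t0 where t0: "\<And>t. t \<in> {-pi..pi} \<Longrightarrow> cmod (vp_mult q p t) \<le> cmod (vp_mult q p t0)"
    using continuous_attains_sup[of "{-pi..pi}" "\<lambda>t. cmod (vp_mult q p t)"] continuous_on_subset[OF c] by force
  have "cmod (vp_mult q p t) \<le> cmod (vp_mult q p t0)" for t
  proof -
    obtain k :: int where k: "\<bar>t + of_int k * (2 * pi)\<bar> \<le> pi" by (rule real_mod_2pi)
    have "vp_mult q p t = vp_mult q p (t + of_int k * (2 * pi))"
      by (rule periodic_int_multiple[symmetric]) (rule vp_mult_per[OF q p(1)])
    then show ?thesis using t0[of "t + of_int k * (2 * pi)"] k by (simp add: abs_le_iff)
  qed
  then show ?thesis using that by blast
qed

text \<open>Here \<open>s'\<close> is infinite and the main term is the maximum \<open>M\<close> of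
  the modulus of the amplitude, divided by \<open>pi\<close>. \<open>M\<close> bounds the pairing
  directly; the lower bound tests with bumps near \<open>- t0\<close>, because the kernel at
  \<open>x = 0\<close> is evaluated at \<open>- t\<close>.\<close>

lemma VP_error_U0_1:
  "\<exists>\<rho>. \<bar>\<rho>\<bar> \<le> 200 \<and> VP_error (C_class (neumann_psi q) \<beta> (U0 1)) n p =
    ereal (Q * (Ls_norm \<infinity> cos / pi powr (1 + enn2real (1 / \<infinity>)) * K_qp q p \<infinity> +
      \<rho> / m * (1 / (1 - q) ^ gamma_exp p + rem_bound q p)))"
proof -
  define S where "S = 1 / (1 - q) ^ gamma_exp p"
  define R where "R = rem_bound q p"
  define D where "D = 3 / (1 - q) * amp_bound q p"
  obtain t0 where t0: "\<And>t. cmod (vp_mult q p t) \<le> cmod (vp_mult q p t0)" using vp_mult_max by metis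
  define M where "M = cmod (vp_mult q p t0)"
  have S: "S > 0" using q by (simp add: S_def)
  have R: "R \<ge> 0" unfolding R_def by (rule rem_bound_nonneg[OF q p(1) m1])
  have D: "D \<le> 6 * S" using amp_rate_le[OF q p(1) m1] by (simp add: D_def S_def)
  have main: "Ls_norm \<infinity> cos / pi powr (1 + enn2real (1 / \<infinity>)) * K_qp q p \<infinity> = M / pi"
  proof -
    have "Ls_norm \<infinity> cos = \<bar>cos 0\<bar>" by (rule Ls_norm_infinity_continuous) (auto intro: continuous_intros)
    moreover have "Ls_norm \<infinity> (\<lambda>t. cmod (vp_mult q p t)) = \<bar>M\<bar>"
      unfolding M_def
      by (rule Ls_norm_infinity_continuous) (use t0 in \<open>auto intro!: continuous_intros vp_mult_cont[OF q p(1)] simp: vp_mult_per[OF q p(1)]\<close>)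
    ultimately show ?thesis by (simp add: K_qp_def cmod_vp_mult[OF q p(1), symmetric] M_def)
  qed
  have num: "54 * S / m + 2 * R / m * 1 \<le> pi * (200 * (S + R) / m)"
  proof -
    have "54 * S + 2 * R \<le> (200 * pi) * S + (200 * pi) * R"
      using S R pi_gt3 by (intro add_mono mult_right_mono) auto
    then have "(54 * S + 2 * R) / m \<le> ((200 * pi) * S + (200 * pi) * R) / m"
      using m0 by (intro divide_right_mono) auto
    then show ?thesis by (simp add: add_divide_distrib distrib_left mult_ac)
  qed
  have "\<exists>\<rho>. \<bar>\<rho>\<bar> \<le> 200 \<and> VP_error (C_class (neumann_psi q) \<beta> (U0 1)) n p = ereal (q ^ (n - p + 1) / (real p * real (n - p + 1)) * (M / pi + \<rho> / real (n - p + 1) * (S + R)))"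
  proof -
    have M: "cmod (kernel_amp q \<beta> p m 0 (- t0)) = M" by (simp add: M_def cmod_kernel_amp)
    obtain \<psi> :: "real \<Rightarrow> real" where \<psi>: "continuous_on UNIV \<psi>" "\<And>t. \<psi> (t + 2 * pi) = \<psi> t" "(LINT t|circ. \<psi> t) = 0" "(LINT t|circ. \<bar>\<psi> t\<bar>) \<le> 1"
      "(LINT t|circ. \<psi> t * kernel_wave q \<beta> p m 0 t) \<ge> M - 8 * D / m - S / m"
    proof -
      interpret frozen_phase "kernel_amp q \<beta> p m 0" m
        by (rule frozen_phase_kernel[OF q p(1) m1])
      have "S / m > 0" using S m0 by simp
      show ?thesis
      proof (rule wave_pairing_extremal_L1[OF kernel_lipschitz[OF q p(1) m1] \<open>S / m > 0\<close>, of "- t0"])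
        fix \<psi> :: "real \<Rightarrow> real"
        assume a: "continuous_on UNIV \<psi>" "\<And>t. \<psi> (t + 2 * pi) = \<psi> t" "(LINT t|circ. \<psi> t) = 0" "(LINT t|circ. \<bar>\<psi> t\<bar>) \<le> 1"
        assume "cmod (kernel_amp q \<beta> p m 0 (- t0)) - 8 * (3 / (1 - q) * amp_bound q p) / m - S / m
          \<le> (LINT t|circ. \<psi> t * wave t)"
        then show ?thesis
          unfolding frozen_wave_kernel[OF q p(1) m1] M D_def[symmetric] by (rule that[OF a])
      qed
    qed
    have \<psi>L: "\<psi> \<in> Ls 1"
      using \<psi>(1,2) integrable_circ_continuous[OF \<psi>(1)] borel_measurable_continuous_onI[OF \<psi>(1)]
      by (simp add: Ls_1_iff periodic2pi_def measurable_completion)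
    show ?thesis
    proof (rule VP_error_sandwich[OF q p, of _ "U0 1" \<beta> _ _ \<psi>])
      show "0 < S + R" using S R by simp
      fix \<phi> x assume "\<phi> \<in> U0 1"
      then have \<phi>: "integrable circ \<phi>" "(LINT t|circ. \<bar>\<phi> t\<bar>) \<le> 1" by (auto simp: U0_1_iff Ls_1_iff)
      have M0: "M \<ge> 0" by (simp add: M_def)
      have kb: "\<bar>kernel_wave q \<beta> p m x t\<bar> \<le> M" for t
        using kernel_wave_bound[OF q p(1) m1, of \<beta> x t] t0[of "x - t"] unfolding M_def by linarith
      have "\<bar>LINT t|circ. \<phi> t * kernel_wave q \<beta> p m x t\<bar> \<le> (LINT t|circ. M * \<bar>\<phi> t\<bar>)"
      proof (rule integral_abs_bound[THEN order_trans], rule integral_mono)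
        show "integrable circ (\<lambda>t. \<bar>\<phi> t * kernel_wave q \<beta> p m x t\<bar>)"
          using integrable_mult_bounded_continuous[OF \<phi>(1) kernel_wave_cont[OF q p(1) m1] kb] by simp
        show "\<bar>\<phi> t * kernel_wave q \<beta> p m x t\<bar> \<le> M * \<bar>\<phi> t\<bar>" for t
          unfolding abs_mult using kb[of t] by (subst mult.commute) (intro mult_right_mono, auto)
      qed (use \<phi> in auto)
      also have "\<dots> = M * (LINT t|circ. \<bar>\<phi> t\<bar>)" by (rule integral_mult_right_zero)
      also have "\<dots> \<le> M" using \<phi>(2) M0 by (simp add: mult_left_le)
      finally have "\<bar>LINT t|circ. \<phi> t * kernel_wave q \<beta> p m x t\<bar> \<le> M + 54 * S / m" using S m0 by (simp add: add_increasing2)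
      then show "\<bar>LINT t|circ. \<phi> t * vp_kernel q \<beta> (n - p + 1) p (x - t)\<bar> / pi
          \<le> q ^ (n - p + 1) / (real p * real (n - p + 1)) * (M / pi + 200 * (S + R) / real (n - p + 1))"
        unfolding m_def[symmetric] Q_def[symmetric]
        by (rule pairing_le[OF \<phi>(1) _ \<phi>(2)]) (use num in \<open>simp add: R_def distrib_left\<close>)
    next
      show "\<psi> \<in> U0 1" using \<psi> \<psi>L by (simp add: U0_1_iff)
      show "\<psi> \<in> Ls 1" by (rule \<psi>L)
      show "(LINT t|circ. \<psi> t) = 0" by (rule \<psi>(3))
      \<comment> \<open>Since \<open>D \<le> 6 * S\<close>, the left side is at most
        \<open>49 * S / m\<close>; the tolerance of the bumps was chosen as
        \<open>S / m\<close>.\<close>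
      have "8 * D / m + S / m \<le> 54 * S / m"
        unfolding add_divide_distrib[symmetric] using D S m0 by (intro divide_right_mono) auto
      then have "M - 54 * S / m \<le> (LINT t|circ. \<psi> t * kernel_wave q \<beta> p m 0 t)" using \<psi>(5) by linarith
      then show "q ^ (n - p + 1) / (real p * real (n - p + 1)) * (M / pi - 200 * (S + R) / real (n - p + 1))
          \<le> (LINT t|circ. \<psi> t * vp_kernel q \<beta> (n - p + 1) p (0 - t)) / pi"
        unfolding m_def[symmetric] Q_def[symmetric]
        by (rule pairing_ge[OF integrable_circ_continuous[OF \<psi>(1)] _ \<psi>(4)])
          (use num in \<open>simp add: R_def right_diff_distrib\<close>)
    qed
  qed
  then show ?thesis by (simp only: Q_def m_def main S_def R_def)
qed

text \<open>The kernel annihilates constants. For the upper bound \<open>\<phi>\<close> is therefore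
  replaced by \<open>\<phi> - \<phi> 0\<close>, which is bounded by \<open>\<omega> pi\<close>, and
  the extremal function is made mean zero by subtracting its mean; neither change leaves the class
  or alters the pairing with the kernel.\<close>

lemma VP_error_H_class:
  assumes \<omega>: "modulus_of_continuity \<omega>" "concave_on {0..} \<omega>" and \<omega>0: "\<omega> pi > 0"
  shows "\<exists>\<rho>. \<bar>\<rho>\<bar> \<le> 200 \<and> VP_error (C_class (neumann_psi q) \<beta> (H_class \<omega>)) n p =
    ereal (Q * (4 / pi\<^sup>2 * ((1 - q ^ (2 * p)) / (1 - q\<^sup>2)) * elliptic_K (q ^ p) *
        (LINT t|lebesgue_on {0..pi / 2}. \<omega> (2 * t / m) * sin t) +
      \<rho> / m * (\<omega> pi / (1 - q) ^ gamma_exp p + rem_bound q p * \<omega> (1 / m))))"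
proof -
  define S where "S = \<omega> pi / (1 - q) ^ gamma_exp p"
  define R where "R = rem_bound q p * \<omega> (1 / m)"
  define L where "L x t = cnj (vp_log q p (x - t)) + \<i> * of_real (\<beta> * pi / 2 - real m * x)" for x t
  define L' where "L' x t = - cnj (vp_log' q p (x - t))" for x t
  have m6: "6 / (1 - q) \<le> real m"
  proof -
    have "6 / (1 - q) \<le> 13 / (1 - q)" using q by (intro divide_right_mono) auto
    then show ?thesis using m13' by linarith
  qed
  have sp: "slow_phase (L x) (L' x) m (3 / (1 - q)) (amp_bound q p)" for x
    unfolding L_def L'_def by (rule slow_phase_kernel[OF q p(1) m1 m6])
  have expL: "exp (L x t) = kernel_amp q \<beta> p m x t" for x t
    unfolding kernel_amp_def L_def exp_add exp_cnj[symmetric] exp_vp_log[OF q p(1)] cis_conv_exp by (simp add: mult.commute)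
  have wave: "slow_phase.wave (L x) m = kernel_wave q \<beta> p m x" for x
    by (rule ext) (simp add: slow_phase.wave_def[OF sp] kernel_wave_conj expL)
  define G where "G = integral {0..2*pi} (\<lambda>t. cmod (vp_mult q p t))"
  have total: "slow_phase.total (L x) = G" for x
  proof -
    have c: "continuous_on UNIV (\<lambda>t. cmod (vp_mult q p t))" by (intro continuous_intros vp_mult_cont[OF q p(1)])
    have c': "continuous_on UNIV (\<lambda>t. cmod (vp_mult q p (x - t)))"
      by (intro continuous_on_compose2[OF c] continuous_intros) auto
    have "slow_phase.total (L x) = integral {0..2*pi} (\<lambda>t. cmod (vp_mult q p (x - t)))"
      unfolding slow_phase.total_def[OF sp] slow_phase.amp_eq[OF sp, abs_def] expL cmod_kernel_amp ..
    also have "\<dots> = (LINT t|circ. cmod (vp_mult q p (x - t)))" by (rule LINT_circ_continuous[OF c', symmetric])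
    also have "\<dots> = (LINT t|circ. cmod (vp_mult q p t))"
      using LINT_circ_reflect[of "\<lambda>t. cmod (vp_mult q p t)" x, OF _ c] by (simp add: vp_mult_per[OF q p(1)])
    also have "\<dots> = G" unfolding G_def by (rule LINT_circ_continuous[OF c])
    finally show ?thesis .
  qed
  define \<Omega> where "\<Omega> = integral {0..pi/2} (\<lambda>t. \<omega> (2 * t / m) * sin t)"
  have cm: "slow_phase.cell_max m \<omega> = \<Omega>" unfolding slow_phase.cell_max_def[OF sp] \<Omega>_def ..
  have \<Omega>L: "(LINT t|lebesgue_on {0..pi / 2}. \<omega> (2 * t / m) * sin t) = \<Omega>"
  proof -
    have "continuous_on {0..pi/2} (\<lambda>t. \<omega> (2 * t / m) * sin t)"
      using m0 by (intro continuous_intros continuous_on_compose2[OF modulus_of_continuityD(5)[OF \<omega>(1)]]) auto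
    then show ?thesis unfolding \<Omega>_def
      by (intro lebesgue_integral_eq_integral continuous_imp_integrable_real) auto
  qed
  have main: "4 / pi\<^sup>2 * ((1 - q ^ (2 * p)) / (1 - q\<^sup>2)) * elliptic_K (q ^ p) * \<Omega> = \<Omega> * G / pi / pi"
    unfolding G_def LINT_cmod_vp_mult[OF q p(1)] by (simp add: power2_eq_square mult_ac)
  have S0: "S > 0" using \<omega>0 q by (simp add: S_def)
  have rb: "0 \<le> rem_bound q p" by (rule rem_bound_nonneg[OF q p(1) m1])
  have R: "R \<ge> 0" unfolding R_def using rb by (intro mult_nonneg_nonneg modulus_of_continuityD(3)[OF \<omega>(1)]) auto
  define E where "E = 3 / (1 - q) * amp_bound q p * \<omega> pi / m"
  have E: "E \<le> 6 * S / m"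
    unfolding E_def S_def using mult_right_mono[OF amp_rate_le[OF q p(1) m1], of "\<omega> pi"] \<omega>0 m0
    by (intro divide_right_mono) auto
  have num: "100 * E + 2 * rem_bound q p / m * (2 * pi * \<omega> pi) \<le> pi * (200 * (S + R) / m)"
  proof -
    have "rem_bound q p * \<omega> pi \<le> S"
      unfolding S_def using mult_right_mono[OF rem_bound_le[OF q p(1) m1], of "\<omega> pi"] \<omega>0 by simp
    then have "2 * pi * (2 * (rem_bound q p * \<omega> pi)) \<le> 2 * pi * (2 * S)" by (intro mult_left_mono) auto
    then have "600 * S + 2 * pi * (2 * (rem_bound q p * \<omega> pi)) \<le> 600 * S + 4 * pi * S" by simp
    also have "\<dots> = (600 + 4 * pi) * S" by (simp add: distrib_right)
    \<comment> \<open>The constant 200 is tightest here: 600 is the 100 of the wave estimate times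
      the 6 of the amplitude rate, and \<open>4 * pi\<close> stems from the kernel
      remainder.\<close>
    also have "\<dots> \<le> (200 * pi) * S" using pi_approx S0 by (intro mult_right_mono) auto
    also have "\<dots> \<le> (200 * pi) * S + (200 * pi) * R" using R by simp
    finally have "(600 * S + 2 * pi * (2 * (rem_bound q p * \<omega> pi))) / m \<le> ((200 * pi) * S + (200 * pi) * R) / m"
      using m0 by (intro divide_right_mono) auto
    then have "600 * S / m + 2 * rem_bound q p / m * (2 * pi * \<omega> pi) \<le> pi * (200 * (S + R) / m)"
      by (simp add: add_divide_distrib distrib_left mult_ac)
    then show ?thesis using E by simp
  qed
  have kc: "continuous_on UNIV (\<lambda>t. vp_kernel q \<beta> m p (x - t))" for x
    by (intro continuous_on_compose2[OF continuous_vp_kernel[OF q]] continuous_intros) auto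
  have shift: "(LINT t|circ. (\<phi> t - c) * vp_kernel q \<beta> m p (x - t)) = (LINT t|circ. \<phi> t * vp_kernel q \<beta> m p (x - t))"
    if "continuous_on UNIV \<phi>" for \<phi> c x
  proof -
    have "integrable circ (\<lambda>t. \<phi> t * vp_kernel q \<beta> m p (x - t))" "integrable circ (\<lambda>t. c * vp_kernel q \<beta> m p (x - t))"
      by (intro integrable_circ_continuous continuous_intros kc that)+
    then show ?thesis using LINT_vp_kernel[OF q m1, of \<beta> p x] by (simp add: left_diff_distrib)
  qed
  have Hc: "continuous_on UNIV \<phi>" if "\<phi> \<in> H_class \<omega>" for \<phi> using that by (simp add: H_class_def C_per_def)
  have Hshift: "(\<lambda>t. \<phi> t - c) \<in> H_class \<omega>" if "\<phi> \<in> H_class \<omega>" for \<phi> c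
  proof (rule H_classI[OF _ _ \<omega>(1)])
    show "(\<lambda>t. \<phi> t - c) \<in> C_per" using that by (auto simp: H_class_def C_per_def periodic2pi_def intro!: continuous_intros)
    show "\<bar>(\<phi> x - c) - (\<phi> y - c)\<bar> \<le> \<omega> \<bar>x - y\<bar>" for x y using H_classD[OF that, of x y] by simp
  qed
  have L1: "(LINT t|circ. \<bar>\<phi> t\<bar>) \<le> 2 * pi * \<omega> pi" if "continuous_on UNIV \<phi>" "\<And>t. \<bar>\<phi> t\<bar> \<le> \<omega> pi" for \<phi>
  proof -
    have "(LINT t|circ. \<bar>\<phi> t\<bar>) \<le> (LINT t|circ. \<omega> pi)"
      using that by (intro integral_mono integrable_circ_continuous continuous_intros) auto
    then show ?thesis by simp
  qed
  have wI: "(LINT t|circ. \<phi> t * kernel_wave q \<beta> p m x t) = integral {0..2*pi} (\<lambda>t. \<phi> t * kernel_wave q \<beta> p m x t)"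
    if "continuous_on UNIV \<phi>" for \<phi> x
    by (intro LINT_circ_continuous continuous_intros that kernel_wave_cont[OF q p(1) m1])
  have "\<exists>\<rho>. \<bar>\<rho>\<bar> \<le> 200 \<and> VP_error (C_class (neumann_psi q) \<beta> (H_class \<omega>)) n p =
      ereal (q ^ (n - p + 1) / (real p * real (n - p + 1)) * (\<Omega> * G / pi / pi + \<rho> / real (n - p + 1) * (S + R)))"
  proof -
    obtain \<psi> where \<psi>: "\<psi> \<in> H_class \<omega>" "\<And>t. \<bar>\<psi> t\<bar> \<le> \<omega> pi"
      "integral {0..2*pi} (\<lambda>t. \<psi> t * kernel_wave q \<beta> p m 0 t) \<ge> \<Omega> * G / pi - 100 * E"
    proof (rule slow_phase.integral_wave_extremal[OF sp[of 0] \<omega>])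
      fix \<psi>
      assume a: "\<psi> \<in> H_class \<omega>" "\<And>t. \<bar>\<psi> t\<bar> \<le> \<omega> pi"
      assume "slow_phase.cell_max m \<omega> * slow_phase.total (L 0) / pi - 100 * (3 / (1 - q) * amp_bound q p * \<omega> pi / m)
        \<le> integral {0..2*pi} (\<lambda>t. \<psi> t * slow_phase.wave (L 0) m t)"
      then show ?thesis unfolding cm total wave E_def[symmetric] by (rule that[OF a])
    qed
    define c where "c = (LINT t|circ. \<psi> t) / (2 * pi)"
    have \<psi>i: "integrable circ \<psi>" by (rule integrable_circ_continuous[OF Hc[OF \<psi>(1)]])
    have mean: "(LINT t|circ. \<psi> t - c) = 0"
    proof -
      have "integrable circ (\<lambda>t. c)" by (rule integrable_circ_continuous) simp
      then show ?thesis using \<psi>i by (simp add: c_def)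
    qed
    have \<psi>c: "(\<lambda>t. \<psi> t - c) \<in> H_class \<omega>" by (rule Hshift[OF \<psi>(1)])
    show ?thesis
    proof (rule VP_error_sandwich[OF q p, of _ "H_class \<omega>" \<beta> _ _ "\<lambda>t. \<psi> t - c"])
      show "0 < S + R" using S0 R by simp
      fix \<phi> x assume \<phi>: "\<phi> \<in> H_class \<omega>"
      define \<phi>' where "\<phi>' t = \<phi> t - \<phi> 0" for t
      have H: "\<phi>' \<in> H_class \<omega>" unfolding \<phi>'_def by (rule Hshift[OF \<phi>])
      have b: "\<bar>\<phi>' t\<bar> \<le> \<omega> pi" for t unfolding \<phi>'_def by (rule H_class_oscillation[OF \<phi> \<omega>(1)])
      have "\<bar>integral {0..2*pi} (\<lambda>t. \<phi>' t * kernel_wave q \<beta> p m x t)\<bar> \<le> \<Omega> * G / pi + 100 * E"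
        using slow_phase.integral_wave_le[OF sp \<omega> H b, of x] unfolding cm total wave E_def .
      then have "\<bar>LINT t|circ. \<phi>' t * kernel_wave q \<beta> p m x t\<bar> \<le> \<Omega> * G / pi + 100 * E"
        unfolding wI[OF Hc[OF H]] .
      then have "\<bar>LINT t|circ. \<phi>' t * vp_kernel q \<beta> m p (x - t)\<bar> / pi \<le> Q * (\<Omega> * G / pi / pi + 200 * (S + R) / m)"
        by (rule pairing_le[OF integrable_circ_continuous[OF Hc[OF H]] _ L1[OF Hc[OF H] b]])
          (use num in \<open>simp add: distrib_left\<close>)
      then show "\<bar>LINT t|circ. \<phi> t * vp_kernel q \<beta> (n - p + 1) p (x - t)\<bar> / pi
          \<le> q ^ (n - p + 1) / (real p * real (n - p + 1)) * (\<Omega> * G / pi / pi + 200 * (S + R) / real (n - p + 1))"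
        unfolding m_def[symmetric] Q_def[symmetric] \<phi>'_def shift[OF Hc[OF \<phi>]] .
    next
      show "(\<lambda>t. \<psi> t - c) \<in> H_class \<omega>" by (rule \<psi>c)
      show "(\<lambda>t. \<psi> t - c) \<in> Ls 1"
        using \<psi>c integrable_circ_continuous[OF Hc[OF \<psi>c]] borel_measurable_continuous_onI[OF Hc[OF \<psi>c]]
        by (simp add: Ls_1_iff H_class_def C_per_def measurable_completion)
      show "(LINT t|circ. \<psi> t - c) = 0" by (rule mean)
      have "\<Omega> * G / pi - 100 * E \<le> (LINT t|circ. \<psi> t * kernel_wave q \<beta> p m 0 t)"
        using \<psi>(3) unfolding wI[OF Hc[OF \<psi>(1)]] .
      then have "Q * (\<Omega> * G / pi / pi - 200 * (S + R) / m) \<le> (LINT t|circ. \<psi> t * vp_kernel q \<beta> m p (0 - t)) / pi"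
        by (rule pairing_ge[OF \<psi>i _ L1[OF Hc[OF \<psi>(1)] \<psi>(2)]])
          (use num in \<open>simp add: right_diff_distrib\<close>)
      then show "q ^ (n - p + 1) / (real p * real (n - p + 1)) * (\<Omega> * G / pi / pi - 200 * (S + R) / real (n - p + 1))
          \<le> (LINT t|circ. (\<psi> t - c) * vp_kernel q \<beta> (n - p + 1) p (0 - t)) / pi"
        unfolding m_def[symmetric] Q_def[symmetric] shift[OF Hc[OF \<psi>(1)]] .
    qed
  qed
  then show ?thesis unfolding \<Omega>L main by (simp only: Q_def m_def S_def R_def)
qed

end

text \<open>The limit condition makes \<open>\<omega>\<close> positive at some point near 0, and
  monotonicity carries this to \<open>pi\<close>. A positive \<open>\<omega> pi\<close> keeps the
  error weight positive, so that the bounded quantity can be solved for.\<close>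

lemma modulus_pi_pos:
  assumes \<omega>: "modulus_of_continuity \<omega>" and lim: "filterlim (\<lambda>t. \<omega> t / t) at_top (at_right 0)"
  shows "\<omega> pi > 0"
proof -
  have "\<forall>\<^sub>F t in at_right 0. \<omega> t / t > 0" using lim by (simp add: filterlim_at_top_dense)
  moreover have "\<forall>\<^sub>F t in at_right 0. t \<in> {0<..<pi}" by (rule eventually_at_right_real) simp
  ultimately have "\<forall>\<^sub>F t in at_right (0::real). \<omega> t / t > 0 \<and> t \<in> {0<..<pi}" by (rule eventually_conj)
  then obtain t where "\<omega> t / t > 0" "t \<in> {0<..<pi}" using eventually_happens[of _ "at_right (0::real)"] by auto
  then show ?thesis using modulus_of_continuityD(1)[OF \<omega>, of t pi] by (simp add: zero_less_divide_iff)
qed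

lemma VP_error_U0:
  assumes q: "0 < q" "q < 1" and p: "1 \<le> p" "p \<le> n" and m13: "13 / (1 - q) \<le> n - p + 1" and s: "1 \<le> s"
  defines "s' \<equiv> conj_exponent s"
  shows "\<exists>r. \<bar>r\<bar> \<le> 200 \<and> VP_error (C_class (neumann_psi q) \<beta> (U0 s)) n p =
    ereal (q ^ (n - p + 1) / (real p * real (n - p + 1)) *
      (Ls_norm s' cos / pi powr (1 + enn2real (1 / s')) * K_qp q p s' +
       r / real (n - p + 1) * (1 / (1 - q) ^ sigma_exp s' p + rem_bound q p)))"
proof (cases "s = 1")
  case True
  then have s': "s' = \<infinity>" by (simp add: s'_def conj_exponent_def)
  have "sigma_exp \<infinity> p = gamma_exp p" by (simp add: sigma_exp_def gamma_exp_def)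
  then show ?thesis using VP_error_U0_1[OF q p m13, of \<beta>] unfolding True s' by simp
next
  case False
  then have "1 < s" using s by (simp add: less_le)
  then obtain r where r: "r \<ge> 1" "s' = ennreal r"
    "\<And>\<phi>. \<phi> \<in> U0 s \<longleftrightarrow> periodic2pi \<phi> \<and> \<phi> \<in> borel_measurable lebesgue \<and> dual_ball r \<phi> \<and> (LINT t|circ. \<phi> t) = 0"
    using conj_exponent_dual_ball unfolding s'_def by metis
  have "sigma_exp s' p = (if p = 1 then (if r = 1 then 1 else 2) else 3)"
    using r(1,2) by (simp add: sigma_exp_def)
  from VP_error_dual_ball[OF q p m13 r(1) this r(3), of \<beta>]
  show ?thesis unfolding main_term_finite[OF q p(1) r(1), folded r(2), symmetric] .
qed

lemma nat_ceiling_le_diff: "nat \<lceil>x\<rceil> \<le> n - p \<Longrightarrow> x \<le> real (n - p + 1)"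
  by linarith

theorem corollary4:
  shows "\<exists>K::real. \<forall>q::real. 0 < q \<and> q < 1 \<longrightarrow> (\<exists>N::nat. \<forall>n p :: nat.
    1 \<le> p \<and> p \<le> n \<and> N \<le> n - p \<longrightarrow>
    (\<forall>(\<beta>::real) (s::ennreal) (s'::ennreal). 1 \<le> s \<and> s' = conj_exponent s \<longrightarrow>
      (\<exists>r::real. \<bar>r\<bar> \<le> K \<and>
        VP_error (C_class (neumann_psi q) \<beta> (U0 s)) n p =
        ereal (q ^ (n - p + 1) / (real p * real (n - p + 1)) *
          (Ls_norm s' cos / pi powr (1 + enn2real (1 / s')) * K_qp q p s' +
           r / real (n - p + 1) *
             (1 / (1 - q) ^ sigma_exp s' p +
              q / (1 - q)\<^sup>2 * min (real p) (1 / (1 - q))))))) \<and>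
    (\<forall>(\<beta>::real) (\<omega>::real \<Rightarrow> real).
      modulus_of_continuity \<omega> \<and> concave_on {0..} \<omega> \<and>
      filterlim (\<lambda>t. \<omega> t / t) at_top (at_right 0) \<longrightarrow>
      (\<exists>r::real. \<bar>r\<bar> \<le> K \<and>
        VP_error (C_class (neumann_psi q) \<beta> (H_class \<omega>)) n p =
        ereal (q ^ (n - p + 1) / (real p * real (n - p + 1)) *
          (4 / pi\<^sup>2 * ((1 - q ^ (2 * p)) / (1 - q\<^sup>2)) * elliptic_K (q ^ p) *
             (LINT t|lebesgue_on {0..pi / 2}. \<omega> (2 * t / real (n - p + 1)) * sin t) +
           r / real (n - p + 1) *
             (\<omega> pi / (1 - q) ^ gamma_exp p +
              q / (1 - q)\<^sup>2 * min (real p) (1 / (1 - q)) * \<omega> (1 / real (n - p + 1))))))))"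
  apply (rule exI[of _ "200::real"], intro allI impI, elim conjE)
  subgoal for q
    \<comment> \<open>The 13 exceeds both \<open>4 * pi\<close>, needed for the quadratic freezing
      estimate, and 6, needed for the phase to be slow.\<close>
    apply (rule exI[of _ "nat \<lceil>13 / (1 - q)\<rceil>"], intro allI impI conjI; elim conjE)
    subgoal for n p \<beta> s s'
      using VP_error_U0[of q p n s \<beta>] nat_ceiling_le_diff[of "13 / (1 - q)" n p]
      by (simp only: rem_bound_def)
    subgoal for n p \<beta> \<omega>
      using VP_error_H_class[of q p n \<omega> \<beta>] nat_ceiling_le_diff[of "13 / (1 - q)" n p] modulus_pi_pos[of \<omega>]
      by (simp only: rem_bound_def)
    done
  done

end
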